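(* Let $k$ be an algebraically closed field and let $\Lambda_3$ be the path algebra over $k$ of the $3$-Kronecker quiver $Q_3$ (two vertices $x,y$ and three arrows from $x$ to $y$). Let $P_0,P_1,P_2,\dots$ be the indecomposable preprojective $\Lambda_3$-modules in their natural order, i.e. $P_0$ is the simple projective module at $y$, $P_1$ is the indecomposable projective module at $x$, and $P_{i+2}=\tau^{-1}P_i$ for $i\ge0$, where $\tau$ is the Auslander-Reiten translation. Then $P_i$ is accessible for all $0\le i\le 4$.
   Context: All modules are finite-dimensional. Accessible modules over a finite-dimensional algebra are defined inductively: every simple module is accessible; a module $M$ of length $l>1$ is accessible if $M$ is indecomposable and has an accessible submodule or factor module of length $l-1$. *)

theory Defs
  imports
    "HOL-Computational_Algebra.Polynomial"
    "Graph_Theory.Arc_Walk"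
    "HOL-Algebra.AbelCoset"
    "HOL-Algebra.Module"
begin

section \<open>Modules over a noncommutative ring\<close>

text \<open>
  The library locale for modules requires a commutative ring of scalars. Its record type (whose
  fields \<open>mult\<close> and \<open>one\<close> play no role for modules), its submodules and its cosets are used below.
\<close>

locale left_module = R?: ring R + M?: abelian_group M
  for R :: "('a, 'r) ring_scheme" (structure) and M :: "('a, 'm, 's) module_scheme" (structure) +
  assumes smult_closed [simp, intro]:
      "\<lbrakk>a \<in> carrier R; x \<in> carrier M\<rbrakk> \<Longrightarrow> a \<odot>\<^bsub>M\<^esub> x \<in> carrier M"
    and smult_l_distr:
      "\<lbrakk>a \<in> carrier R; b \<in> carrier R; x \<in> carrier M\<rbrakk> \<Longrightarrow>
      (a \<oplus> b) \<odot>\<^bsub>M\<^esub> x = a \<odot>\<^bsub>M\<^esub> x \<oplus>\<^bsub>M\<^esub> b \<odot>\<^bsub>M\<^esub> x"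
    and smult_r_distr:
      "\<lbrakk>a \<in> carrier R; x \<in> carrier M; y \<in> carrier M\<rbrakk> \<Longrightarrow>
      a \<odot>\<^bsub>M\<^esub> (x \<oplus>\<^bsub>M\<^esub> y) = a \<odot>\<^bsub>M\<^esub> x \<oplus>\<^bsub>M\<^esub> a \<odot>\<^bsub>M\<^esub> y"
    and smult_assoc1:
      "\<lbrakk>a \<in> carrier R; b \<in> carrier R; x \<in> carrier M\<rbrakk> \<Longrightarrow>
      (a \<otimes> b) \<odot>\<^bsub>M\<^esub> x = a \<odot>\<^bsub>M\<^esub> (b \<odot>\<^bsub>M\<^esub> x)"
    and smult_one [simp]:
      "x \<in> carrier M \<Longrightarrow> \<one> \<odot>\<^bsub>M\<^esub> x = x"

definition mod_hom :: "('a, 'r) ring_scheme \<Rightarrow> ('a, 'm) module \<Rightarrow> ('a, 'n) module \<Rightarrow> ('m \<Rightarrow> 'n) set" where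
  "mod_hom R M N = {h \<in> carrier M \<rightarrow> carrier N.
     (\<forall>x\<in>carrier M. \<forall>y\<in>carrier M. h (x \<oplus>\<^bsub>M\<^esub> y) = h x \<oplus>\<^bsub>N\<^esub> h y) \<and>
     (\<forall>a\<in>carrier R. \<forall>x\<in>carrier M. h (a \<odot>\<^bsub>M\<^esub> x) = a \<odot>\<^bsub>N\<^esub> h x)}"

definition mod_isomorphic :: "('a, 'r) ring_scheme \<Rightarrow> ('a, 'm) module \<Rightarrow> ('a, 'n) module \<Rightarrow> bool" where
  "mod_isomorphic R M N \<longleftrightarrow> (\<exists>h\<in>mod_hom R M N. bij_betw h (carrier M) (carrier N))"

definition quot_module :: "('a, 'm) module \<Rightarrow> 'm set \<Rightarrow> ('a, 'm set) module" where
  "quot_module M U =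
     \<lparr>carrier = a_rcosets\<^bsub>M\<^esub> U, mult = undefined, one = undefined,
      zero = U, add = set_add M,
      smult = (\<lambda>a X. \<Union>x\<in>X. U +>\<^bsub>M\<^esub> (a \<odot>\<^bsub>M\<^esub> x))\<rparr>"

definition simple_module :: "('a, 'r) ring_scheme \<Rightarrow> ('a, 'm) module \<Rightarrow> bool" where
  "simple_module R M \<longleftrightarrow> carrier M \<noteq> {\<zero>\<^bsub>M\<^esub>} \<and>
     (\<forall>U. submodule U R M \<longrightarrow> U = {\<zero>\<^bsub>M\<^esub>} \<or> U = carrier M)"

definition indecomposable_module :: "('a, 'r) ring_scheme \<Rightarrow> ('a, 'm) module \<Rightarrow> bool" where
  "indecomposable_module R M \<longleftrightarrow> carrier M \<noteq> {\<zero>\<^bsub>M\<^esub>} \<and>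
     (\<forall>U V. submodule U R M \<and> submodule V R M \<and>
        U \<inter> V = {\<zero>\<^bsub>M\<^esub>} \<and> U <+>\<^bsub>M\<^esub> V = carrier M \<longrightarrow> U = {\<zero>\<^bsub>M\<^esub>} \<or> V = {\<zero>\<^bsub>M\<^esub>})"

text \<open>
  \<open>M\<close> has length \<open>n\<close> iff it has a composition series with \<open>n\<close> factors; by Jordan--Hoelder
  there is at most one such \<open>n\<close>.
\<close>

definition has_length :: "('a, 'r) ring_scheme \<Rightarrow> ('a, 'm) module \<Rightarrow> nat \<Rightarrow> bool" where
  "has_length R M n \<longleftrightarrow> (\<exists>U :: nat \<Rightarrow> 'm set.
     U 0 = {\<zero>\<^bsub>M\<^esub>} \<and> U n = carrier M \<and> (\<forall>i\<le>n. submodule (U i) R M) \<and>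
     (\<forall>i<n. U i \<subseteq> U (Suc i) \<and>
        simple_module R (quot_module (M\<lparr>carrier := U (Suc i)\<rparr>) (U i))))"


section \<open>Finite-dimensional modules over an algebra\<close>

text \<open>
  A \<open>k\<close>-algebra is a record of type \<open>('k, 'a) module\<close>: the ring operations together with a scalar
  multiplication by \<open>k\<close>. The field \<open>k\<close> acts on a module through \<open>c \<mapsto> c \<odot> \<one>\<close>.
\<close>

definition scalar :: "('k, 'a) module \<Rightarrow> 'k \<Rightarrow> 'a" where
  "scalar A c = c \<odot>\<^bsub>A\<^esub> \<one>\<^bsub>A\<^esub>"

definition fd_module :: "('k::field, 'a) module \<Rightarrow> ('a, 'm) module \<Rightarrow> bool" where
  "fd_module A M \<longleftrightarrow> left_module A M \<and>
     (\<exists>S. finite S \<and> S \<subseteq> carrier M \<and>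
        (\<forall>x\<in>carrier M. \<exists>c :: 'm \<Rightarrow> 'k. x = (\<Oplus>\<^bsub>M\<^esub>s\<in>S. scalar A (c s) \<odot>\<^bsub>M\<^esub> s)))"

text \<open>
  In the last rule, \<open>N\<close> is a copy of the factor module \<open>M/U\<close> on the carrier type of \<open>M\<close>. This is no
  restriction: a set of coset representatives can serve as carrier.
\<close>

inductive accessible :: "('k::field, 'a) module \<Rightarrow> ('a, 'm) module \<Rightarrow> bool"
  for A :: "('k, 'a) module" where
  simple: "\<lbrakk>fd_module A M; simple_module A M\<rbrakk> \<Longrightarrow> accessible A M"
| sub: "\<lbrakk>fd_module A M; has_length A M l; l > 1; indecomposable_module A M;
     submodule U A M; has_length A (M\<lparr>carrier := U\<rparr>) (l - 1);
     accessible A (M\<lparr>carrier := U\<rparr>)\<rbrakk> \<Longrightarrow> accessible A M"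
| factor: "\<lbrakk>fd_module A M; has_length A M l; l > 1; indecomposable_module A M;
     submodule U A M; mod_isomorphic A (quot_module M U) N; has_length A N (l - 1);
     accessible A N\<rbrakk> \<Longrightarrow> accessible A M"


section \<open>The Auslander--Reiten translation\<close>

definition regular_module :: "('k, 'a) module \<Rightarrow> ('a, 'a) module" where
  "regular_module A =
     \<lparr>carrier = carrier A, mult = mult A, one = one A, zero = zero A, add = add A, smult = mult A\<rparr>"

text \<open>Right \<open>A\<close>-modules are left modules over \<open>opp A\<close>. Note that \<open>opp (opp A) = A\<close>.\<close>

definition opp :: "('k, 'a) module \<Rightarrow> ('k, 'a) module" where
  "opp A = A\<lparr>mult := \<lambda>a b. b \<otimes>\<^bsub>A\<^esub> a\<rparr>"

text \<open>\<open>D M = Hom\<^sub>k(M, k)\<close>, a left module over \<open>opp A\<close>.\<close>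

definition dual_module :: "('k::field, 'a) module \<Rightarrow> ('a, 'm) module \<Rightarrow> ('a, 'm \<Rightarrow> 'k) module" where
  "dual_module A M =
     \<lparr>carrier = {\<phi> \<in> extensional (carrier M).
        (\<forall>x\<in>carrier M. \<forall>y\<in>carrier M. \<phi> (x \<oplus>\<^bsub>M\<^esub> y) = \<phi> x + \<phi> y) \<and>
        (\<forall>c. \<forall>x\<in>carrier M. \<phi> (scalar A c \<odot>\<^bsub>M\<^esub> x) = c * \<phi> x)},
      mult = undefined, one = undefined,
      zero = (\<lambda>x\<in>carrier M. 0),
      add = (\<lambda>\<phi> \<psi>. \<lambda>x\<in>carrier M. \<phi> x + \<psi> x),
      smult = (\<lambda>a \<phi>. \<lambda>x\<in>carrier M. \<phi> (a \<odot>\<^bsub>M\<^esub> x))\<rparr>"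

text \<open>\<open>P\<^sup>t = Hom\<^sub>A(P, A)\<close>, a left module over \<open>opp A\<close>.\<close>

definition hom_module :: "('k, 'a) module \<Rightarrow> ('a, 'm) module \<Rightarrow> ('a, 'm \<Rightarrow> 'a) module" where
  "hom_module A P =
     \<lparr>carrier = mod_hom A P (regular_module A) \<inter> extensional (carrier P),
      mult = undefined, one = undefined,
      zero = (\<lambda>p\<in>carrier P. \<zero>\<^bsub>A\<^esub>),
      add = (\<lambda>\<phi> \<psi>. \<lambda>p\<in>carrier P. \<phi> p \<oplus>\<^bsub>A\<^esub> \<psi> p),
      smult = (\<lambda>a \<phi>. \<lambda>p\<in>carrier P. \<phi> p \<otimes>\<^bsub>A\<^esub> a)\<rparr>"

definition free_module :: "('k, 'a) module \<Rightarrow> nat \<Rightarrow> ('a, nat \<Rightarrow> 'a) module" where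
  "free_module A n =
     \<lparr>carrier = {..<n} \<rightarrow>\<^sub>E carrier A, mult = undefined, one = undefined,
      zero = (\<lambda>i\<in>{..<n}. \<zero>\<^bsub>A\<^esub>),
      add = (\<lambda>f g. \<lambda>i\<in>{..<n}. f i \<oplus>\<^bsub>A\<^esub> g i),
      smult = (\<lambda>a f. \<lambda>i\<in>{..<n}. a \<otimes>\<^bsub>A\<^esub> f i)\<rparr>"

text \<open>Finitely generated projective modules: direct summands of free modules of finite rank.\<close>

definition projective_module :: "('k, 'a) module \<Rightarrow> ('a, 'm) module \<Rightarrow> bool" where
  "projective_module A P \<longleftrightarrow> (\<exists>n. \<exists>s\<in>mod_hom A P (free_module A n).
     \<exists>r\<in>mod_hom A (free_module A n) P. \<forall>x\<in>carrier P. r (s x) = x)"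

definition superfluous :: "('a, 'r) ring_scheme \<Rightarrow> ('a, 'm) module \<Rightarrow> 'm set \<Rightarrow> bool" where
  "superfluous R M K \<longleftrightarrow>
     (\<forall>U. submodule U R M \<and> U <+>\<^bsub>M\<^esub> K = carrier M \<longrightarrow> U = carrier M)"

definition projective_cover ::
  "('k::field, 'a) module \<Rightarrow> ('a, 'p) module \<Rightarrow> ('p \<Rightarrow> 'm) \<Rightarrow> ('a, 'm) module \<Rightarrow> bool" where
  "projective_cover A P h M \<longleftrightarrow> fd_module A P \<and> projective_module A P \<and>
     h \<in> mod_hom A P M \<and> h ` carrier P = carrier M \<and> superfluous A P (a_kernel P M h)"

text \<open>\<open>P1 \<rightarrow> P0 \<rightarrow> M \<rightarrow> 0\<close> with maps \<open>f\<close> and \<open>g\<close>.\<close>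

definition minimal_projective_presentation ::
  "('k::field, 'a) module \<Rightarrow> ('a, 'p) module \<Rightarrow> ('p \<Rightarrow> 'q) \<Rightarrow> ('a, 'q) module \<Rightarrow> ('q \<Rightarrow> 'm) \<Rightarrow>
    ('a, 'm) module \<Rightarrow> bool" where
  "minimal_projective_presentation A P1 f P0 g M \<longleftrightarrow>
     projective_cover A P0 g M \<and> projective_cover A P1 f (P0\<lparr>carrier := a_kernel P0 M g\<rparr>)"

text \<open>
  \<open>N\<close> is (isomorphic to) the transpose of \<open>M\<close>, i.e. the cokernel of \<open>P0\<^sup>t \<rightarrow> P1\<^sup>t\<close> for a
  minimal projective presentation of \<open>M\<close>. Every finitely generated projective \<open>A\<close>-module
  is isomorphic to a submodule of some \<open>A\<^sup>n\<close>, whence the choice of carrier type for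
  \<open>P1\<close> and \<open>P0\<close>.
\<close>

definition is_transpose :: "('k::field, 'a) module \<Rightarrow> ('a, 'm) module \<Rightarrow> ('a, 'n) module \<Rightarrow> bool" where
  "is_transpose A M N \<longleftrightarrow>
     (\<exists>(P1 :: ('a, nat \<Rightarrow> 'a) module) f (P0 :: ('a, nat \<Rightarrow> 'a) module) g.
        minimal_projective_presentation A P1 f P0 g M \<and>
        mod_isomorphic (opp A)
          (quot_module (hom_module A P1)
            ((\<lambda>\<phi>. \<lambda>p\<in>carrier P1. \<phi> (f p)) ` carrier (hom_module A P0)))
          N)"

text \<open>\<open>N\<close> is (isomorphic to) \<open>\<tau>\<^sup>-\<^sup>1 M\<close>, where \<open>\<tau> = D Tr\<close> and hence \<open>\<tau>\<^sup>-\<^sup>1 = Tr D\<close>.\<close>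

definition is_tau_inverse :: "('k::field, 'a) module \<Rightarrow> ('a, 'm) module \<Rightarrow> ('a, 'n) module \<Rightarrow> bool" where
  "is_tau_inverse A M N \<longleftrightarrow> is_transpose (opp A) (dual_module A M) N"


section \<open>Path algebras and Kronecker quivers\<close>

text \<open>
  A quiver is a digraph with multiple arcs. A path is a pair of its starting vertex and its list of
  arcs, in the order in which they are traversed.
\<close>

definition paths :: "('v, 'e) pre_digraph \<Rightarrow> ('v \<times> 'e list) set" where
  "paths Q = {(u, p). \<exists>v. pre_digraph.awalk Q u p v}"

text \<open>
  Elements are finitely supported functions on the set of paths. The product \<open>p q\<close> of two
  paths is the path that traverses \<open>q\<close> first and \<open>p\<close> afterwards (and \<open>0\<close> if \<open>p\<close> does
  not start where \<open>q\<close> ends); thus left modules are the covariant representations of the quiver.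
  The coefficient of a path \<open>(u, r)\<close> in \<open>f \<otimes> g\<close> is the sum over all factorisations of this path.
\<close>

definition path_algebra :: "('v, 'e) pre_digraph \<Rightarrow> ('k::field, 'v \<times> 'e list \<Rightarrow> 'k) module" where
  "path_algebra Q =
     \<lparr>carrier = {f. finite {p. f p \<noteq> 0} \<and> {p. f p \<noteq> 0} \<subseteq> paths Q},
      mult = (\<lambda>f g (u, r). \<Sum>i\<le>length r.
        f (last (pre_digraph.awalk_verts Q u (take i r)), drop i r) * g (u, take i r)),
      one = (\<lambda>(u, r). if u \<in> verts Q \<and> r = [] then 1 else 0),
      zero = (\<lambda>_. 0),
      add = (\<lambda>f g p. f p + g p),
      smult = (\<lambda>c f p. c * f p)\<rparr>"

definition vertex_idempotent :: "'v \<Rightarrow> 'v \<times> 'e list \<Rightarrow> 'k::field" where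
  "vertex_idempotent v = (\<lambda>p. if p = (v, []) then 1 else 0)"

text \<open>The indecomposable projective module \<open>A e\<^sub>v\<close> at the vertex \<open>v\<close>.\<close>

definition vertex_projective ::
  "('v, 'e) pre_digraph \<Rightarrow> 'v \<Rightarrow> ('v \<times> 'e list \<Rightarrow> 'k::field, 'v \<times> 'e list \<Rightarrow> 'k) module" where
  "vertex_projective Q v = (regular_module (path_algebra Q))
     \<lparr>carrier := (\<lambda>a. a \<otimes>\<^bsub>path_algebra Q\<^esub> vertex_idempotent v) ` carrier (path_algebra Q)\<rparr>"

datatype kronecker_vertex = VX | VY

definition kronecker_quiver :: "nat \<Rightarrow> (kronecker_vertex, nat) pre_digraph" where
  "kronecker_quiver n = \<lparr>verts = {VX, VY}, arcs = {..<n}, tail = (\<lambda>_. VX), head = (\<lambda>_. VY)\<rparr>"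

end

theory Submission
  imports Defs "HOL-Library.Product_Plus"
begin

text \<open>
  The modules \<open>P\<^sub>1\<close>, \<open>P\<^sub>2\<close>, \<open>P\<^sub>3\<close>, \<open>P\<^sub>4\<close> are factor modules of \<open>(\<Lambda>\<^sub>3 e\<^sub>x)\<^sup>n\<close> for \<open>n = 1, 3, 8, 21\<close>. Indeed, if \<open>P\<^sub>i\<close> has the
  dimension vector \<open>(l, n)\<close> and \<open>P\<^sub>i\<^sub>+\<^sub>1\<close> has the dimension vector \<open>(n, d)\<close>, then \<open>D P\<^sub>i\<close> has the minimal projective
  presentation \<open>(e\<^sub>x \<Lambda>\<^sub>3)\<^sup>d \<rightarrow> (e\<^sub>y \<Lambda>\<^sub>3)\<^sup>n \<rightarrow> D P\<^sub>i\<close>, whose first map is given by the arrows of \<open>P\<^sub>i\<^sub>+\<^sub>1\<close>. Hence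
  \<open>P\<^sub>i\<^sub>+\<^sub>2 = \<tau>\<^sup>-\<^sup>1 P\<^sub>i\<close> is the factor module of \<open>(\<Lambda>\<^sub>3 e\<^sub>x)\<^sup>d\<close> by the relations \<open>(a v, b v, c v)\<close> with \<open>v \<in> k\<^sup>n\<close>.

  Identify \<open>k\<^sup>d\<close> with the polynomials in \<open>x\<close> of degree less than \<open>d\<close>. Dividing out the relations \<open>(x\<^sup>t, x\<^sup>t\<^sup>+\<^sup>1, 0)\<close>
  one by one decreases the length by one in each step, and in the end the first two arrows form a string module,
  whose endomorphisms are scalars. From then on the factor modules remain indecomposable whatever is divided out,
  and one reaches a string module, which is accessible. The intermediate factor modules are
  indecomposable because an idempotent endomorphism \<open>E\<close> of one of them descends to an idempotent endomorphism \<open>D\<close> of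
  the previous level; there, \<open>D\<close> or \<open>1 - D\<close> vanishes by induction, and this forces \<open>E\<close> or \<open>1 - E\<close> to vanish.
\<close>

section \<open>Submodules and factor modules\<close>

text \<open>The obstacle is indecomposability: every module on the way must be indecomposable, and
  dividing out a relation may destroy this. The order of the relations is chosen so that two
  mechanisms suffice. If the relations with third component 0 are exactly the
  \<open>(f, x f, 0)\<close> with \<open>f\<close> of degree less than \<open>t\<close>, then a
  linear map preserving the relations commutes with \<open>x\<close> there and is a scalar on degree
  at most \<open>t\<close>. The third arrow is injective, so the third component of a relation
  determines the vector it comes from; this makes the descent from \<open>E\<close> to
  \<open>D\<close> well defined. Idempotents are convenient because an idempotent that maps a vector
  into a subspace which it kills already kills the vector. The dimensions 1, 3, 8, 21 obey
  \<open>next = 3 * current - previous\<close>, because the arrows of one level are exactly the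
  relations between the arrows of the next. The basis of the last space is adapted to the previous
  one: the first two arrows send \<open>(f, x f)\<close> to \<open>f\<close>, so that sums of low
  degree correspond to string relations of the level below.\<close>

context left_module
begin

lemma smult_zero_right [simp]: "a \<in> carrier R \<Longrightarrow> a \<odot>\<^bsub>M\<^esub> \<zero>\<^bsub>M\<^esub> = \<zero>\<^bsub>M\<^esub>"
  using smult_r_distr[of a "\<zero>\<^bsub>M\<^esub>" "\<zero>\<^bsub>M\<^esub>"]
  by (metis M.add.r_cancel_one' M.r_zero M.zero_closed smult_closed)

lemma smult_zero_left [simp]: "x \<in> carrier M \<Longrightarrow> \<zero> \<odot>\<^bsub>M\<^esub> x = \<zero>\<^bsub>M\<^esub>"
  using smult_l_distr[of \<zero> \<zero> x]
  by (metis M.add.r_cancel_one' R.r_zero R.zero_closed smult_closed)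

lemma smult_minus_one: "x \<in> carrier M \<Longrightarrow> (\<ominus> \<one>) \<odot>\<^bsub>M\<^esub> x = \<ominus>\<^bsub>M\<^esub> x"
proof -
  assume x: "x \<in> carrier M"
  have "(\<ominus> \<one>) \<odot>\<^bsub>M\<^esub> x \<oplus>\<^bsub>M\<^esub> x = \<zero>\<^bsub>M\<^esub>"
    using smult_l_distr[of "\<ominus> \<one>" \<one> x] x by (simp add: R.l_neg)
  then show ?thesis using x by (simp add: M.minus_equality)
qed

lemma smult_neg: "\<lbrakk>a \<in> carrier R; x \<in> carrier M\<rbrakk> \<Longrightarrow> a \<odot>\<^bsub>M\<^esub> (\<ominus>\<^bsub>M\<^esub> x) = \<ominus>\<^bsub>M\<^esub> (a \<odot>\<^bsub>M\<^esub> x)"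
  using smult_r_distr[of a "\<ominus>\<^bsub>M\<^esub> x" x] by (simp add: M.l_neg M.minus_equality)

lemma smult_diff:
  "\<lbrakk>a \<in> carrier R; x \<in> carrier M; y \<in> carrier M\<rbrakk> \<Longrightarrow> a \<odot>\<^bsub>M\<^esub> (x \<ominus>\<^bsub>M\<^esub> y) = a \<odot>\<^bsub>M\<^esub> x \<ominus>\<^bsub>M\<^esub> a \<odot>\<^bsub>M\<^esub> y"
  by (simp add: a_minus_def smult_r_distr smult_neg)

lemma diff_eq_zero_iff: "\<lbrakk>x \<in> carrier M; y \<in> carrier M\<rbrakk> \<Longrightarrow> x \<ominus>\<^bsub>M\<^esub> y = \<zero>\<^bsub>M\<^esub> \<longleftrightarrow> x = y"
  by (metis M.minus_equality M.minus_minus M.r_neg a_minus_def M.add.inv_closed)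

text \<open>Closure under negatives comes from the scalar \<open>\<ominus> \<one>\<close>.\<close>

lemma submodule_iff:
  "submodule U R M \<longleftrightarrow> U \<subseteq> carrier M \<and> \<zero>\<^bsub>M\<^esub> \<in> U \<and> (\<forall>x\<in>U. \<forall>y\<in>U. x \<oplus>\<^bsub>M\<^esub> y \<in> U) \<and>
    (\<forall>a\<in>carrier R. \<forall>x\<in>U. a \<odot>\<^bsub>M\<^esub> x \<in> U)" (is "?L \<longleftrightarrow> ?R")
proof
  assume ?L
  then interpret submodule U R M .
  show ?R using subset one_closed m_closed smult_closed by auto
next
  assume r: ?R
  have "\<ominus>\<^bsub>M\<^esub> x \<in> U" if "x \<in> U" for x
    using r that smult_minus_one[of x] by (metis R.a_inv_closed R.one_closed subsetD)
  then have "inv\<^bsub>add_monoid M\<^esub> x \<in> U" if "x \<in> U" for x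
    using that by (simp add: a_inv_def)
  then show ?L
    using r by (intro submodule.intro subgroup.intro submodule_axioms.intro) auto
qed

lemma submodule_diff: "\<lbrakk>submodule U R M; x \<in> U; y \<in> U\<rbrakk> \<Longrightarrow> x \<ominus>\<^bsub>M\<^esub> y \<in> U"
  unfolding submodule_iff a_minus_def using smult_minus_one[of y]
  by (metis R.a_inv_closed R.one_closed subsetD)

lemma submodule_add_diff_iff:
  "\<lbrakk>submodule U R M; x \<in> carrier M; y \<in> U\<rbrakk> \<Longrightarrow> x \<oplus>\<^bsub>M\<^esub> y \<in> U \<longleftrightarrow> x \<in> U"
proof
  assume U: "submodule U R M" "x \<in> carrier M" "y \<in> U"
  then have y: "y \<in> carrier M" unfolding submodule_iff by blast
  { assume "x \<oplus>\<^bsub>M\<^esub> y \<in> U"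
    moreover have "x \<oplus>\<^bsub>M\<^esub> y \<ominus>\<^bsub>M\<^esub> y = x" using U y by (simp add: a_minus_def M.a_assoc M.r_neg)
    ultimately show "x \<in> U" using submodule_diff[OF U(1) _ U(3)] by metis }
  { assume "x \<in> U"
    then show "x \<oplus>\<^bsub>M\<^esub> y \<in> U" using U unfolding submodule_iff by blast }
qed

lemma submodule_carrier: "submodule (carrier M) R M"
  unfolding submodule_iff by auto

lemma submodule_zero: "submodule {\<zero>\<^bsub>M\<^esub>} R M"
  unfolding submodule_iff by auto

lemma submodule_left_module: assumes U: "submodule U R M" shows "left_module R (M\<lparr>carrier := U\<rparr>)"
proof -
  note u = U[unfolded submodule_iff]
  have c: "x \<in> carrier M" if "x \<in> U" for x using u that by auto
  have "abelian_group (M\<lparr>carrier := U\<rparr>)"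
  proof (intro abelian_groupI)
    fix x assume "x \<in> carrier (M\<lparr>carrier := U\<rparr>)"
    then have x: "x \<in> U" by simp
    then have "\<ominus>\<^bsub>M\<^esub> x \<in> U" using u smult_minus_one[of x] by (metis R.a_inv_closed R.one_closed subsetD)
    then show "\<exists>y\<in>carrier (M\<lparr>carrier := U\<rparr>). y \<oplus>\<^bsub>M\<lparr>carrier := U\<rparr>\<^esub> x = \<zero>\<^bsub>M\<lparr>carrier := U\<rparr>\<^esub>"
      using x c by (auto intro!: bexI[of _ "\<ominus>\<^bsub>M\<^esub> x"] simp: M.l_neg)
  qed (use u c in \<open>auto simp: M.a_assoc intro: M.a_comm\<close>)
  then show ?thesis
    by (intro left_module.intro left_module_axioms.intro)
      (use u c R.ring_axioms smult_l_distr smult_r_distr smult_assoc1 in \<open>auto\<close>)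
qed

lemma submodule_of_submodule:
  assumes "submodule V R M"
  shows "submodule U R (M\<lparr>carrier := V\<rparr>) \<longleftrightarrow> submodule U R M \<and> U \<subseteq> V"
proof -
  interpret V: left_module R "M\<lparr>carrier := V\<rparr>" using submodule_left_module[OF assms] .
  show ?thesis using assms unfolding V.submodule_iff submodule_iff by auto
qed

end

text \<open>\<open>q\<close> exhibits \<open>N\<close> as the factor module of \<open>M\<close> by \<open>U\<close>.\<close>

definition factor_map ::
  "('a, 'r) ring_scheme \<Rightarrow> ('a, 'm) module \<Rightarrow> ('a, 'n) module \<Rightarrow> ('m \<Rightarrow> 'n) \<Rightarrow> 'm set \<Rightarrow> bool" where
  "factor_map R M N q U \<longleftrightarrow> q ` carrier M = carrier N \<and> q \<zero>\<^bsub>M\<^esub> = \<zero>\<^bsub>N\<^esub> \<and>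
     (\<forall>x\<in>carrier M. \<forall>y\<in>carrier M. q (x \<oplus>\<^bsub>M\<^esub> y) = q x \<oplus>\<^bsub>N\<^esub> q y) \<and>
     (\<forall>a\<in>carrier R. \<forall>x\<in>carrier M. q (a \<odot>\<^bsub>M\<^esub> x) = a \<odot>\<^bsub>N\<^esub> q x) \<and>
     (\<forall>x\<in>carrier M. \<forall>y\<in>carrier M. q x = q y \<longleftrightarrow> x \<ominus>\<^bsub>M\<^esub> y \<in> U)"

lemma
  assumes "factor_map R M N q U"
  shows factor_map_image_carrier: "q ` carrier M = carrier N"
    and factor_map_zero: "q \<zero>\<^bsub>M\<^esub> = \<zero>\<^bsub>N\<^esub>"
    and factor_map_add: "\<And>x y. \<lbrakk>x \<in> carrier M; y \<in> carrier M\<rbrakk> \<Longrightarrow> q (x \<oplus>\<^bsub>M\<^esub> y) = q x \<oplus>\<^bsub>N\<^esub> q y"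
    and factor_map_smult: "\<And>a x. \<lbrakk>a \<in> carrier R; x \<in> carrier M\<rbrakk> \<Longrightarrow> q (a \<odot>\<^bsub>M\<^esub> x) = a \<odot>\<^bsub>N\<^esub> q x"
    and factor_map_eq_iff: "\<And>x y. \<lbrakk>x \<in> carrier M; y \<in> carrier M\<rbrakk> \<Longrightarrow> q x = q y \<longleftrightarrow> x \<ominus>\<^bsub>M\<^esub> y \<in> U"
  using assms unfolding factor_map_def by simp_all

lemma factor_map_closed: "\<lbrakk>factor_map R M N q U; x \<in> carrier M\<rbrakk> \<Longrightarrow> q x \<in> carrier N"
  unfolding factor_map_def by blast

lemma factor_map_surj: "\<lbrakk>factor_map R M N q U; y \<in> carrier N\<rbrakk> \<Longrightarrow> \<exists>x\<in>carrier M. y = q x"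
  unfolding factor_map_def by blast

context left_module
begin

text \<open>The axioms are transported along the surjection \<open>q\<close>, without assuming that
  \<open>N\<close> is a group. This covers factor modules as well as copies of them on other
  carriers.\<close>

lemma left_module_factor_map:
  fixes N :: "('a, 'n) module"
  assumes "q ` carrier M = carrier N" "q \<zero>\<^bsub>M\<^esub> = \<zero>\<^bsub>N\<^esub>"
    and add: "\<And>x y. \<lbrakk>x \<in> carrier M; y \<in> carrier M\<rbrakk> \<Longrightarrow> q (x \<oplus>\<^bsub>M\<^esub> y) = q x \<oplus>\<^bsub>N\<^esub> q y"
    and sm: "\<And>a x. \<lbrakk>a \<in> carrier R; x \<in> carrier M\<rbrakk> \<Longrightarrow> q (a \<odot>\<^bsub>M\<^esub> x) = a \<odot>\<^bsub>N\<^esub> q x"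
  shows "left_module R N"
proof -
  have im: "\<exists>y\<in>carrier M. x = q y" if "x \<in> carrier N" for x
    using that unfolding assms(1)[symmetric] by blast
  have cl: "q x \<in> carrier N" if "x \<in> carrier M" for x
    using that unfolding assms(1)[symmetric] by blast
  have "abelian_group N"
  proof (intro abelian_groupI)
    fix x assume "x \<in> carrier N"
    then obtain x' where x': "x' \<in> carrier M" "x = q x'" using im by blast
    show "\<exists>y\<in>carrier N. y \<oplus>\<^bsub>N\<^esub> x = \<zero>\<^bsub>N\<^esub>"
      using add[of "\<ominus>\<^bsub>M\<^esub> x'" x'] assms(2) x' cl by (intro bexI[of _ "q (\<ominus>\<^bsub>M\<^esub> x')"]) (auto simp: M.l_neg)
    show "\<zero>\<^bsub>N\<^esub> \<oplus>\<^bsub>N\<^esub> x = x" using x' add[of "\<zero>\<^bsub>M\<^esub>" x'] assms(2) by simp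
  next
    fix x y assume "x \<in> carrier N" "y \<in> carrier N"
    then obtain x' y' where "x' \<in> carrier M" "x = q x'" "y' \<in> carrier M" "y = q y'" using im by blast
    then show "x \<oplus>\<^bsub>N\<^esub> y \<in> carrier N" "x \<oplus>\<^bsub>N\<^esub> y = y \<oplus>\<^bsub>N\<^esub> x"
      using cl by (simp_all add: M.a_comm flip: add)
  next
    fix x y z assume "x \<in> carrier N" "y \<in> carrier N" "z \<in> carrier N"
    then obtain x' y' z' where "x' \<in> carrier M" "x = q x'" "y' \<in> carrier M" "y = q y'"
      "z' \<in> carrier M" "z = q z'" using im by meson
    then show "x \<oplus>\<^bsub>N\<^esub> y \<oplus>\<^bsub>N\<^esub> z = x \<oplus>\<^bsub>N\<^esub> (y \<oplus>\<^bsub>N\<^esub> z)"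
      by (simp add: M.a_assoc flip: add)
  next
    show "\<zero>\<^bsub>N\<^esub> \<in> carrier N" using assms(2) cl[of "\<zero>\<^bsub>M\<^esub>"] by simp
  qed
  moreover have "left_module_axioms R N"
  proof (rule left_module_axioms.intro)
    fix a x assume a: "a \<in> carrier R" and "x \<in> carrier N"
    then obtain x' where x': "x' \<in> carrier M" "x = q x'" using im by blast
    then show "a \<odot>\<^bsub>N\<^esub> x \<in> carrier N" using a cl by (simp flip: sm)
    fix b assume "b \<in> carrier R"
    then show "(a \<oplus> b) \<odot>\<^bsub>N\<^esub> x = a \<odot>\<^bsub>N\<^esub> x \<oplus>\<^bsub>N\<^esub> b \<odot>\<^bsub>N\<^esub> x"
      and "(a \<otimes> b) \<odot>\<^bsub>N\<^esub> x = a \<odot>\<^bsub>N\<^esub> (b \<odot>\<^bsub>N\<^esub> x)"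
      using a x' by (simp_all add: smult_l_distr smult_assoc1 flip: sm add)
  next
    fix a x y assume "a \<in> carrier R" "x \<in> carrier N" "y \<in> carrier N"
    moreover then obtain x' y' where "x' \<in> carrier M" "x = q x'" "y' \<in> carrier M" "y = q y'" using im by blast
    ultimately show "a \<odot>\<^bsub>N\<^esub> (x \<oplus>\<^bsub>N\<^esub> y) = a \<odot>\<^bsub>N\<^esub> x \<oplus>\<^bsub>N\<^esub> a \<odot>\<^bsub>N\<^esub> y"
      by (simp add: smult_r_distr flip: sm add)
  next
    fix x assume "x \<in> carrier N"
    then obtain x' where x': "x' \<in> carrier M" "x = q x'" using im by blast
    then show "\<one> \<odot>\<^bsub>N\<^esub> x = x" by (simp flip: sm)
  qed
  ultimately show ?thesis using R.ring_axioms by (intro left_module.intro) auto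
qed

lemma a_r_coset_eq_iff:
  assumes "submodule U R M" "x \<in> carrier M" "y \<in> carrier M"
  shows "U +>\<^bsub>M\<^esub> x = U +>\<^bsub>M\<^esub> y \<longleftrightarrow> x \<ominus>\<^bsub>M\<^esub> y \<in> U"
proof -
  note u = assms(1)[unfolded submodule_iff]
  have mem: "z \<in> U +>\<^bsub>M\<^esub> w \<longleftrightarrow> z \<in> carrier M \<and> z \<ominus>\<^bsub>M\<^esub> w \<in> U" if "w \<in> carrier M" for z w
  proof
    assume "z \<in> U +>\<^bsub>M\<^esub> w"
    then obtain h where h: "h \<in> U" "z = h \<oplus>\<^bsub>M\<^esub> w" unfolding a_r_coset_def' by auto
    then have "h \<in> carrier M" using u by auto
    then show "z \<in> carrier M \<and> z \<ominus>\<^bsub>M\<^esub> w \<in> U" using h that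
      by (simp add: a_minus_def M.a_assoc M.r_neg)
  next
    assume z: "z \<in> carrier M \<and> z \<ominus>\<^bsub>M\<^esub> w \<in> U"
    then have "z = (z \<ominus>\<^bsub>M\<^esub> w) \<oplus>\<^bsub>M\<^esub> w" using that by (simp add: a_minus_def M.a_assoc M.l_neg)
    then show "z \<in> U +>\<^bsub>M\<^esub> w" unfolding a_r_coset_def' using z by blast
  qed
  have "x \<in> U +>\<^bsub>M\<^esub> x" using mem[of x x] assms u diff_eq_zero_iff[of x x] by simp
  moreover have "U +>\<^bsub>M\<^esub> x = U +>\<^bsub>M\<^esub> y" if d: "x \<ominus>\<^bsub>M\<^esub> y \<in> U"
  proof -
    have "z \<ominus>\<^bsub>M\<^esub> x \<in> U \<longleftrightarrow> z \<ominus>\<^bsub>M\<^esub> y \<in> U" if z: "z \<in> carrier M" for z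
    proof -
      have "z \<ominus>\<^bsub>M\<^esub> y = (z \<ominus>\<^bsub>M\<^esub> x) \<oplus>\<^bsub>M\<^esub> (x \<ominus>\<^bsub>M\<^esub> y)" using z assms
        by (simp add: a_minus_def M.a_assoc M.r_neg2 M.r_neg1)
      then show ?thesis using submodule_add_diff_iff[OF assms(1) _ d, of "z \<ominus>\<^bsub>M\<^esub> x"] z assms by simp
    qed
    then show ?thesis using mem assms by auto
  qed
  ultimately show ?thesis using mem assms by blast
qed

lemma a_r_coset_mem:
  assumes "submodule U R M" "x \<in> carrier M" "y \<in> U +>\<^bsub>M\<^esub> x"
  shows "y \<in> carrier M" "U +>\<^bsub>M\<^esub> y = U +>\<^bsub>M\<^esub> x"
proof -
  note u = assms(1)[unfolded submodule_iff]
  obtain h where h: "h \<in> U" "y = h \<oplus>\<^bsub>M\<^esub> x" using assms(3) unfolding a_r_coset_def' by auto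
  then have hc: "h \<in> carrier M" using u by auto
  then show y: "y \<in> carrier M" using h assms by simp
  have "y \<ominus>\<^bsub>M\<^esub> x = h" using h hc assms by (simp add: a_minus_def M.a_assoc M.r_neg)
  then show "U +>\<^bsub>M\<^esub> y = U +>\<^bsub>M\<^esub> x" using a_r_coset_eq_iff[OF assms(1) y assms(2)] h by simp
qed

end

context
  fixes R :: "('a, 'r) ring_scheme" and M :: "('a, 'm) module"
  assumes left_module: "left_module R M"
begin

interpretation left_module R M by (rule left_module)

text \<open>The union that defines the scalar multiplication of \<open>quot_module\<close> consists
  of a single coset, since the multiples of two representatives again differ by an element of
  \<open>U\<close>.\<close>

lemma factor_map_quot_module:
  assumes U: "submodule U R M"
  shows "factor_map R M (quot_module M U) (\<lambda>x. U +>\<^bsub>M\<^esub> x) U"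
proof -
  note u = U[unfolded submodule_iff]
  have self: "x \<in> U +>\<^bsub>M\<^esub> x" if "x \<in> carrier M" for x
    using u that M.l_zero[of x] unfolding a_r_coset_def' by force
  have "U +>\<^bsub>M\<^esub> (x \<oplus>\<^bsub>M\<^esub> y) = (U +>\<^bsub>M\<^esub> x) <+>\<^bsub>M\<^esub> (U +>\<^bsub>M\<^esub> y)"
    if "x \<in> carrier M" "y \<in> carrier M" for x y
  proof -
    have "(U +>\<^bsub>M\<^esub> x) <+>\<^bsub>M\<^esub> (U +>\<^bsub>M\<^esub> y) = {h \<oplus>\<^bsub>M\<^esub> x \<oplus>\<^bsub>M\<^esub> (k \<oplus>\<^bsub>M\<^esub> y) |h k. h \<in> U \<and> k \<in> U}"
      unfolding set_add_def' a_r_coset_def' by auto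
    also have "\<dots> = {(h \<oplus>\<^bsub>M\<^esub> k) \<oplus>\<^bsub>M\<^esub> (x \<oplus>\<^bsub>M\<^esub> y) |h k. h \<in> U \<and> k \<in> U}"
    proof -
      have "h \<oplus>\<^bsub>M\<^esub> x \<oplus>\<^bsub>M\<^esub> (k \<oplus>\<^bsub>M\<^esub> y) = (h \<oplus>\<^bsub>M\<^esub> k) \<oplus>\<^bsub>M\<^esub> (x \<oplus>\<^bsub>M\<^esub> y)" if "h \<in> U" "k \<in> U" for h k
        using that u \<open>x \<in> carrier M\<close> \<open>y \<in> carrier M\<close> by (simp add: M.a_ac subset_iff)
      then show ?thesis by (intro Collect_cong) metis
    qed
    also have "\<dots> = U +>\<^bsub>M\<^esub> (x \<oplus>\<^bsub>M\<^esub> y)"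
    proof -
      have "h = h \<oplus>\<^bsub>M\<^esub> \<zero>\<^bsub>M\<^esub>" if "h \<in> U" for h using that u by (simp add: subset_iff)
      then have "\<exists>h' k'. h \<oplus>\<^bsub>M\<^esub> (x \<oplus>\<^bsub>M\<^esub> y) = h' \<oplus>\<^bsub>M\<^esub> k' \<oplus>\<^bsub>M\<^esub> (x \<oplus>\<^bsub>M\<^esub> y) \<and> h' \<in> U \<and> k' \<in> U"
        if "h \<in> U" for h using that u by metis
      then show ?thesis unfolding a_r_coset_def' using u by blast
    qed
    finally show ?thesis by simp
  qed
  moreover have "U +>\<^bsub>M\<^esub> (a \<odot>\<^bsub>M\<^esub> x) = (\<Union>x'\<in>U +>\<^bsub>M\<^esub> x. U +>\<^bsub>M\<^esub> (a \<odot>\<^bsub>M\<^esub> x'))"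
    if a: "a \<in> carrier R" and x: "x \<in> carrier M" for a x
  proof -
    have "U +>\<^bsub>M\<^esub> (a \<odot>\<^bsub>M\<^esub> x') = U +>\<^bsub>M\<^esub> (a \<odot>\<^bsub>M\<^esub> x)" if "x' \<in> U +>\<^bsub>M\<^esub> x" for x'
    proof -
      have x': "x' \<in> carrier M" "U +>\<^bsub>M\<^esub> x' = U +>\<^bsub>M\<^esub> x" using a_r_coset_mem[OF U x that] by auto
      then have "a \<odot>\<^bsub>M\<^esub> (x' \<ominus>\<^bsub>M\<^esub> x) \<in> U" using a_r_coset_eq_iff[OF U x'(1) x] u a by auto
      then show ?thesis using a_r_coset_eq_iff[OF U, of "a \<odot>\<^bsub>M\<^esub> x'" "a \<odot>\<^bsub>M\<^esub> x"] a x x'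
        by (simp add: smult_diff)
    qed
    then show ?thesis using self[OF x] by (metis (no_types, lifting) SUP_eq_const empty_iff)
  qed
  moreover have "U +>\<^bsub>M\<^esub> \<zero>\<^bsub>M\<^esub> = U" using u by (simp add: M.a_coset_add_zero)
  ultimately show ?thesis using a_r_coset_eq_iff[OF U]
    unfolding factor_map_def quot_module_def by (auto simp: A_RCOSETS_def')
qed

text \<open>A copy of \<open>M/U\<close> whose carrier is a set of coset representatives.\<close>

lemma ex_factor_module:
  assumes U: "submodule U R M"
  shows "\<exists>(N :: ('a, 'm) module) q. factor_map R M N q U"
proof -
  define c where "c x = U +>\<^bsub>M\<^esub> x" for x
  define q where "q x = (SOME y. y \<in> carrier M \<and> c y = c x)" for x
  have q: "q x \<in> carrier M" "c (q x) = c x" if "x \<in> carrier M" for x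
    using someI[of "\<lambda>y. y \<in> carrier M \<and> c y = c x" x] that unfolding q_def by auto
  have qc: "q x = q y" if "c x = c y" for x y unfolding q_def using that by simp
  have qi: "q x = q y \<longleftrightarrow> c x = c y" if "x \<in> carrier M" "y \<in> carrier M" for x y
    using qc q(2) that by metis
  define N :: "('a, 'm) module" where "N = \<lparr>carrier = q ` carrier M, mult = undefined, one = undefined,
    zero = q \<zero>\<^bsub>M\<^esub>, add = (\<lambda>x y. q (x \<oplus>\<^bsub>M\<^esub> y)), smult = (\<lambda>a x. q (a \<odot>\<^bsub>M\<^esub> x))\<rparr>"
  note f = factor_map_quot_module[OF U, folded c_def]
  have "q (x \<oplus>\<^bsub>M\<^esub> y) = q (q x \<oplus>\<^bsub>M\<^esub> q y)" if "x \<in> carrier M" "y \<in> carrier M" for x y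
  proof -
    have "c (x \<oplus>\<^bsub>M\<^esub> y) = c x \<oplus>\<^bsub>quot_module M U\<^esub> c y"
      "c (q x \<oplus>\<^bsub>M\<^esub> q y) = c (q x) \<oplus>\<^bsub>quot_module M U\<^esub> c (q y)"
      using that q(1) by (simp_all only: factor_map_add[OF f])
    then show ?thesis by (intro qc) (simp only: q(2)[OF that(1)] q(2)[OF that(2)])
  qed
  moreover have "q (a \<odot>\<^bsub>M\<^esub> x) = q (a \<odot>\<^bsub>M\<^esub> q x)" if "a \<in> carrier R" "x \<in> carrier M" for a x
  proof -
    have "c (a \<odot>\<^bsub>M\<^esub> x) = a \<odot>\<^bsub>quot_module M U\<^esub> c x"
      "c (a \<odot>\<^bsub>M\<^esub> q x) = a \<odot>\<^bsub>quot_module M U\<^esub> c (q x)"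
      using that q(1) by (simp_all only: factor_map_smult[OF f])
    then show ?thesis by (intro qc) (simp only: q(2)[OF that(2)])
  qed
  ultimately have "factor_map R M N q U"
    unfolding factor_map_def N_def by (simp add: qi a_r_coset_eq_iff[OF U, folded c_def])
  then show ?thesis by blast
qed

lemma factor_map_left_module: "factor_map R M N q U \<Longrightarrow> left_module R N"
  by (rule left_module_factor_map[where q = q])
    (simp_all add: factor_map_image_carrier factor_map_zero factor_map_add factor_map_smult)

text \<open>Both maps have the same fibres, so choosing a preimage under \<open>q\<close> and
  applying \<open>q'\<close> does not depend on the choice.\<close>

lemma mod_isomorphic_factor_maps:
  fixes N :: "('a, 'n) module" and N' :: "('a, 'p) module"
  assumes f: "factor_map R M N q U" and f': "factor_map R M N' q' U"
  shows "mod_isomorphic R N N'"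
proof -
  define g where "g = inv_into (carrier M) q"
  have g: "g y \<in> carrier M" "q (g y) = y" if "y \<in> carrier N" for y
    using that factor_map_image_carrier[OF f] unfolding g_def by (metis inv_into_into, metis f_inv_into_f)
  have qq: "q x = q y \<longleftrightarrow> q' x = q' y" if "x \<in> carrier M" "y \<in> carrier M" for x y
    using that by (simp add: factor_map_eq_iff[OF f] factor_map_eq_iff[OF f'])
  have h: "q' (g (q x)) = q' x" if "x \<in> carrier M" for x
    using qq[of "g (q x)" x] g[of "q x"] factor_map_closed[OF f that] that by simp
  have a: "q' (g (x \<oplus>\<^bsub>N\<^esub> y)) = q' (g x) \<oplus>\<^bsub>N'\<^esub> q' (g y)" if x: "x \<in> carrier N" and y: "y \<in> carrier N" for x y
    using h[of "g x \<oplus>\<^bsub>M\<^esub> g y"] g[OF x] g[OF y] by (simp add: factor_map_add[OF f] factor_map_add[OF f'])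
  have s: "q' (g (a \<odot>\<^bsub>N\<^esub> x)) = a \<odot>\<^bsub>N'\<^esub> q' (g x)" if "a \<in> carrier R" and x: "x \<in> carrier N" for a x
    using h[of "a \<odot>\<^bsub>M\<^esub> g x"] g[OF x] that by (simp add: factor_map_smult[OF f] factor_map_smult[OF f'])
  have b: "bij_betw (\<lambda>x. q' (g x)) (carrier N) (carrier N')"
    unfolding bij_betw_def inj_on_def
  proof (intro conjI ballI impI)
    fix x y assume "x \<in> carrier N" "y \<in> carrier N" "q' (g x) = q' (g y)"
    then show "x = y" using g[of x] g[of y] qq[of "g x" "g y"] by simp
  next
    show "(\<lambda>x. q' (g x)) ` carrier N = carrier N'"
    proof (intro equalityI subsetI)
      fix z assume "z \<in> carrier N'"
      then obtain x where "x \<in> carrier M" "z = q' x" using factor_map_surj[OF f'] by blast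
      then show "z \<in> (\<lambda>x. q' (g x)) ` carrier N" using h factor_map_closed[OF f] by (metis imageI)
    qed (use g factor_map_closed[OF f'] in auto)
  qed
  show ?thesis unfolding mod_isomorphic_def mod_hom_def
    using a s b bij_betw_apply[OF b] by (intro bexI[of _ "\<lambda>x. q' (g x)"]) simp_all
qed

lemma mod_isomorphic_quot_module:
  "\<lbrakk>submodule U R M; factor_map R M N q U\<rbrakk> \<Longrightarrow> mod_isomorphic R (quot_module M U) N"
  using mod_isomorphic_factor_maps[OF factor_map_quot_module] by blast

lemma factor_map_preimage:
  assumes f: "factor_map R M N q U" and W: "submodule W R N"
  shows "submodule {x \<in> carrier M. q x \<in> W} R M"
proof -
  interpret N: left_module R N using factor_map_left_module[OF f] .
  show ?thesis using W unfolding submodule_iff N.submodule_iff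
    by (simp add: factor_map_add[OF f] factor_map_smult[OF f] factor_map_zero[OF f] subset_iff)
qed

lemma factor_map_image:
  assumes f: "factor_map R M N q U" and V: "submodule V R M"
  shows "submodule (q ` V) R N"
proof -
  interpret N: left_module R N using factor_map_left_module[OF f] .
  note v = V[unfolded submodule_iff]
  have c: "x \<in> carrier M" if "x \<in> V" for x using v that by blast
  have "q x \<oplus>\<^bsub>N\<^esub> q y \<in> q ` V" if "x \<in> V" "y \<in> V" for x y
    using that c v by (simp flip: factor_map_add[OF f])
  moreover have "a \<odot>\<^bsub>N\<^esub> q x \<in> q ` V" if "x \<in> V" "a \<in> carrier R" for x a
    using that c v by (simp flip: factor_map_smult[OF f])
  moreover have "\<zero>\<^bsub>N\<^esub> \<in> q ` V" using v by (simp flip: factor_map_zero[OF f])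
  moreover have "q ` V \<subseteq> carrier N" using c factor_map_closed[OF f] by blast
  ultimately show ?thesis unfolding N.submodule_iff by blast
qed

lemma diff_mem_submodule_imp:
  assumes W: "submodule W R M" and x: "x \<in> carrier M" and "v \<in> W" "x \<ominus>\<^bsub>M\<^esub> v \<in> W"
  shows "x \<in> W"
proof -
  have v: "v \<in> carrier M" using W \<open>v \<in> W\<close> unfolding submodule_iff by blast
  have "x = (x \<ominus>\<^bsub>M\<^esub> v) \<oplus>\<^bsub>M\<^esub> v" using x v by (simp add: a_minus_def M.a_assoc M.l_neg)
  then show ?thesis using assms unfolding submodule_iff by metis
qed

lemma factor_map_image_mem_iff:
  assumes f: "factor_map R M N q U" and W: "submodule W R M" "U \<subseteq> W" and x: "x \<in> carrier M"
  shows "q x \<in> q ` W \<longleftrightarrow> x \<in> W"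
proof
  assume "q x \<in> q ` W"
  then obtain v where v: "v \<in> W" "q x = q v" by blast
  then have vc: "v \<in> carrier M" using W(1) unfolding submodule_iff by blast
  have "x \<ominus>\<^bsub>M\<^esub> v \<in> W" using v(2) W(2) factor_map_eq_iff[OF f x vc] by blast
  then show "x \<in> W" using diff_mem_submodule_imp[OF W(1) x v(1)] by blast
qed simp

lemma factor_map_zero_iff:
  assumes f: "factor_map R M N q U" and x: "x \<in> carrier M"
  shows "q x = \<zero>\<^bsub>N\<^esub> \<longleftrightarrow> x \<in> U"
proof -
  have "x \<ominus>\<^bsub>M\<^esub> \<zero>\<^bsub>M\<^esub> = x" using x by (simp add: a_minus_def)
  then show ?thesis using factor_map_eq_iff[OF f x M.zero_closed] unfolding factor_map_zero[OF f] by simp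
qed

end

text \<open>The isomorphism theorem (M/U)/(L/U) = M/L. It lets relations be divided out one after
  the other while every stage remains a factor module of one fixed projective module.\<close>

lemma factor_map_comp:
  assumes lm: "left_module R M" and f: "factor_map R M N q U" and L: "submodule L R M" "U \<subseteq> L"
    and g: "factor_map R N P p (q ` L)"
  shows "factor_map R M P (\<lambda>x. p (q x)) L"
proof -
  interpret left_module R M by (rule lm)
  have "p (q x) = p (q y) \<longleftrightarrow> x \<ominus>\<^bsub>M\<^esub> y \<in> L" if xy: "x \<in> carrier M" "y \<in> carrier M" for x y
  proof -
    interpret N: left_module R N using factor_map_left_module[OF lm f] .
    have c: "q x \<in> carrier N" "q y \<in> carrier N" using xy factor_map_closed[OF f] by simp_all
    have xyd: "x \<ominus>\<^bsub>M\<^esub> y \<in> carrier M" using xy by simp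
    have "q (x \<ominus>\<^bsub>M\<^esub> y) \<oplus>\<^bsub>N\<^esub> q y = q x"
      using xy xyd by (simp add: a_minus_def M.a_assoc M.l_neg flip: factor_map_add[OF f])
    then have "q (x \<ominus>\<^bsub>M\<^esub> y) = q x \<ominus>\<^bsub>N\<^esub> q y"
      using c factor_map_closed[OF f xyd] by (metis N.M.add.inv_solve_right' a_minus_def)
    then show ?thesis
      using factor_map_eq_iff[OF g c] factor_map_image_mem_iff[OF lm f L xyd] by simp
  qed
  moreover have "(\<lambda>x. p (q x)) ` carrier M = carrier P"
    using factor_map_image_carrier[OF f] factor_map_image_carrier[OF g] by (metis image_image)
  ultimately show ?thesis
    unfolding factor_map_def
    by (simp add: factor_map_zero[OF f] factor_map_zero[OF g] factor_map_add[OF f] factor_map_add[OF g]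
        factor_map_smult[OF f] factor_map_smult[OF g] factor_map_closed[OF f])
qed

section \<open>Length and accessibility\<close>

text \<open>A form of the series in \<open>has_length\<close> that avoids factor modules: a factor
  is simple iff the step is proper and nothing lies strictly between.\<close>

definition composition_series ::
  "('a, 'r) ring_scheme \<Rightarrow> ('a, 'm) module \<Rightarrow> (nat \<Rightarrow> 'm set) \<Rightarrow> nat \<Rightarrow> bool" where
  "composition_series R M C n \<longleftrightarrow> C 0 = {\<zero>\<^bsub>M\<^esub>} \<and> C n = carrier M \<and> (\<forall>i\<le>n. submodule (C i) R M) \<and>
    (\<forall>i<n. C i \<subset> C (Suc i) \<and>
      (\<forall>W. submodule W R M \<and> C i \<subseteq> W \<and> W \<subseteq> C (Suc i) \<longrightarrow> W = C i \<or> W = C (Suc i)))"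

lemma composition_seriesD:
  assumes "composition_series R M C n"
  shows "C 0 = {\<zero>\<^bsub>M\<^esub>}" "C n = carrier M" "\<And>i. i \<le> n \<Longrightarrow> submodule (C i) R M"
    "\<And>i. i < n \<Longrightarrow> C i \<subset> C (Suc i)"
    "\<And>i W. \<lbrakk>i < n; submodule W R M; C i \<subseteq> W; W \<subseteq> C (Suc i)\<rbrakk> \<Longrightarrow> W = C i \<or> W = C (Suc i)"
  using assms unfolding composition_series_def by simp_all

context
  fixes R :: "('a, 'r) ring_scheme" and M :: "('a, 'm) module"
  assumes left_module: "left_module R M"
begin

interpretation left_module R M by (rule left_module)

text \<open>Submodules of the factor module correspond to the submodules between \<open>U\<close>
  and \<open>M\<close>, by image and preimage.\<close>

lemma simple_quot_module_iff:
  assumes U: "submodule U R M"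
  shows "simple_module R (quot_module M U) \<longleftrightarrow>
    U \<noteq> carrier M \<and> (\<forall>V. submodule V R M \<and> U \<subseteq> V \<longrightarrow> V = U \<or> V = carrier M)"
proof -
  let ?Q = "quot_module M U" and ?q = "\<lambda>x. U +>\<^bsub>M\<^esub> x"
  note f = factor_map_quot_module[OF left_module U]
  note u = U[unfolded submodule_iff]
  have q0: "?q x = \<zero>\<^bsub>?Q\<^esub> \<longleftrightarrow> x \<in> U" if "x \<in> carrier M" for x
    by (rule factor_map_zero_iff[OF left_module f that])
  show ?thesis
  proof
    assume s: "simple_module R ?Q"
    have "V = U \<or> V = carrier M" if V: "submodule V R M" "U \<subseteq> V" for V
    proof -
      have c: "x \<in> carrier M" if "x \<in> V" for x using V(1) that unfolding submodule_iff by blast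
      from s factor_map_image[OF left_module f V(1)]
      consider "?q ` V = {\<zero>\<^bsub>?Q\<^esub>}" | "?q ` V = carrier ?Q" unfolding simple_module_def by blast
      then show ?thesis
      proof cases
        case 1
        then have "x \<in> U" if "x \<in> V" for x using q0[OF c[OF that]] that by blast
        then show ?thesis using V(2) by blast
      next
        case 2
        then have "x \<in> V" if x: "x \<in> carrier M" for x
          using factor_map_closed[OF f x] factor_map_image_mem_iff[OF left_module f V x] by simp
        then show ?thesis using c by blast
      qed
    qed
    moreover have "U \<noteq> carrier M"
    proof
      assume e: "U = carrier M"
      have "y = \<zero>\<^bsub>?Q\<^esub>" if "y \<in> carrier ?Q" for y
        using factor_map_surj[OF f that] q0 e by auto
      moreover have "\<zero>\<^bsub>?Q\<^esub> \<in> carrier ?Q"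
        using factor_map_closed[OF f M.zero_closed] by (simp add: factor_map_zero[OF f])
      ultimately show False using s unfolding simple_module_def by blast
    qed
    ultimately show "U \<noteq> carrier M \<and> (\<forall>V. submodule V R M \<and> U \<subseteq> V \<longrightarrow> V = U \<or> V = carrier M)" by blast
  next
    assume a: "U \<noteq> carrier M \<and> (\<forall>V. submodule V R M \<and> U \<subseteq> V \<longrightarrow> V = U \<or> V = carrier M)"
    then obtain x where x: "x \<in> carrier M" "x \<notin> U" using u by blast
    then have "carrier ?Q \<noteq> {\<zero>\<^bsub>?Q\<^esub>}" using q0 factor_map_closed[OF f x(1)] by blast
    moreover have "W = {\<zero>\<^bsub>?Q\<^esub>} \<or> W = carrier ?Q" if W: "submodule W R ?Q" for W
    proof -
      interpret Q: left_module R ?Q using factor_map_left_module[OF left_module f] .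
      note w = W[unfolded Q.submodule_iff]
      let ?V = "{x \<in> carrier M. ?q x \<in> W}"
      have "submodule ?V R M" using factor_map_preimage[OF left_module f W] .
      moreover have "U \<subseteq> ?V"
      proof
        fix x assume "x \<in> U"
        then have "x \<in> carrier M" "?q x = \<zero>\<^bsub>?Q\<^esub>" using q0 u by blast+
        then show "x \<in> ?V" using w by simp
      qed
      ultimately consider "?V = U" | "?V = carrier M" using a by blast
      then show ?thesis
      proof cases
        case 1
        have "y = \<zero>\<^bsub>?Q\<^esub>" if y: "y \<in> W" for y
        proof -
          obtain x where "x \<in> carrier M" "y = ?q x" using w y factor_map_surj[OF f] by blast
          then show ?thesis using q0 1 y by blast
        qed
        then show ?thesis using w by blast
      next
        case 2
        have "y \<in> W" if "y \<in> carrier ?Q" for y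
          using factor_map_surj[OF f that] 2 by blast
        then show ?thesis using w by blast
      qed
    qed
    ultimately show "simple_module R ?Q" unfolding simple_module_def by blast
  qed
qed

end

context
  fixes R :: "('a, 'r) ring_scheme" and M :: "('a, 'm) module"
  assumes left_module: "left_module R M"
begin

interpretation left_module R M by (rule left_module)

lemma has_length_iff: "has_length R M n \<longleftrightarrow> (\<exists>C. composition_series R M C n)"
proof -
  have "C i \<subseteq> C (Suc i) \<and> simple_module R (quot_module (M\<lparr>carrier := C (Suc i)\<rparr>) (C i)) \<longleftrightarrow>
      C i \<subset> C (Suc i) \<and>
      (\<forall>W. submodule W R M \<and> C i \<subseteq> W \<and> W \<subseteq> C (Suc i) \<longrightarrow> W = C i \<or> W = C (Suc i))"
    if "submodule (C i) R M" and V: "submodule (C (Suc i)) R M" for C i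
  proof (cases "C i \<subseteq> C (Suc i)")
    case True
    then have "submodule (C i) R (M\<lparr>carrier := C (Suc i)\<rparr>)"
      using that submodule_of_submodule[OF V] by blast
    from simple_quot_module_iff[OF submodule_left_module[OF V] this]
    show ?thesis using True by (simp add: submodule_of_submodule[OF V] psubset_eq conj_ac)
  qed auto
  then show ?thesis unfolding has_length_def composition_series_def
    by (intro ex_cong conj_cong refl) (meson Suc_leI less_imp_le)
qed

lemma has_length_1: "simple_module R M \<Longrightarrow> has_length R M 1"
  unfolding has_length_iff composition_series_def simple_module_def
  by (rule exI[of _ "\<lambda>i. if i = 0 then {\<zero>\<^bsub>M\<^esub>} else carrier M"]) (auto simp: submodule_zero submodule_carrier)

end

context
  fixes R :: "('a, 'r) ring_scheme" and M :: "('a, 'm) module"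
  assumes left_module: "left_module R M"
begin

interpretation left_module R M by (rule left_module)

lemma has_length_Suc_submodule:
  assumes V: "submodule V R M" "V \<noteq> carrier M"
    and max: "\<And>W. \<lbrakk>submodule W R M; V \<subseteq> W\<rbrakk> \<Longrightarrow> W = V \<or> W = carrier M"
    and "has_length R (M\<lparr>carrier := V\<rparr>) l"
  shows "has_length R M (Suc l)"
proof -
  note Vm = submodule_left_module[OF V(1)]
  obtain C where C: "composition_series R (M\<lparr>carrier := V\<rparr>) C l"
    using assms(4) has_length_iff[OF Vm] by blast
  define D where "D i = (if i \<le> l then C i else carrier M)" for i
  note C = C[unfolded composition_series_def submodule_of_submodule[OF V(1)], simplified]
  have VM: "V \<subset> carrier M" using V unfolding submodule_iff by blast
  have "D i \<subset> D (Suc i) \<and> (\<forall>W. submodule W R M \<and> D i \<subseteq> W \<and> W \<subseteq> D (Suc i) \<longrightarrow> W = D i \<or> W = D (Suc i))"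
    if "i < Suc l" for i
  proof (cases "i < l")
    case True
    then have "W \<subseteq> V" if "W \<subseteq> C (Suc i)" for W using C that by (meson Suc_leI order.trans)
    then show ?thesis using True C unfolding D_def by simp
  next
    case False
    then have "i = l" using that by simp
    then show ?thesis using C VM max unfolding D_def by auto
  qed
  moreover have "submodule (D i) R M" for i using C unfolding D_def by (simp add: submodule_carrier)
  ultimately have "composition_series R M D (Suc l)"
    unfolding composition_series_def using C by (simp add: D_def)
  then show ?thesis using has_length_iff[OF left_module] by blast
qed

text \<open>The series of \<open>N\<close> is pulled back along \<open>q\<close> and the zero module
  is put below it. The pullback of zero is the minimal submodule \<open>U\<close>, hence the shift
  of the indices by one.\<close>

lemma has_length_Suc_factor_module:
  assumes f: "factor_map R M N q U" and U: "submodule U R M" "U \<noteq> {\<zero>\<^bsub>M\<^esub>}"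
    and min: "\<And>W. \<lbrakk>submodule W R M; W \<subseteq> U\<rbrakk> \<Longrightarrow> W = {\<zero>\<^bsub>M\<^esub>} \<or> W = U"
    and "has_length R N l"
  shows "has_length R M (Suc l)"
proof -
  note Nm = factor_map_left_module[OF left_module f]
  interpret N: left_module R N by (rule Nm)
  obtain C where C: "composition_series R N C l"
    using assms(5) has_length_iff[OF Nm] by blast
  note C = composition_seriesD[OF C]
  define P where "P W = {x \<in> carrier M. q x \<in> W}" for W
  have q0: "q x = \<zero>\<^bsub>N\<^esub> \<longleftrightarrow> x \<in> U" if "x \<in> carrier M" for x
    by (rule factor_map_zero_iff[OF left_module f that])
  have P0: "P {\<zero>\<^bsub>N\<^esub>} = U" using q0 U unfolding P_def submodule_iff by blast
  have Pc: "P (carrier N) = carrier M" using factor_map_closed[OF f] unfolding P_def by blast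
  have Ps: "submodule (P W) R M" if "submodule W R N" for W
    unfolding P_def by (rule factor_map_preimage[OF left_module f that])
  have qP: "q ` P W = W" if "W \<subseteq> carrier N" for W
    using factor_map_surj[OF f] that unfolding P_def by blast
  have Pq: "P (q ` W) = W" if W: "submodule W R M" "U \<subseteq> W" for W
    using factor_map_image_mem_iff[OF left_module f W] W(1) unfolding P_def submodule_iff by blast
  define D where "D i = (case i of 0 \<Rightarrow> {\<zero>\<^bsub>M\<^esub>} | Suc j \<Rightarrow> P (C j))" for i
  have "D i \<subset> D (Suc i) \<and> (\<forall>W. submodule W R M \<and> D i \<subseteq> W \<and> W \<subseteq> D (Suc i) \<longrightarrow> W = D i \<or> W = D (Suc i))"
    if i: "i < Suc l" for i
  proof (cases i)
    case 0
    then have "D i = {\<zero>\<^bsub>M\<^esub>}" "D (Suc i) = U" using P0 by (simp_all add: D_def C(1))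
    moreover have "{\<zero>\<^bsub>M\<^esub>} \<subset> U" using U unfolding submodule_iff by blast
    ultimately show ?thesis using min by simp
  next
    case (Suc j)
    have j: "j < l" using i Suc by simp
    have Cc: "C j \<subset> C (Suc j)" using C(4)[OF j] .
    have s: "submodule (C j) R N" "submodule (C (Suc j)) R N" using C(3) j by simp_all
    have cc: "C j \<subseteq> carrier N" "C (Suc j) \<subseteq> carrier N" using s unfolding N.submodule_iff by blast+
    have "W = P (C j) \<or> W = P (C (Suc j))"
      if W: "submodule W R M" "P (C j) \<subseteq> W" "W \<subseteq> P (C (Suc j))" for W
    proof -
      have "\<zero>\<^bsub>N\<^esub> \<in> C j" using s unfolding N.submodule_iff by blast
      then have "P {\<zero>\<^bsub>N\<^esub>} \<subseteq> P (C j)" unfolding P_def by auto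
      then have "U \<subseteq> W" unfolding P0 using W(2) by (rule subset_trans)
      moreover have "C j \<subseteq> q ` W" "q ` W \<subseteq> C (Suc j)"
        using image_mono[OF W(2), of q] image_mono[OF W(3), of q] by (simp_all add: qP cc)
      then have "q ` W = C j \<or> q ` W = C (Suc j)"
        using C(5)[OF j factor_map_image[OF left_module f W(1)]] by blast
      ultimately show ?thesis using Pq[OF W(1)] by metis
    qed
    moreover have "P (C j) \<subset> P (C (Suc j))"
    proof
      show "P (C j) \<subseteq> P (C (Suc j))" using Cc unfolding P_def by auto
      have "q ` P (C j) \<noteq> q ` P (C (Suc j))" unfolding qP[OF cc(1)] qP[OF cc(2)] using Cc by simp
      then show "P (C j) \<noteq> P (C (Suc j))" by metis
    qed
    ultimately show ?thesis using Suc unfolding D_def by simp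
  qed
  moreover have "submodule (D i) R M" if "i \<le> Suc l" for i
    using that C(3) Ps unfolding D_def by (cases i) (simp_all add: submodule_zero)
  ultimately have "composition_series R M D (Suc l)"
    unfolding composition_series_def using Pc by (simp add: D_def C(2))
  then show ?thesis using has_length_iff[OF left_module] by blast
qed

end

text \<open>Accessibility and length are carried together because the inductive rules compare the
  length of a module with that of the smaller one.\<close>

definition accessible_of_length :: "('k::field, 'a) module \<Rightarrow> ('a, 'm) module \<Rightarrow> nat \<Rightarrow> bool" where
  "accessible_of_length A M l \<longleftrightarrow> accessible A M \<and> has_length A M l"

lemma accessible_of_length_simple:
  "\<lbrakk>fd_module A M; simple_module A M\<rbrakk> \<Longrightarrow> accessible_of_length A M 1"
  unfolding accessible_of_length_def using accessible.simple has_length_1 by (metis fd_module_def)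

lemma accessible_of_length_submodule:
  assumes "fd_module A M" "indecomposable_module A M" "submodule V A M" "V \<noteq> carrier M"
    "\<And>W. \<lbrakk>submodule W A M; V \<subseteq> W\<rbrakk> \<Longrightarrow> W = V \<or> W = carrier M"
    "accessible_of_length A (M\<lparr>carrier := V\<rparr>) l" "l > 0"
  shows "accessible_of_length A M (Suc l)"
proof -
  have lm: "left_module A M" using assms(1) unfolding fd_module_def by blast
  have "has_length A M (Suc l)"
    using has_length_Suc_submodule[OF lm assms(3-5)] assms(6) unfolding accessible_of_length_def by blast
  then show ?thesis using accessible.sub[OF assms(1) _ _ assms(2,3)] assms(6,7)
    unfolding accessible_of_length_def by simp
qed

lemma accessible_of_length_factor_module:
  fixes M N :: "('a, 'm) module"
  assumes "fd_module A M" "indecomposable_module A M" "factor_map A M N q U" "submodule U A M"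
    "U \<noteq> {\<zero>\<^bsub>M\<^esub>}" "\<And>W. \<lbrakk>submodule W A M; W \<subseteq> U\<rbrakk> \<Longrightarrow> W = {\<zero>\<^bsub>M\<^esub>} \<or> W = U"
    "accessible_of_length A N l" "l > 0"
  shows "accessible_of_length A M (Suc l)"
proof -
  have lm: "left_module A M" using assms(1) unfolding fd_module_def by blast
  have "has_length A M (Suc l)"
    using has_length_Suc_factor_module[OF lm assms(3-6)] assms(7) unfolding accessible_of_length_def by blast
  moreover have "mod_isomorphic A (quot_module M U) N"
    using mod_isomorphic_quot_module[OF lm assms(4,3)] .
  ultimately have "accessible A M"
    using assms(1,2,4,7,8) unfolding accessible_of_length_def
    by (intro accessible.factor[of A M "Suc l" U N]) simp_all
  then show ?thesis using \<open>has_length A M (Suc l)\<close> unfolding accessible_of_length_def by simp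
qed

section \<open>Modules over the path algebra of the 3-Kronecker quiver\<close>

abbreviation K3 :: "('k::field, kronecker_vertex \<times> nat list \<Rightarrow> 'k) module" where
  "K3 \<equiv> path_algebra (kronecker_quiver 3)"

text \<open>The coordinates with respect to the five paths: the two trivial paths and the three
  arrows. Multiplication becomes that of triangular matrices with \<open>x\<close> and
  \<open>y\<close> on the diagonal.\<close>

definition pathalg_elem :: "'k::field \<Rightarrow> 'k \<Rightarrow> 'k \<Rightarrow> 'k \<Rightarrow> 'k \<Rightarrow> kronecker_vertex \<times> nat list \<Rightarrow> 'k" where
  "pathalg_elem x y a b c = (\<lambda>(v, p). case v of
     VX \<Rightarrow> if p = [] then x else if p = [0] then a else if p = [1] then b else if p = [2] then c else 0
   | VY \<Rightarrow> if p = [] then y else 0)"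

lemma pathalg_elem_simps [simp]:
  "pathalg_elem x y a b c (VX, []) = x" "pathalg_elem x y a b c (VY, []) = y"
  "pathalg_elem x y a b c (VX, [0]) = a" "pathalg_elem x y a b c (VX, [Suc 0]) = b"
  "pathalg_elem x y a b c (VX, [2]) = c"
  by (simp_all add: pathalg_elem_def)

lemma paths_K3: "paths (kronecker_quiver 3) = {(VX, []), (VY, []), (VX, [0]), (VX, [1]), (VX, [2])}"
proof -
  interpret pre_digraph "kronecker_quiver 3" .
  have "awalk u p v \<longleftrightarrow> (u, p, v) \<in> {(VX, [], VX), (VY, [], VY), (VX, [0], VY), (VX, [1], VY), (VX, [2], VY)}" for u p v
    unfolding awalk_def by (cases p; cases "tl p"; cases u; cases v) (auto simp: kronecker_quiver_def pre_digraph.cas.simps less_Suc_eq eval_nat_numeral)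
  then show ?thesis unfolding paths_def by auto
qed

lemma carrier_K3: "f \<in> carrier K3 \<longleftrightarrow>
  f = pathalg_elem (f (VX, [])) (f (VY, [])) (f (VX, [0])) (f (VX, [1])) (f (VX, [2]))"
proof -
  have "{p. f p \<noteq> 0} \<subseteq> paths (kronecker_quiver 3) \<Longrightarrow> finite {p. f p \<noteq> 0}"
    by (erule finite_subset) (simp add: paths_K3)
  then have "f \<in> carrier K3 \<longleftrightarrow> {p. f p \<noteq> 0} \<subseteq> paths (kronecker_quiver 3)"
    unfolding path_algebra_def by auto
  also have "\<dots> \<longleftrightarrow> f = pathalg_elem (f (VX, [])) (f (VY, [])) (f (VX, [0])) (f (VX, [1])) (f (VX, [2]))"
  proof
    assume s: "{p. f p \<noteq> 0} \<subseteq> paths (kronecker_quiver 3)"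
    show "f = pathalg_elem (f (VX, [])) (f (VY, [])) (f (VX, [0])) (f (VX, [1])) (f (VX, [2]))"
    proof
      fix vp :: "kronecker_vertex \<times> nat list"
      obtain v p where vp: "vp = (v, p)" by (cases vp)
      have "f vp = 0 \<or> vp \<in> paths (kronecker_quiver 3)" using s by blast
      then show "f vp = pathalg_elem (f (VX, [])) (f (VY, [])) (f (VX, [0])) (f (VX, [1])) (f (VX, [2])) vp"
        unfolding vp paths_K3 by (cases v) (auto simp: pathalg_elem_def)
    qed
  next
    assume e: "f = pathalg_elem (f (VX, [])) (f (VY, [])) (f (VX, [0])) (f (VX, [1])) (f (VX, [2]))"
    show "{p. f p \<noteq> 0} \<subseteq> paths (kronecker_quiver 3)"
    proof (rule subsetI, rule ccontr)
      fix vp assume "vp \<in> {p. f p \<noteq> 0}" and n: "vp \<notin> paths (kronecker_quiver 3)"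
      then have "f vp \<noteq> 0" by simp
      moreover have "f vp = 0"
        using n by (subst e, cases vp, cases "fst vp") (auto simp: pathalg_elem_def paths_K3)
      ultimately show False by simp
    qed
  qed
  finally show ?thesis .
qed

lemma pathalg_elem_closed [simp]: "pathalg_elem x y a b c \<in> carrier K3"
  by (simp add: carrier_K3)

lemma pathalg_elem_cases:
  assumes "f \<in> carrier K3"
  obtains x y a b c where "f = pathalg_elem x y a b c"
  using assms carrier_K3 by blast

lemma pathalg_elem_eq_iff [simp]:
  "pathalg_elem x y a b c = pathalg_elem x' y' a' b' c' \<longleftrightarrow> x = x' \<and> y = y' \<and> a = a' \<and> b = b' \<and> c = c'"
  by (metis pathalg_elem_simps)

lemma pathalg_elem_mult [simp]:
  "pathalg_elem x y a b c \<otimes>\<^bsub>K3\<^esub> pathalg_elem x' y' a' b' c' =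
   pathalg_elem (x * x') (y * y') (a * x' + y * a') (b * x' + y * b') (c * x' + y * c')"
proof
  fix vp :: "kronecker_vertex \<times> nat list"
  obtain v p where vp: "vp = (v, p)" by (cases vp)
  note d = path_algebra_def pathalg_elem_def kronecker_quiver_def pre_digraph.awalk_verts.simps
  show "(pathalg_elem x y a b c \<otimes>\<^bsub>K3\<^esub> pathalg_elem x' y' a' b' c') vp =
   pathalg_elem (x * x') (y * y') (a * x' + y * a') (b * x' + y * b') (c * x' + y * c') vp"
  proof (cases p)
    case Nil
    then show ?thesis unfolding vp by (cases v) (simp_all add: d)
  next
    case (Cons i q)
    show ?thesis
    proof (cases q)
      case Nil
      then show ?thesis unfolding vp Cons by (cases v) (simp_all add: d)
    next
      case (Cons j r)
      \<comment> \<open>No splitting of a path of length at least 2 contributes: for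
        \<open>k = 0\<close> the remaining part is too long, for \<open>k = 1\<close> it is a
        nonempty path starting at the sink, and for larger \<open>k\<close> the initial part is too
        long.\<close>
      have "pathalg_elem x y a b c (last (pre_digraph.awalk_verts (kronecker_quiver 3) v (take k p)), drop k p) *
        pathalg_elem x' y' a' b' c' (v, take k p) = 0" for k
      proof -
        consider "k = 0" | "k = 1" | l where "k = Suc (Suc l)" by (metis One_nat_def not0_implies_Suc)
        then show ?thesis unfolding \<open>p = i # q\<close> Cons
          by cases (cases v; simp add: d)+
      qed
      note z = this
      have "(pathalg_elem x y a b c \<otimes>\<^bsub>K3\<^esub> pathalg_elem x' y' a' b' c') vp = 0"
        unfolding vp by (simp add: path_algebra_def) (intro sum.neutral ballI z)
      moreover have "pathalg_elem x1 x2 x3 x4 x5 vp = 0" for x1 x2 x3 x4 x5 :: 'a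
        unfolding vp \<open>p = i # q\<close> Cons by (cases v) (simp_all add: pathalg_elem_def)
      ultimately show ?thesis by simp
    qed
  qed
qed

lemma pathalg_elem_add [simp]:
  "pathalg_elem x y a b c \<oplus>\<^bsub>K3\<^esub> pathalg_elem x' y' a' b' c' = pathalg_elem (x + x') (y + y') (a + a') (b + b') (c + c')"
  by (rule ext) (auto simp: path_algebra_def pathalg_elem_def split: kronecker_vertex.split)

lemma pathalg_elem_one: "\<one>\<^bsub>K3\<^esub> = pathalg_elem 1 1 0 0 0"
  by (rule ext) (auto simp: path_algebra_def pathalg_elem_def kronecker_quiver_def split: kronecker_vertex.split)

lemma pathalg_elem_zero: "\<zero>\<^bsub>K3\<^esub> = pathalg_elem 0 0 0 0 0"
  by (rule ext) (auto simp: path_algebra_def pathalg_elem_def split: kronecker_vertex.split)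

lemma scalar_K3: "scalar K3 c = pathalg_elem c c 0 0 0"
proof
  fix p show "scalar K3 c p = pathalg_elem c c 0 0 0 p"
    by (cases p; cases "fst p") (auto simp: scalar_def path_algebra_def pathalg_elem_def kronecker_quiver_def)
qed

lemma scalar_K3_closed [simp]: "scalar K3 c \<in> carrier K3"
  by (simp add: scalar_K3)

section \<open>Polynomials of bounded degree as vector spaces, and the projective modules at the
  source\<close>

abbreviation pscale :: "'k::field \<Rightarrow> 'k poly \<Rightarrow> 'k poly" (infixr \<open>*s\<close> 75) where
  "c *s p \<equiv> Polynomial.smult c p"

text \<open>The polynomials of degree less than \<open>n\<close> serve as the vector space \<open>k\<^sup>n\<close>.\<close>

definition kn :: "nat \<Rightarrow> 'k::field poly set" where
  "kn n = {f. \<forall>i\<ge>n. coeff f i = 0}"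

lemma kn_closed [simp, intro]:
  "0 \<in> kn n" "\<lbrakk>f \<in> kn n; g \<in> kn n\<rbrakk> \<Longrightarrow> f + g \<in> kn n" "\<lbrakk>f \<in> kn n; g \<in> kn n\<rbrakk> \<Longrightarrow> f - g \<in> kn n"
  "f \<in> kn n \<Longrightarrow> - f \<in> kn n" "f \<in> kn n \<Longrightarrow> c *s f \<in> kn n" "i < n \<Longrightarrow> monom c i \<in> kn n"
  by (auto simp: kn_def)

lemma kn_mono: "\<lbrakk>f \<in> kn n; n \<le> m\<rbrakk> \<Longrightarrow> f \<in> kn m"
  by (auto simp: kn_def)

lemma kn_0 [simp]: "kn 0 = {0}"
  by (auto simp: kn_def poly_eq_iff)

text \<open>Monomials form a basis, so linear statements are proved by adding one multiple of a
  monomial at a time.\<close>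

lemma kn_induct [consumes 1, case_names zero add]:
  assumes "f \<in> kn n" "P 0"
    and "\<And>f c i. \<lbrakk>f \<in> kn n; P f; i < n\<rbrakk> \<Longrightarrow> P (f + c *s (monom 1 i))"
  shows "P f"
proof -
  have "(\<Sum>i<m. (coeff f i) *s (monom 1 i)) \<in> kn n \<and> P (\<Sum>i<m. (coeff f i) *s (monom 1 i))" if "m \<le> n" for m
    using that by (induction m) (auto simp: assms)
  moreover have "(\<Sum>i<n. (coeff f i) *s (monom 1 i)) = f"
    using assms(1) by (auto simp: poly_eq_iff coeff_sum smult_monom kn_def if_distrib cong: if_cong)
  ultimately show ?thesis by (metis order_refl)
qed

type_synonym 'k triple = "'k poly \<times> 'k poly \<times> 'k poly"

definition kn3 :: "nat \<Rightarrow> 'k::field triple set" where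
  "kn3 n = kn n \<times> kn n \<times> kn n"

text \<open>Left multiplication on coordinate vectors: a path algebra element acts on the source
  component by its coefficient at the trivial path, and each arrow copies that component into its
  own slot at the sink.\<close>

definition act :: "(kronecker_vertex \<times> nat list \<Rightarrow> 'k::field) \<Rightarrow> 'k poly \<times> 'k triple \<Rightarrow> 'k poly \<times> 'k triple" where
  "act a = (\<lambda>(x, u, v, w). ((a (VX, [])) *s x, (a (VX, [0])) *s x + (a (VY, [])) *s u,
     (a (VX, [1])) *s x + (a (VY, [])) *s v, (a (VX, [2])) *s x + (a (VY, [])) *s w))"

text \<open>The projective module \<open>(\<Lambda>\<^sub>3 e\<^sub>x)\<^sup>n\<close>: an element consists of its component at \<open>x\<close> and of three
  components at \<open>y\<close>, one for each arrow.\<close>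

definition proj_x :: "nat \<Rightarrow> (kronecker_vertex \<times> nat list \<Rightarrow> 'k::field, 'k poly \<times> 'k triple) module" where
  "proj_x n = \<lparr>carrier = kn n \<times> kn3 n, mult = undefined, one = undefined, zero = 0, add = (+), smult = act\<rparr>"

lemma proj_x_simps [simp]:
  "carrier (proj_x n) = kn n \<times> kn3 n" "zero (proj_x n) = 0" "add (proj_x n) = (+)" "module.smult (proj_x n) = act"
  by (simp_all add: proj_x_def)

lemma act_pathalg_elem [simp]:
  "act (pathalg_elem p q a b c) (x, u, v, w) =
    (p *s x, a *s x + q *s u, b *s x + q *s v, c *s x + q *s w)"
  by (simp add: act_def)

lemma act_closed: "q \<in> kn n \<times> kn3 n \<Longrightarrow> act a q \<in> kn n \<times> kn3 n"
  by (auto simp: act_def kn3_def)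

text \<open>That the path algebra is a ring is taken as an assumption, because every given module
  over it carries this fact as one of its axioms.\<close>

lemma left_module_proj_x:
  assumes "ring (K3 :: ('k::field, _) module)"
  shows "left_module K3 (proj_x n :: (_, 'k poly \<times> 'k triple) module)"
proof -
  have "abelian_group (proj_x n :: (_, 'k poly \<times> 'k triple) module)"
  proof (intro abelian_groupI)
    fix x assume "x \<in> carrier (proj_x n :: (_, 'k poly \<times> 'k triple) module)"
    then show "\<exists>y\<in>carrier (proj_x n). y \<oplus>\<^bsub>proj_x n\<^esub> x = \<zero>\<^bsub>proj_x n\<^esub>"
      by (intro bexI[of _ "- x"]) (auto simp: kn3_def)
  qed (auto simp: kn3_def zero_prod_def add.assoc add.commute)
  moreover have "left_module_axioms K3 (proj_x n :: (_, 'k poly \<times> 'k triple) module)"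
  proof (rule left_module_axioms.intro)
    fix a b :: "kronecker_vertex \<times> nat list \<Rightarrow> 'k" and x :: "'k poly \<times> 'k triple"
    assume ab: "a \<in> carrier K3" "b \<in> carrier K3" and x: "x \<in> carrier (proj_x n)"
    obtain a0 a1 a2 a3 a4 where a: "a = pathalg_elem a0 a1 a2 a3 a4" using ab(1) by (rule pathalg_elem_cases)
    obtain b0 b1 b2 b3 b4 where b: "b = pathalg_elem b0 b1 b2 b3 b4" using ab(2) by (rule pathalg_elem_cases)
    obtain x0 x1 x2 x3 where xx: "x = (x0, x1, x2, x3)" by (cases x) auto
    show "(a \<oplus>\<^bsub>K3\<^esub> b) \<odot>\<^bsub>proj_x n\<^esub> x = a \<odot>\<^bsub>proj_x n\<^esub> x \<oplus>\<^bsub>proj_x n\<^esub> b \<odot>\<^bsub>proj_x n\<^esub> x"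
      by (simp add: a b xx smult_add_left algebra_simps)
    show "(a \<otimes>\<^bsub>K3\<^esub> b) \<odot>\<^bsub>proj_x n\<^esub> x = a \<odot>\<^bsub>proj_x n\<^esub> (b \<odot>\<^bsub>proj_x n\<^esub> x)"
      by (simp add: a b xx smult_add_left smult_add_right algebra_simps)
  next
    fix a :: "kronecker_vertex \<times> nat list \<Rightarrow> 'k" and x y :: "'k poly \<times> 'k triple"
    assume "a \<in> carrier K3" "x \<in> carrier (proj_x n)" "y \<in> carrier (proj_x n)"
    then show "a \<odot>\<^bsub>proj_x n\<^esub> (x \<oplus>\<^bsub>proj_x n\<^esub> y) = a \<odot>\<^bsub>proj_x n\<^esub> x \<oplus>\<^bsub>proj_x n\<^esub> a \<odot>\<^bsub>proj_x n\<^esub> y"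
      by (auto simp: act_def smult_add_right algebra_simps split: prod.split)
  next
    fix a :: "kronecker_vertex \<times> nat list \<Rightarrow> 'k" and x :: "'k poly \<times> 'k triple"
    assume "a \<in> carrier K3" "x \<in> carrier (proj_x n)"
    then show "a \<odot>\<^bsub>proj_x n\<^esub> x \<in> carrier (proj_x n)" using act_closed by simp
  next
    fix x :: "'k poly \<times> 'k triple" assume "x \<in> carrier (proj_x n)"
    then show "\<one>\<^bsub>K3\<^esub> \<odot>\<^bsub>proj_x n\<^esub> x = x" by (cases x) (auto simp: pathalg_elem_one)
  qed
  ultimately show ?thesis using assms by (simp add: left_module.intro)
qed

text \<open>Replaces finite sums by a closure condition: the set of all linear combinations of
  \<open>S\<close> contains zero and is closed under adding a multiple of an element of
  \<open>S\<close>, so \<open>gen\<close> shows that it is everything.\<close>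

lemma fd_module_K3I:
  fixes M :: "(kronecker_vertex \<times> nat list \<Rightarrow> 'k::field, 'm) module"
  assumes lm: "left_module K3 M" and S: "finite S" "S \<subseteq> carrier M"
    and gen: "\<And>T. \<lbrakk>T \<subseteq> carrier M; \<zero>\<^bsub>M\<^esub> \<in> T; \<And>x c s. \<lbrakk>x \<in> T; s \<in> S\<rbrakk> \<Longrightarrow> x \<oplus>\<^bsub>M\<^esub> scalar K3 c \<odot>\<^bsub>M\<^esub> s \<in> T\<rbrakk> \<Longrightarrow>
      carrier M \<subseteq> T"
  shows "fd_module K3 M"
proof -
  interpret left_module K3 M by (rule lm)
  define T where "T = {x. \<exists>c :: 'm \<Rightarrow> 'k. x = (\<Oplus>\<^bsub>M\<^esub>s\<in>S. scalar K3 (c s) \<odot>\<^bsub>M\<^esub> s)}"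
  have Sc: "s \<in> carrier M" if "s \<in> S" for s using S that by blast
  have cl: "(\<lambda>s. scalar K3 (c s) \<odot>\<^bsub>M\<^esub> s) \<in> S \<rightarrow> carrier M" for c :: "'m \<Rightarrow> 'k" using Sc by simp
  have "carrier M \<subseteq> T"
  proof (rule gen)
    show "T \<subseteq> carrier M" unfolding T_def using cl by (auto intro: M.finsum_closed)
    have z: "scalar K3 (0::'k) \<odot>\<^bsub>M\<^esub> s = \<zero>\<^bsub>M\<^esub>" if "s \<in> S" for s
      using smult_zero_left[OF Sc[OF that]] by (simp add: scalar_K3 pathalg_elem_zero)
    have "(\<Oplus>\<^bsub>M\<^esub>s\<in>S. scalar K3 (0::'k) \<odot>\<^bsub>M\<^esub> s) = (\<Oplus>\<^bsub>M\<^esub>s\<in>S. \<zero>\<^bsub>M\<^esub>)"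
      by (rule M.finsum_cong') (simp_all add: z)
    then have "\<zero>\<^bsub>M\<^esub> = (\<Oplus>\<^bsub>M\<^esub>s\<in>S. scalar K3 (0::'k) \<odot>\<^bsub>M\<^esub> s)" by simp
    then show "\<zero>\<^bsub>M\<^esub> \<in> T" unfolding T_def by (intro CollectI exI[of _ "\<lambda>_. 0"])
  next
    fix x c s assume "x \<in> T" and s: "s \<in> S"
    then obtain d :: "'m \<Rightarrow> 'k" where d: "x = (\<Oplus>\<^bsub>M\<^esub>s\<in>S. scalar K3 (d s) \<odot>\<^bsub>M\<^esub> s)" unfolding T_def by blast
    define e where "e t = (if t = s then d t + c else d t)" for t
    have "(\<Oplus>\<^bsub>M\<^esub>t\<in>S. scalar K3 (e t) \<odot>\<^bsub>M\<^esub> t) =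
      (\<Oplus>\<^bsub>M\<^esub>t\<in>S. scalar K3 (d t) \<odot>\<^bsub>M\<^esub> t \<oplus>\<^bsub>M\<^esub> (if s = t then scalar K3 c \<odot>\<^bsub>M\<^esub> t else \<zero>\<^bsub>M\<^esub>))"
    proof (rule M.finsum_cong')
      fix t assume t: "t \<in> S"
      have "scalar K3 (d s) \<oplus>\<^bsub>K3\<^esub> scalar K3 c = scalar K3 (d s + c)" by (simp add: scalar_K3)
      then show "scalar K3 (e t) \<odot>\<^bsub>M\<^esub> t =
        scalar K3 (d t) \<odot>\<^bsub>M\<^esub> t \<oplus>\<^bsub>M\<^esub> (if s = t then scalar K3 c \<odot>\<^bsub>M\<^esub> t else \<zero>\<^bsub>M\<^esub>)"
        using Sc[OF t] smult_l_distr[of "scalar K3 (d s)" "scalar K3 c" s] by (auto simp: e_def)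
    qed (use Sc in auto)
    also have "\<dots> = x \<oplus>\<^bsub>M\<^esub> (\<Oplus>\<^bsub>M\<^esub>t\<in>S. if s = t then scalar K3 c \<odot>\<^bsub>M\<^esub> t else \<zero>\<^bsub>M\<^esub>)"
      unfolding d by (rule M.finsum_addf) (use Sc in auto)
    also have "(\<Oplus>\<^bsub>M\<^esub>t\<in>S. if s = t then scalar K3 c \<odot>\<^bsub>M\<^esub> t else \<zero>\<^bsub>M\<^esub>) = scalar K3 c \<odot>\<^bsub>M\<^esub> s"
      using M.add.finprod_singleton[OF s S(1), of "\<lambda>t. scalar K3 c \<odot>\<^bsub>M\<^esub> t"] cl[of "\<lambda>_. c"]
      by (simp add: finsum_def)
    finally show "x \<oplus>\<^bsub>M\<^esub> scalar K3 c \<odot>\<^bsub>M\<^esub> s \<in> T" unfolding T_def by (intro CollectI exI[of _ e]) simp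
  qed
  then show ?thesis unfolding fd_module_def T_def using lm S by blast
qed

section \<open>Modules generated at the source\<close>

definition tscale :: "'k::field \<Rightarrow> 'k triple \<Rightarrow> 'k triple" where
  "tscale c = (\<lambda>(u, v, w). (c *s u, c *s v, c *s w))"

lemma tscale_simps [simp]: "tscale c (u, v, w) = (c *s u, c *s v, c *s w)"
  by (simp add: tscale_def)

definition subspace3 :: "nat \<Rightarrow> 'k::field triple set \<Rightarrow> bool" where
  "subspace3 n R \<longleftrightarrow> R \<subseteq> kn3 n \<and> 0 \<in> R \<and> (\<forall>r\<in>R. \<forall>s\<in>R. r + s \<in> R) \<and> (\<forall>c. \<forall>r\<in>R. tscale c r \<in> R)"

lemma subspace3D:
  assumes "subspace3 n R"
  shows "R \<subseteq> kn3 n" "0 \<in> R" "\<And>r s. \<lbrakk>r \<in> R; s \<in> R\<rbrakk> \<Longrightarrow> r + s \<in> R" "\<And>c r. r \<in> R \<Longrightarrow> tscale c r \<in> R"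
    "\<And>r s. \<lbrakk>r \<in> R; s \<in> R\<rbrakk> \<Longrightarrow> r - s \<in> R"
proof -
  show a: "R \<subseteq> kn3 n" "0 \<in> R" "\<And>r s. \<lbrakk>r \<in> R; s \<in> R\<rbrakk> \<Longrightarrow> r + s \<in> R" "\<And>c r. r \<in> R \<Longrightarrow> tscale c r \<in> R"
    using assms unfolding subspace3_def by blast+
  fix r s assume "r \<in> R" "s \<in> R"
  then have "r + tscale (- 1) s \<in> R" using a(3,4) by blast
  moreover have "r + tscale (- 1) s = r - s" by (cases r; cases s) simp
  ultimately show "r - s \<in> R" by simp
qed

text \<open>\<open>M\<close> is the factor module of \<open>(\<Lambda>\<^sub>3 e\<^sub>x)\<^sup>n\<close> by the relations \<open>R\<close> at the vertex \<open>y\<close>.\<close>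

definition presents ::
  "(kronecker_vertex \<times> nat list \<Rightarrow> 'k::field, 'm) module \<Rightarrow> nat \<Rightarrow> 'k triple set \<Rightarrow> ('k poly \<times> 'k triple \<Rightarrow> 'm) \<Rightarrow> bool" where
  "presents M n R \<Psi> \<longleftrightarrow> left_module K3 M \<and> subspace3 n R \<and> factor_map K3 (proj_x n) M \<Psi> ({0} \<times> R)"

text \<open>The idempotent endomorphisms of the factor module are induced by the following maps.\<close>

definition idem_on :: "nat \<Rightarrow> ('k::field poly \<Rightarrow> 'k poly) \<Rightarrow> bool" where
  "idem_on n E \<longleftrightarrow> (\<forall>f\<in>kn n. E f \<in> kn n \<and> E (E f) = E f \<and> (\<forall>c. E (c *s f) = c *s E f) \<and> (\<forall>g\<in>kn n. E (f + g) = E f + E g))"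

text \<open>The factor module is generated at the source, so an endomorphism is determined by its
  component \<open>E\<close> there, and \<open>E\<close> extends to the sink exactly if applying it
  in all three slots preserves \<open>R\<close>. Thus \<open>rigid\<close> says that 0 and 1 are the
  only idempotent endomorphisms.\<close>

definition rigid :: "nat \<Rightarrow> 'k::field triple set \<Rightarrow> bool" where
  "rigid n R \<longleftrightarrow> (\<forall>E. idem_on n E \<and> (\<forall>u v w. (u, v, w) \<in> R \<longrightarrow> (E u, E v, E w) \<in> R) \<longrightarrow>
    (\<forall>f\<in>kn n. E f = 0) \<or> (\<forall>f\<in>kn n. E f = f))"

lemma presents_left_module_proj:
  fixes R :: "'k::field triple set"
  shows "presents M n R \<Psi> \<Longrightarrow> left_module (K3 :: ('k, _) module) (proj_x n :: (_, 'k poly \<times> 'k triple) module)"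
  unfolding presents_def by (meson left_module.axioms(1) left_module_proj_x)

lemma ball_K3_iff: "(\<forall>a\<in>carrier K3. P a) \<longleftrightarrow> (\<forall>p s a b c. P (pathalg_elem p s a b c))"
  by (metis pathalg_elem_cases pathalg_elem_closed)

lemma submodule_proj_x_iff:
  fixes U :: "('k::field poly \<times> 'k triple) set"
  assumes "left_module K3 (proj_x n :: (_, 'k poly \<times> 'k triple) module)"
  shows "submodule U K3 (proj_x n) \<longleftrightarrow> U \<subseteq> kn n \<times> kn3 n \<and> 0 \<in> U \<and> (\<forall>q\<in>U. \<forall>r\<in>U. q + r \<in> U) \<and>
    (\<forall>p s a b c. \<forall>q\<in>U. act (pathalg_elem p s a b c) q \<in> U)"
  unfolding left_module.submodule_iff[OF assms] ball_K3_iff by simp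

lemma submodule_relations:
  fixes R :: "'k::field triple set"
  assumes "left_module K3 (proj_x n :: (_, 'k poly \<times> 'k triple) module)" and R: "subspace3 n R"
  shows "submodule ({0} \<times> R) K3 (proj_x n)"
proof -
  have "act (pathalg_elem p s a b c) (0, r) = (0, tscale s r)" for p s a b c :: 'k and r
    by (cases r) simp
  then show ?thesis unfolding submodule_proj_x_iff[OF assms(1)]
    using subspace3D[OF R] by (auto simp: zero_prod_def)
qed

context
  fixes M :: "(kronecker_vertex \<times> nat list \<Rightarrow> 'k::field, 'm) module" and n R \<Psi>
  assumes pres: "presents M n R \<Psi>"
begin

lemma pres_lm: "left_module K3 M" and pres_R: "subspace3 n R" and pres_fm: "factor_map K3 (proj_x n) M \<Psi> ({0} \<times> R)"
  using pres unfolding presents_def by blast+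

lemma pres_lmF: "left_module (K3 :: ('k, _) module) (proj_x n :: (_, 'k poly \<times> 'k triple) module)"
  using presents_left_module_proj[OF pres] .

interpretation left_module K3 M by (rule pres_lm)

lemma pres_closed: "\<lbrakk>x \<in> kn n; u \<in> kn n; v \<in> kn n; w \<in> kn n\<rbrakk> \<Longrightarrow> \<Psi> (x, u, v, w) \<in> carrier M"
  using factor_map_closed[OF pres_fm] by (simp add: kn3_def)

lemma pres_add: "\<lbrakk>q \<in> kn n \<times> kn3 n; r \<in> kn n \<times> kn3 n\<rbrakk> \<Longrightarrow> \<Psi> (q + r) = \<Psi> q \<oplus>\<^bsub>M\<^esub> \<Psi> r"
  using factor_map_add[OF pres_fm] by simp

lemma pres_smult: "q \<in> kn n \<times> kn3 n \<Longrightarrow> \<Psi> (act (pathalg_elem p s a b c) q) = pathalg_elem p s a b c \<odot>\<^bsub>M\<^esub> \<Psi> q"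
  using factor_map_smult[OF pres_fm] by simp

lemma pres_zero_iff: "q \<in> kn n \<times> kn3 n \<Longrightarrow> \<Psi> q = \<zero>\<^bsub>M\<^esub> \<longleftrightarrow> fst q = 0 \<and> snd q \<in> R"
  using factor_map_zero_iff[OF pres_lmF pres_fm] by (cases q) simp

lemma pres_surj: "z \<in> carrier M \<Longrightarrow> \<exists>x u v w. x \<in> kn n \<and> u \<in> kn n \<and> v \<in> kn n \<and> w \<in> kn n \<and> z = \<Psi> (x, u, v, w)"
proof -
  assume "z \<in> carrier M"
  from factor_map_surj[OF pres_fm this] obtain q where "q \<in> kn n \<times> kn3 n" "z = \<Psi> q" by auto
  then show ?thesis by (cases q) (auto simp: kn3_def)
qed

lemma fd_module_if_presents: "fd_module K3 M"
proof -
  define S0 :: "('k poly \<times> 'k triple) set" where "S0 = (\<Union>i<n. {(monom 1 i, 0, 0, 0), (0, monom 1 i, 0, 0), (0, 0, monom 1 i, 0), (0, 0, 0, monom 1 i)})"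
  have S0: "S0 \<subseteq> kn n \<times> kn3 n" unfolding S0_def kn3_def by auto
  show ?thesis
  proof (rule fd_module_K3I[OF pres_lm])
    show "finite (\<Psi> ` S0)" unfolding S0_def by simp
    show "\<Psi> ` S0 \<subseteq> carrier M" using S0 factor_map_closed[OF pres_fm] by auto
  next
    fix T assume T: "T \<subseteq> carrier M" "\<zero>\<^bsub>M\<^esub> \<in> T"
      "\<And>x (c::'k) s. \<lbrakk>x \<in> T; s \<in> \<Psi> ` S0\<rbrakk> \<Longrightarrow> x \<oplus>\<^bsub>M\<^esub> scalar K3 c \<odot>\<^bsub>M\<^esub> s \<in> T"
    have step: "\<Psi> (q + act (pathalg_elem c c 0 0 0) s) \<in> T" if q: "q \<in> kn n \<times> kn3 n" "\<Psi> q \<in> T" and s: "s \<in> S0" for q c s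
    proof -
      have sc: "s \<in> kn n \<times> kn3 n" using S0 s by blast
      have "\<Psi> (q + act (pathalg_elem c c 0 0 0) s) = \<Psi> q \<oplus>\<^bsub>M\<^esub> scalar K3 c \<odot>\<^bsub>M\<^esub> \<Psi> s"
        using pres_add[OF q(1) act_closed[OF sc]] pres_smult[OF sc] by (simp add: scalar_K3)
      then show ?thesis using T(3)[of "\<Psi> q" "\<Psi> s" c] q s by simp
    qed
    have "\<Psi> 0 = \<zero>\<^bsub>M\<^esub>" using factor_map_zero[OF pres_fm] by simp
    then have z: "\<Psi> (0, 0, 0, 0) \<in> T" using T(2) by (simp add: zero_prod_def)
    have a: "\<Psi> (x, 0, 0, 0) \<in> T" if "x \<in> kn n" for x
      using that
    proof (induction rule: kn_induct)
      case (add f c i)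
      then show ?case using step[of "(f, 0, 0, 0)" "(monom 1 i, 0, 0, 0)" c] by (auto simp: S0_def kn3_def)
    qed (simp add: z)
    have b: "\<Psi> (x, u, 0, 0) \<in> T" if "u \<in> kn n" "x \<in> kn n" for x u
      using that
    proof (induction rule: kn_induct)
      case (add f c i)
      then show ?case using step[of "(x, f, 0, 0)" "(0, monom 1 i, 0, 0)" c] by (auto simp: S0_def kn3_def)
    qed (simp add: a)
    have c: "\<Psi> (x, u, v, 0) \<in> T" if "v \<in> kn n" "x \<in> kn n" "u \<in> kn n" for x u v
      using that
    proof (induction rule: kn_induct)
      case (add f c i)
      then show ?case using step[of "(x, u, f, 0)" "(0, 0, monom 1 i, 0)" c] by (auto simp: S0_def kn3_def)
    qed (simp add: b)
    have d: "\<Psi> (x, u, v, w) \<in> T" if "w \<in> kn n" "x \<in> kn n" "u \<in> kn n" "v \<in> kn n" for x u v w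
      using that
    proof (induction rule: kn_induct)
      case (add f c i)
      then show ?case using step[of "(x, u, v, f)" "(0, 0, 0, monom 1 i)" c] by (auto simp: S0_def kn3_def)
    qed (simp add: c)
    then show "carrier M \<subseteq> T" using pres_surj by blast
  qed
qed

text \<open>A decomposition into \<open>U\<close> and \<open>V\<close> decomposes the source
  component, and the projection \<open>E\<close> onto the part in \<open>U\<close> preserves the
  relations. If it is 0 or 1, then \<open>V\<close> or \<open>U\<close> contains the whole source
  component, which generates \<open>M\<close>.\<close>

lemma indecomposable_module_if_rigid:
  assumes n: "n > 0" and rigid: "rigid n R"
  shows "indecomposable_module K3 M"
proof -
  have xF: "(x, 0, 0, 0) \<in> kn n \<times> kn3 n" if "x \<in> kn n" for x :: "'k poly" using that by (simp add: kn3_def)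
  have "\<Psi> (1, 0, 0, 0) \<noteq> \<zero>\<^bsub>M\<^esub>" "\<Psi> (1, 0, 0, 0) \<in> carrier M"
    using pres_zero_iff[of "(1, 0, 0, 0)"] pres_closed[of 1 0 0 0] n by (auto simp: kn_def kn3_def)
  then have nz: "carrier M \<noteq> {\<zero>\<^bsub>M\<^esub>}" by blast
  have "U = {\<zero>\<^bsub>M\<^esub>} \<or> V = {\<zero>\<^bsub>M\<^esub>}"
    if UV: "submodule U K3 M" "submodule V K3 M" "U \<inter> V = {\<zero>\<^bsub>M\<^esub>}" "U <+>\<^bsub>M\<^esub> V = carrier M" for U V
  proof -
    note u = UV(1)[unfolded submodule_iff] and v = UV(2)[unfolded submodule_iff]
    define p where "p x = \<Psi> (x, 0, 0, 0)" for x
    have p_add: "p (x + y) = p x \<oplus>\<^bsub>M\<^esub> p y" if "x \<in> kn n" "y \<in> kn n" for x y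
      unfolding p_def using pres_add[OF xF[OF that(1)] xF[OF that(2)]] by simp
    have p_closed: "p x \<in> carrier M" if "x \<in> kn n" for x unfolding p_def using pres_closed that by simp
    have p_inj: "x = 0" if "x \<in> kn n" "p x = \<zero>\<^bsub>M\<^esub>" for x
      using pres_zero_iff[OF xF[OF that(1)]] that(2) unfolding p_def by simp
    have p_scale: "p (c *s x) = pathalg_elem c 0 0 0 0 \<odot>\<^bsub>M\<^esub> p x" if "x \<in> kn n" for c x
      using pres_smult[OF xF[OF that], of c 0 0 0 0] unfolding p_def by simp
    have arrows: "\<Psi> (0, x, y, z) = pathalg_elem 0 0 1 0 0 \<odot>\<^bsub>M\<^esub> p x \<oplus>\<^bsub>M\<^esub> pathalg_elem 0 0 0 1 0 \<odot>\<^bsub>M\<^esub> p y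
        \<oplus>\<^bsub>M\<^esub> pathalg_elem 0 0 0 0 1 \<odot>\<^bsub>M\<^esub> p z" if "x \<in> kn n" "y \<in> kn n" "z \<in> kn n" for x y z
    proof -
      have "\<Psi> (0, x, y, z) = \<Psi> (0, x, 0, 0) \<oplus>\<^bsub>M\<^esub> \<Psi> (0, 0, y, 0) \<oplus>\<^bsub>M\<^esub> \<Psi> (0, 0, 0, z)"
        using pres_add[of "(0, x, y, 0)" "(0, 0, 0, z)"] pres_add[of "(0, x, 0, 0)" "(0, 0, y, 0)"] that
        by (simp add: kn3_def)
      then show ?thesis using pres_smult[OF xF] that unfolding p_def by (simp flip: pres_smult)
    qed
    have ex: "\<exists>y\<in>kn n. p y \<in> U \<and> p (x - y) \<in> V" if x: "x \<in> kn n" for x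
    proof -
      obtain a b where ab: "a \<in> U" "b \<in> V" "p x = a \<oplus>\<^bsub>M\<^esub> b"
        using p_closed[OF x] UV(4) unfolding set_add_def' by blast
      have abc: "a \<in> carrier M" "b \<in> carrier M" using ab u v by blast+
      obtain y y1 y2 y3 where y: "a = \<Psi> (y, y1, y2, y3)" "y \<in> kn n" "y1 \<in> kn n" "y2 \<in> kn n" "y3 \<in> kn n"
        using pres_surj[OF abc(1)] by blast
      \<comment> \<open>The idempotent of the source turns the two summands of \<open>p x\<close>
        into \<open>p y\<close> and \<open>p (x - y)\<close>, and it keeps them in \<open>U\<close>
        and \<open>V\<close>.\<close>
      let ?e = "pathalg_elem 1 0 0 0 0 :: kronecker_vertex \<times> nat list \<Rightarrow> 'k"
      have ea: "?e \<odot>\<^bsub>M\<^esub> a = p y"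
        unfolding y(1) p_def using pres_smult[of "(y, y1, y2, y3)" 1 0 0 0 0] y by (simp add: kn3_def)
      have "p x = ?e \<odot>\<^bsub>M\<^esub> p x" using p_scale[OF x, of 1] by simp
      also have "\<dots> = p y \<oplus>\<^bsub>M\<^esub> ?e \<odot>\<^bsub>M\<^esub> b" unfolding ab(3) ea[symmetric] using abc by (simp add: smult_r_distr)
      finally have e1: "p x = p y \<oplus>\<^bsub>M\<^esub> ?e \<odot>\<^bsub>M\<^esub> b" .
      have e2: "p x = p y \<oplus>\<^bsub>M\<^esub> p (x - y)" using p_add[of y "x - y"] x y(2) by simp
      have "p (x - y) = ?e \<odot>\<^bsub>M\<^esub> b"
        using e1 e2 M.r_neg1[of "p y" "p (x - y)"] M.r_neg1[of "p y" "?e \<odot>\<^bsub>M\<^esub> b"] p_closed x y(2) abc by simp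
      moreover have "?e \<odot>\<^bsub>M\<^esub> b \<in> V" "?e \<odot>\<^bsub>M\<^esub> a \<in> U" using ab u v pathalg_elem_closed by blast+
      ultimately show ?thesis using y(2) ea by (intro bexI[of _ y]) simp_all
    qed
    define E where "E x = (SOME y. y \<in> kn n \<and> p y \<in> U \<and> p (x - y) \<in> V)" for x
    have E: "E x \<in> kn n" "p (E x) \<in> U" "p (x - E x) \<in> V" if "x \<in> kn n" for x
      using someI_ex[of "\<lambda>y. y \<in> kn n \<and> p y \<in> U \<and> p (x - y) \<in> V"] ex[OF that] unfolding E_def by blast+
    have p_neg: "p (- y) = \<ominus>\<^bsub>M\<^esub> p y" if "y \<in> kn n" for y
    proof -
      have "p (- y) \<oplus>\<^bsub>M\<^esub> p y = p 0" using p_add[of "- y" y] that by simp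
      also have "p 0 = \<zero>\<^bsub>M\<^esub>" unfolding p_def using pres_zero_iff[OF xF] subspace3D(2)[OF pres_R] by (simp add: zero_prod_def)
      finally show ?thesis using p_closed that by (simp add: M.minus_equality)
    qed
    have p_diff: "p (x - y) = p x \<ominus>\<^bsub>M\<^esub> p y" if "x \<in> kn n" "y \<in> kn n" for x y
      using p_add[of x "- y"] p_neg that by (simp add: a_minus_def)
    have uniq: "E x = y" if "x \<in> kn n" "y \<in> kn n" "p y \<in> U" "p (x - y) \<in> V" for x y
    proof -
      have "p (E x - y) \<in> U" using p_diff[of "E x" y] submodule_diff[OF UV(1)] that E by simp
      moreover have "p (E x - y) = p (x - y) \<ominus>\<^bsub>M\<^esub> p (x - E x)"
        using p_diff[of "x - y" "x - E x"] that E by simp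
      then have "p (E x - y) \<in> V" using submodule_diff[OF UV(2)] that E by simp
      ultimately show ?thesis using UV(3) p_inj[of "E x - y"] E that by auto
    qed
    have "idem_on n E"
      unfolding idem_on_def
    proof (intro ballI conjI allI)
      fix f :: "'k poly" assume f: "f \<in> kn n"
      have p0: "p 0 \<in> V" using v pres_zero_iff[OF xF[of 0]] subspace3D(2)[OF pres_R] unfolding p_def by (simp add: zero_prod_def)
      show "E f \<in> kn n" using E f by simp
      show "E (E f) = E f" using uniq[of "E f" "E f"] E f p0 by simp
      fix c
      have "c *s f - c *s E f = c *s (f - E f)" by (simp add: smult_diff_right)
      then show "E (c *s f) = c *s E f"
        using uniq[of "c *s f" "c *s E f"] E[OF f] f u v p_scale[of _ c] by simp
    next
      fix f g :: "'k poly" assume fg: "f \<in> kn n" "g \<in> kn n"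
      have d: "f + g - (E f + E g) = (f - E f) + (g - E g)" by simp
      have "p (f + g - (E f + E g)) = p (f - E f) \<oplus>\<^bsub>M\<^esub> p (g - E g)"
        unfolding d by (rule p_add) (use fg E in simp_all)
      then show "E (f + g) = E f + E g"
        using uniq[of "f + g" "E f + E g"] E[OF fg(1)] E[OF fg(2)] fg u v p_add[of "E f" "E g"] by simp
    qed
    moreover have "(E x, E y, E z) \<in> R" if r: "(x, y, z) \<in> R" for x y z
    proof -
      have k: "x \<in> kn n" "y \<in> kn n" "z \<in> kn n" using r subspace3D(1)[OF pres_R] by (auto simp: kn3_def)
      \<comment> \<open>A relation splits into a part in \<open>U\<close> and a part in
        \<open>V\<close>. Their sum is zero, so the first part lies in the intersection and
        vanishes.\<close>
      have UE: "\<Psi> (0, E x, E y, E z) \<in> U" using arrows[OF E(1) E(1) E(1)] k E u by simp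
      have VE: "\<Psi> (0, x - E x, y - E y, z - E z) \<in> V"
        using arrows[of "x - E x" "y - E y" "z - E z"] k E v by simp
      have c: "(0, E x, E y, E z) \<in> kn n \<times> kn3 n" "(0, x - E x, y - E y, z - E z) \<in> kn n \<times> kn3 n"
        using k E by (simp_all add: kn3_def)
      have "\<Psi> (0, E x, E y, E z) \<oplus>\<^bsub>M\<^esub> \<Psi> (0, x - E x, y - E y, z - E z) = \<zero>\<^bsub>M\<^esub>"
        using pres_add[OF c] pres_zero_iff[of "(0, x, y, z)"] k r by (simp add: kn3_def)
      then have "\<Psi> (0, E x, E y, E z) \<oplus>\<^bsub>M\<^esub> \<Psi> (0, x - E x, y - E y, z - E z) \<in> V" using v by simp
      then have "\<Psi> (0, E x, E y, E z) \<in> V"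
        using submodule_add_diff_iff[OF UV(2) _ VE] factor_map_closed[OF pres_fm] c by simp
      then have "\<Psi> (0, E x, E y, E z) = \<zero>\<^bsub>M\<^esub>" using UE UV(3) by blast
      then show ?thesis using pres_zero_iff[OF c(1)] by simp
    qed
    ultimately consider "\<And>f. f \<in> kn n \<Longrightarrow> E f = 0" | "\<And>f. f \<in> kn n \<Longrightarrow> E f = f"
      using rigid unfolding rigid_def by blast
    then show ?thesis
    proof cases
      case 1
      then have pV: "p x \<in> V" if "x \<in> kn n" for x using E(3)[OF that] that by simp
      have "carrier M \<subseteq> V"
      proof
        fix z assume "z \<in> carrier M"
        then obtain x x1 x2 x3 where z: "z = \<Psi> (x, x1, x2, x3)" "x \<in> kn n" "x1 \<in> kn n" "x2 \<in> kn n" "x3 \<in> kn n"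
          using pres_surj by blast
        then have "z = p x \<oplus>\<^bsub>M\<^esub> \<Psi> (0, x1, x2, x3)" unfolding p_def
          using pres_add[of "(x, 0, 0, 0)" "(0, x1, x2, x3)"] by (simp add: kn3_def)
        then show "z \<in> V" using arrows[OF z(3-5)] pV z v by simp
      qed
      then show ?thesis using UV(3) u by blast
    next
      case 2
      then have pU: "p x \<in> U" if "x \<in> kn n" for x using E(2)[OF that] that by simp
      have "carrier M \<subseteq> U"
      proof
        fix z assume "z \<in> carrier M"
        then obtain x x1 x2 x3 where z: "z = \<Psi> (x, x1, x2, x3)" "x \<in> kn n" "x1 \<in> kn n" "x2 \<in> kn n" "x3 \<in> kn n"
          using pres_surj by blast
        then have "z = p x \<oplus>\<^bsub>M\<^esub> \<Psi> (0, x1, x2, x3)" unfolding p_def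
          using pres_add[of "(x, 0, 0, 0)" "(0, x1, x2, x3)"] by (simp add: kn3_def)
        then show "z \<in> U" using arrows[OF z(3-5)] pU z u by simp
      qed
      then show ?thesis using UV(3) v by blast
    qed
  qed
  then show ?thesis unfolding indecomposable_module_def using nz by blast
qed

end


section \<open>Accessibility via minimal and maximal submodules of a presented module\<close>

definition shift3 :: "'k::field triple \<Rightarrow> 'k triple" where
  "shift3 = (\<lambda>(u, v, w). (pCons 0 u, pCons 0 v, pCons 0 w))"

lemma shift3_simps [simp]: "shift3 (u, v, w) = (pCons 0 u, pCons 0 v, pCons 0 w)"
  by (simp add: shift3_def)

lemma kn_pCons [simp]: "pCons c f \<in> kn (Suc n) \<longleftrightarrow> f \<in> kn n"
  unfolding kn_def by (auto simp: coeff_pCons split: nat.splits)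

lemma shift3_mem_kn3 [simp]: "shift3 r \<in> kn3 (Suc n) \<longleftrightarrow> r \<in> kn3 n"
  by (cases r) (simp add: kn3_def)

lemma shift3_add: "shift3 (r + s) = shift3 r + shift3 s"
  by (cases r; cases s) simp

lemma kn_1_cases: "f \<in> kn 1 \<Longrightarrow> \<exists>c. f = [:c:]"
  by (rule exI[of _ "coeff f 0"]) (simp add: kn_def poly_eq_iff coeff_pCons split: nat.splits)

text \<open>The length has to be positive because the inductive rules require the next length
  \<open>Suc l\<close> to exceed 1.\<close>

definition acc :: "(kronecker_vertex \<times> nat list \<Rightarrow> 'k::field, 'm) module \<Rightarrow> bool" where
  "acc M \<longleftrightarrow> (\<exists>l>0. accessible_of_length K3 M l)"

lemma proj_x_minus:
  assumes "left_module (K3 :: ('k::field, _) module) (proj_x n :: (_, 'k poly \<times> 'k triple) module)"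
    and q: "q \<in> carrier (proj_x n :: (_, 'k poly \<times> 'k triple) module)" and r: "r \<in> carrier (proj_x n)"
  shows "q \<ominus>\<^bsub>proj_x n\<^esub> r = q - r"
proof -
  interpret left_module "K3 :: ('k, _) module" "proj_x n :: (_, 'k poly \<times> 'k triple) module" by fact
  have "- r \<in> carrier (proj_x n)" using r by (auto simp: kn3_def)
  then have "\<ominus>\<^bsub>proj_x n\<^esub> r = - r" using r by (intro M.minus_equality) simp_all
  then show ?thesis by (simp add: a_minus_def)
qed

context
  fixes M :: "(kronecker_vertex \<times> nat list \<Rightarrow> 'k::field, 'm) module" and n R \<Psi>
  assumes pres: "presents M n R \<Psi>"
begin

lemmas lm = pres_lm[OF pres] and subR = pres_R[OF pres] and fm = pres_fm[OF pres]
  and lmF = pres_lmF[OF pres]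

interpretation left_module K3 M by (rule lm)
interpretation F: left_module "K3 :: ('k, _) module" "proj_x n :: (_, 'k poly \<times> 'k triple) module" by (rule lmF)

text \<open>Submodules of \<open>M\<close> are studied through their preimages in the projective
  module, where elements have coordinates.\<close>

definition Pre :: "'m set \<Rightarrow> ('k poly \<times> 'k triple) set" where
  "Pre W = {q \<in> carrier (proj_x n). \<Psi> q \<in> W}"

lemma Pre_submodule: "submodule W K3 M \<Longrightarrow> submodule (Pre W) K3 (proj_x n)"
  unfolding Pre_def by (rule factor_map_preimage[OF lmF fm])

lemma relations_Pre:
  assumes "submodule W K3 M" shows "{0} \<times> R \<subseteq> Pre W"
proof
  fix q :: "'k poly \<times> 'k triple" assume q: "q \<in> {0} \<times> R"
  then have c: "q \<in> carrier (proj_x n)" using subspace3D(1)[OF subR] by auto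
  then have "\<Psi> q = \<zero>\<^bsub>M\<^esub>" using factor_map_zero_iff[OF lmF fm c] q by blast
  then show "q \<in> Pre W" using c assms unfolding Pre_def submodule_iff by simp
qed

lemma mem_iff_Pre:
  assumes "submodule W K3 M"
  shows "z \<in> W \<longleftrightarrow> (\<exists>q\<in>Pre W. z = \<Psi> q)"
proof
  assume z: "z \<in> W"
  then have "z \<in> carrier M" using assms unfolding submodule_iff by blast
  then obtain q where "q \<in> carrier (proj_x n)" "z = \<Psi> q" using factor_map_surj[OF fm] by blast
  then show "\<exists>q\<in>Pre W. z = \<Psi> q" using z unfolding Pre_def by blast
qed (auto simp: Pre_def)

lemma Pre_add: "\<lbrakk>submodule W K3 M; q \<in> Pre W; r \<in> Pre W\<rbrakk> \<Longrightarrow> q + r \<in> Pre W"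
  using Pre_submodule[of W] unfolding submodule_proj_x_iff[OF lmF] by blast

lemma Pre_act: "\<lbrakk>submodule W K3 M; q \<in> Pre W\<rbrakk> \<Longrightarrow> act (pathalg_elem p s a b c) q \<in> Pre W"
  using Pre_submodule[of W] unfolding submodule_proj_x_iff[OF lmF] by blast

lemma act_0_r: "act (pathalg_elem p s a b c) (0, r) = (0, tscale s r)"
  by (cases r) simp

lemma act_scalar: "act (pathalg_elem c c 0 0 0) (x, r) = (c *s x, tscale c r)"
  by (cases r) simp

text \<open>With the whole sink component divided out, only the simple module at the source is
  left.\<close>

lemma acc_simple:
  assumes n: "n = 1" and R: "R = kn3 1"
  shows "acc M"
proof -
  have "simple_module K3 M"
    unfolding simple_module_def
  proof (intro conjI allI impI)
    have onec: "(1, 0, 0, 0) \<in> carrier (proj_x n)" using n by (simp add: kn3_def kn_def)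
    have "\<Psi> (1, 0, 0, 0) \<in> carrier M" "\<Psi> (1, 0, 0, 0) \<noteq> \<zero>\<^bsub>M\<^esub>"
      using factor_map_closed[OF fm onec] factor_map_zero_iff[OF lmF fm onec] by simp_all
    then show "carrier M \<noteq> {\<zero>\<^bsub>M\<^esub>}" by blast
    fix U assume U: "submodule U K3 M"
    have rel: "(0, r) \<in> Pre U" if "r \<in> kn3 1" for r
      using relations_Pre[OF U] that R by blast
    show "U = {\<zero>\<^bsub>M\<^esub>} \<or> U = carrier M"
    proof (cases "\<exists>q\<in>Pre U. fst q \<noteq> 0")
      case True
      then obtain f r where fr: "(f, r) \<in> Pre U" "f \<noteq> 0" by force
      then have frk: "f \<in> kn 1" "r \<in> kn3 1" using n unfolding Pre_def by auto
      then obtain c where c: "f = [:c:]" using kn_1_cases by blast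
      have "z \<in> U" if z: "z \<in> carrier M" for z
      proof -
        obtain g s where gs: "z = \<Psi> (g, s)" "g \<in> kn 1" "s \<in> kn3 1"
          using factor_map_surj[OF fm z] n by auto
        obtain d where d: "g = [:d:]" using kn_1_cases gs by blast
        have "tscale (d / c) r \<in> kn3 1" using frk by (cases r) (simp add: kn3_def)
        then have "s - tscale (d / c) r \<in> kn3 1" using gs(3) by (cases s; cases "tscale (d / c) r") (simp add: kn3_def)
        then have "act (pathalg_elem (d / c) (d / c) 0 0 0) (f, r) + (0, s - tscale (d / c) r) \<in> Pre U"
          using Pre_add[OF U Pre_act[OF U fr(1)] rel] by blast
        moreover have "act (pathalg_elem (d / c) (d / c) 0 0 0) (f, r) + (0, s - tscale (d / c) r) = (g, s)"
          unfolding act_scalar using c d fr(2) by simp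
        ultimately show ?thesis unfolding gs(1) mem_iff_Pre[OF U] by metis
      qed
      then show ?thesis using U unfolding submodule_iff by blast
    next
      case False
      have "z = \<zero>\<^bsub>M\<^esub>" if z: "z \<in> U" for z
      proof -
        obtain q where q: "q \<in> Pre U" "z = \<Psi> q" using z mem_iff_Pre[OF U] by blast
        then have c: "q \<in> carrier (proj_x n)" unfolding Pre_def by blast
        then have "q \<in> {0} \<times> R" using False q(1) n R by (cases q) auto
        then show ?thesis using factor_map_zero_iff[OF lmF fm c] q(2) by blast
      qed
      then show ?thesis using U unfolding submodule_iff by blast
    qed
  qed
  then show ?thesis unfolding acc_def
    using accessible_of_length_simple[OF fd_module_if_presents[OF pres]] by (intro exI[of _ 1]) simp
qed

text \<open>By \<open>codim\<close>, the image of \<open>R'\<close> in \<open>M\<close> is a line at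
  the sink, hence a minimal submodule, and the factor module is presented by \<open>R'\<close>. The
  last hypothesis speaks of all modules so presented, since the factor module is constructed only up
  to isomorphism.\<close>

lemma acc_factor:
  assumes n: "n > 0" and rigid: "rigid n R" and R': "subspace3 n R'" "R \<subseteq> R'" and r0: "r0 \<in> R'" "r0 \<notin> R"
    and codim: "\<And>r. r \<in> R' \<Longrightarrow> \<exists>c. r - tscale c r0 \<in> R"
    and acc: "\<And>(N :: (kronecker_vertex \<times> nat list \<Rightarrow> 'k, 'm) module) \<Phi>. presents N n R' \<Phi> \<Longrightarrow> acc N"
  shows "acc M"
proof -
  let ?L = "{0 :: 'k poly} \<times> R'"
  have L: "submodule ?L K3 (proj_x n)" "{0} \<times> R \<subseteq> ?L"
    using submodule_relations[OF lmF R'(1)] R'(2) by auto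
  let ?U = "\<Psi> ` ?L"
  have U: "submodule ?U K3 M" using factor_map_image[OF lmF fm L(1)] .
  obtain N :: "(kronecker_vertex \<times> nat list \<Rightarrow> 'k, 'm) module" and q where q: "factor_map K3 M N q ?U"
    using ex_factor_module[OF lm U] by blast
  have "presents N n R' (\<lambda>x. q (\<Psi> x))"
    unfolding presents_def using factor_map_comp[OF lmF fm L q] R'(1) factor_map_left_module[OF lm q] by blast
  then obtain l where l: "l > 0" "accessible_of_length K3 N l" using acc unfolding acc_def by blast
  have r0c: "(0, r0) \<in> carrier (proj_x n)" using r0 subspace3D(1)[OF R'(1)] by auto
  then have "\<Psi> (0, r0) \<noteq> \<zero>\<^bsub>M\<^esub>" using factor_map_zero_iff[OF lmF fm r0c] r0(2) by simp
  moreover have "\<Psi> (0, r0) \<in> ?U" using r0(1) by blast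
  ultimately have nz: "?U \<noteq> {\<zero>\<^bsub>M\<^esub>}" by blast
  have min: "W = {\<zero>\<^bsub>M\<^esub>} \<or> W = ?U" if W: "submodule W K3 M" "W \<subseteq> ?U" for W
  proof -
    have PL: "q \<in> ?L" if "q \<in> Pre W" for q
      using that W(2) factor_map_image_mem_iff[OF lmF fm L] unfolding Pre_def by blast
    show ?thesis
    proof (cases "Pre W \<subseteq> {0} \<times> R")
      case True
      have "z = \<zero>\<^bsub>M\<^esub>" if z: "z \<in> W" for z
      proof -
        obtain q where qp: "q \<in> Pre W" "z = \<Psi> q" using z mem_iff_Pre[OF W(1)] by blast
        then have c: "q \<in> carrier (proj_x n)" unfolding Pre_def by blast
        then show ?thesis using factor_map_zero_iff[OF lmF fm c] qp True by blast
      qed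
      then show ?thesis using W unfolding submodule_iff by blast
    next
      case False
      then obtain r where r: "(0, r) \<in> Pre W" "r \<in> R'" "r \<notin> R" using PL by blast
      \<comment> \<open>An element of \<open>R'\<close> outside \<open>R\<close> is, modulo
        \<open>R\<close>, a nonzero multiple of \<open>r0\<close>. So it yields \<open>r0\<close>,
        and with it all of \<open>R'\<close>.\<close>
      obtain c where c: "r - tscale c r0 \<in> R" using codim[OF r(2)] by blast
      have rel: "(0, s) \<in> Pre W" if "s \<in> R" for s using relations_Pre[OF W(1)] that by blast
      have "c \<noteq> 0"
      proof
        assume "c = 0"
        then have "tscale c r0 = 0" by (cases r0) (simp add: zero_prod_def)
        then show False using c r(3) by simp
      qed
      have "(0, r) + act (pathalg_elem (- 1) (- 1) 0 0 0) (0, r - tscale c r0) \<in> Pre W"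
        using Pre_add[OF W(1) r(1) Pre_act[OF W(1) rel[OF c]]] .
      also have "(0, r) + act (pathalg_elem (- 1) (- 1) 0 0 0) (0, r - tscale c r0) = (0, tscale c r0)"
        unfolding act_0_r by (cases r; cases r0) simp
      finally have "act (pathalg_elem 0 (1 / c) 0 0 0) (0, tscale c r0) \<in> Pre W"
        using Pre_act[OF W(1)] by blast
      also have "act (pathalg_elem 0 (1 / c) 0 0 0) (0, tscale c r0) = (0, r0)"
        unfolding act_0_r using \<open>c \<noteq> 0\<close> by (cases r0) simp
      finally have r0P: "(0, r0) \<in> Pre W" .
      have "(0, s) \<in> Pre W" if s: "s \<in> R'" for s
      proof -
        obtain d where d: "s - tscale d r0 \<in> R" using codim[OF s] by blast
        have "(0, s - tscale d r0) + act (pathalg_elem 0 d 0 0 0) (0, r0) \<in> Pre W"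
          using Pre_add[OF W(1) rel[OF d] Pre_act[OF W(1) r0P]] .
        then show ?thesis unfolding act_0_r by simp
      qed
      then have "?U \<subseteq> W" unfolding Pre_def by blast
      then show ?thesis using W(2) by blast
    qed
  qed
  show ?thesis unfolding acc_def
    using accessible_of_length_factor_module[OF fd_module_if_presents[OF pres]
      indecomposable_module_if_rigid[OF pres n rigid] q U nz min l(2,1)] by blast
qed

text \<open>The elements whose source component has no constant term form a maximal submodule. By
  \<open>gen\<close>, its sink component is still reached from multiples of \<open>x\<close>, so
  multiplication by \<open>x\<close> identifies the submodule with a module on \<open>m\<close>
  generators.\<close>

lemma acc_submodule:
  assumes n: "n = Suc m" and rigid: "rigid n R"
    and gen: "\<And>r. r \<in> kn3 n \<Longrightarrow> \<exists>s\<in>kn3 m. r - shift3 s \<in> R"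
    and acc: "\<And>(N :: (kronecker_vertex \<times> nat list \<Rightarrow> 'k, 'm) module) \<Phi>.
      presents N m {r \<in> kn3 m. shift3 r \<in> R} \<Phi> \<Longrightarrow> acc N"
  shows "acc M"
proof -
  let ?L = "{q \<in> carrier (proj_x n). coeff (fst q) 0 = (0::'k)}"
  have L: "submodule ?L K3 (proj_x n)" unfolding submodule_proj_x_iff[OF lmF]
  proof (intro conjI ballI allI)
    fix p s a b c :: 'k and q assume "q \<in> ?L"
    then show "act (pathalg_elem p s a b c) q \<in> ?L"
      using act_closed[of q n "pathalg_elem p s a b c"] by (cases q) auto
  qed (auto simp: kn3_def zero_prod_def)
  have RL: "{0} \<times> R \<subseteq> ?L" using subspace3D(1)[OF subR] by auto
  let ?V = "\<Psi> ` ?L"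
  have V: "submodule ?V K3 M" using factor_map_image[OF lmF fm L] .
  have onec: "(1, 0, 0, 0) \<in> carrier (proj_x n)" using n by (simp add: kn3_def kn_def)
  then have "\<Psi> (1, 0, 0, 0) \<notin> ?V" "\<Psi> (1, 0, 0, 0) \<in> carrier M"
    using factor_map_image_mem_iff[OF lmF fm L RL onec] factor_map_closed[OF fm onec] by auto
  then have nc: "?V \<noteq> carrier M" by blast
  have max: "W = ?V \<or> W = carrier M" if W: "submodule W K3 M" "?V \<subseteq> W" for W
  proof -
    have LP: "q \<in> Pre W" if "q \<in> ?L" for q using that W(2) unfolding Pre_def by blast
    show ?thesis
    proof (cases "Pre W \<subseteq> ?L")
      case True
      then have "z \<in> ?V" if "z \<in> W" for z using that mem_iff_Pre[OF W(1)] by blast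
      then show ?thesis using W(2) by blast
    next
      case False
      then obtain q where "q \<in> Pre W" "q \<notin> ?L" by blast
      then obtain f r where fr: "(f, r) \<in> Pre W" "(f, r) \<notin> ?L" by (cases q) blast
      then have frk: "f \<in> kn n" "r \<in> kn3 n" "coeff f 0 \<noteq> 0" unfolding Pre_def by auto
      have "z \<in> W" if z: "z \<in> carrier M" for z
      proof -
        obtain g s where gs: "z = \<Psi> (g, s)" "g \<in> kn n" "s \<in> kn3 n"
          using factor_map_surj[OF fm z] by auto
        define d where "d = coeff g 0 / coeff f 0"
        have "tscale d r \<in> kn3 n" using frk by (cases r) (simp add: kn3_def)
        then have "s - tscale d r \<in> kn3 n" using gs(3) by (cases s; cases "tscale d r") (simp add: kn3_def)
        then have "(g - d *s f, s - tscale d r) \<in> ?L" using gs frk by (simp add: d_def)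
        then have "act (pathalg_elem d d 0 0 0) (f, r) + (g - d *s f, s - tscale d r) \<in> Pre W"
          using Pre_add[OF W(1) Pre_act[OF W(1) fr(1)] LP] by blast
        then show ?thesis unfolding act_scalar gs(1) mem_iff_Pre[OF W(1)] by auto
      qed
      then show ?thesis using W unfolding submodule_iff by blast
    qed
  qed
  let ?N = "M\<lparr>carrier := ?V\<rparr>"
  let ?sh = "\<lambda>(f, r). (pCons 0 f, shift3 r) :: 'k poly \<times> 'k triple"
  define \<Phi> where "\<Phi> q = \<Psi> (?sh q)" for q
  let ?S = "{r \<in> kn3 m. shift3 r \<in> R}"
  have shc: "?sh q \<in> ?L" if "q \<in> carrier (proj_x m)" for q
    using that n by (cases q) (simp add: kn3_def)
  have sh_add: "?sh (q + r) = ?sh q + ?sh r" for q r by (cases q; cases r) (simp add: shift3_add)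
  have sh_act: "?sh (act a q) = act a (?sh q)" for a q
    by (cases q) (auto simp: act_def shift3_def split: prod.split)
  have lmN: "left_module K3 ?N" using submodule_left_module[OF V] .
  have lmF': "left_module K3 (proj_x m :: (_, 'k poly \<times> 'k triple) module)"
    using left_module_proj_x R.ring_axioms by blast
  have "factor_map K3 (proj_x m) ?N \<Phi> ({0} \<times> ?S)"
    unfolding factor_map_def
  proof (intro conjI ballI)
    show "\<Phi> ` carrier (proj_x m) = carrier ?N"
    proof (intro equalityI subsetI)
      fix z assume "z \<in> \<Phi> ` carrier (proj_x m)"
      then show "z \<in> carrier ?N" using shc unfolding \<Phi>_def by auto
    next
      fix z assume "z \<in> carrier ?N"
      then obtain f r where fr: "z = \<Psi> (f, r)" "f \<in> kn n" "r \<in> kn3 n" "coeff f 0 = 0" by auto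
      \<comment> \<open>Only the class modulo \<open>R\<close> matters, so the sink component may be
        replaced by a multiple of \<open>x\<close>.\<close>
      obtain s where s: "s \<in> kn3 m" "r - shift3 s \<in> R" using gen[OF fr(3)] by blast
      obtain g where g: "f = pCons 0 g" using fr(4) by (cases f) auto
      have gk: "g \<in> kn m" using fr(2) g n by simp
      have c: "(f, r) \<in> carrier (proj_x n)" "(f, shift3 s) \<in> carrier (proj_x n)"
        using fr(2,3) s(1) n by simp_all
      have "(f, r) \<ominus>\<^bsub>proj_x n\<^esub> (f, shift3 s) = (0, r - shift3 s)"
        using proj_x_minus[OF lmF c] by simp
      then have "\<Psi> (f, r) = \<Psi> (f, shift3 s)" using factor_map_eq_iff[OF fm c] s(2) by simp
      then show "z \<in> \<Phi> ` carrier (proj_x m)" unfolding \<Phi>_def fr(1) g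
        using gk s(1) by (intro image_eqI[of _ _ "(g, s)"]) (simp_all add: g)
    qed
    show "\<Phi> \<zero>\<^bsub>proj_x m\<^esub> = \<zero>\<^bsub>?N\<^esub>" unfolding \<Phi>_def using factor_map_zero[OF fm] by (simp add: zero_prod_def)
  next
    fix q r :: "'k poly \<times> 'k triple" assume q: "q \<in> carrier (proj_x m)" and r: "r \<in> carrier (proj_x m)"
    have c: "?sh q \<in> carrier (proj_x n)" "?sh r \<in> carrier (proj_x n)" using shc q r by blast+
    show "\<Phi> (q \<oplus>\<^bsub>proj_x m\<^esub> r) = \<Phi> q \<oplus>\<^bsub>?N\<^esub> \<Phi> r"
      unfolding \<Phi>_def using factor_map_add[OF fm c] sh_add[of q r] by simp
    have "\<Phi> q = \<Phi> r \<longleftrightarrow> ?sh q - ?sh r \<in> {0} \<times> R"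
      unfolding \<Phi>_def using factor_map_eq_iff[OF fm c] proj_x_minus[OF lmF c] by simp
    also have "?sh q - ?sh r = ?sh (q - r)" using sh_add[of "q - r" r] by simp
    also have "?sh (q - r) \<in> {0} \<times> R \<longleftrightarrow> q - r \<in> {0} \<times> ?S"
    proof -
      have "snd (q - r) \<in> kn3 m" using q r by (cases q; cases r) (auto simp: kn3_def)
      then show ?thesis by (cases "q - r") simp
    qed
    also have "q - r = q \<ominus>\<^bsub>proj_x m\<^esub> r" using proj_x_minus[OF lmF' q r] by simp
    finally show "\<Phi> q = \<Phi> r \<longleftrightarrow> q \<ominus>\<^bsub>proj_x m\<^esub> r \<in> {0} \<times> ?S" .
  next
    fix a :: "kronecker_vertex \<times> nat list \<Rightarrow> 'k" and q :: "'k poly \<times> 'k triple" assume a: "a \<in> carrier K3" and q: "q \<in> carrier (proj_x m)"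
    have c: "?sh q \<in> carrier (proj_x n)" using shc q by blast
    show "\<Phi> (a \<odot>\<^bsub>proj_x m\<^esub> q) = a \<odot>\<^bsub>?N\<^esub> \<Phi> q"
      unfolding \<Phi>_def using factor_map_smult[OF fm a c] sh_act[of a q] by simp
  qed
  moreover have "subspace3 m ?S"
    unfolding subspace3_def
  proof (intro conjI ballI allI)
    fix r s assume "r \<in> ?S" "s \<in> ?S"
    then show "r + s \<in> ?S" using subspace3D(3)[OF subR] by (auto simp: shift3_add kn3_def)
  next
    fix c r assume "r \<in> ?S"
    then show "tscale c r \<in> ?S" using subspace3D(4)[OF subR, of "shift3 r" c]
      by (cases r) (auto simp: kn3_def)
  qed (use subspace3D(2)[OF subR] in \<open>auto simp: kn3_def zero_prod_def\<close>)
  ultimately have "presents ?N m ?S \<Phi>" unfolding presents_def using lmN by blast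
  then obtain l where l: "l > 0" "accessible_of_length K3 ?N l" using acc unfolding acc_def by blast
  show ?thesis unfolding acc_def
    using accessible_of_length_submodule[OF fd_module_if_presents[OF pres]
      indecomposable_module_if_rigid[OF pres _ rigid] V nc max l(2,1)] n by blast
qed

end

section \<open>Rigid systems of relations\<close>

lemma const_mem_kn [simp]: "n > 0 \<Longrightarrow> [:c:] \<in> kn n"
  by (auto simp: kn_def coeff_pCons split: nat.splits)

lemma one_mem_kn [simp]: "n > 0 \<Longrightarrow> 1 \<in> kn n"
  by (simp add: one_pCons)

section \<open>Linear maps, idempotents and rigidity\<close>

definition lin_on :: "nat \<Rightarrow> nat \<Rightarrow> ('k::field poly \<Rightarrow> 'k poly) \<Rightarrow> bool" where
  "lin_on n m L \<longleftrightarrow> (\<forall>f\<in>kn n. L f \<in> kn m \<and> (\<forall>c. L (c *s f) = c *s L f) \<and> (\<forall>g\<in>kn n. L (f + g) = L f + L g))"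

lemma idem_on_iff: "idem_on n E \<longleftrightarrow> lin_on n n E \<and> (\<forall>f\<in>kn n. E (E f) = E f)"
  unfolding idem_on_def lin_on_def by blast

lemma lin_onD:
  assumes "lin_on n m L" "f \<in> kn n"
  shows "L f \<in> kn m" "L (c *s f) = c *s L f" "g \<in> kn n \<Longrightarrow> L (f + g) = L f + L g" "L (- f) = - L f"
    "g \<in> kn n \<Longrightarrow> L (f - g) = L f - L g"
proof -
  show *: "L f \<in> kn m" "\<And>c. L (c *s f) = c *s L f" "\<And>g. g \<in> kn n \<Longrightarrow> L (f + g) = L f + L g"
    using assms unfolding lin_on_def by blast+
  show n: "L (- f) = - L f" using *(2)[of "-1"] by simp
  assume g: "g \<in> kn n"
  have "L (- g) = - L g" using assms(1) g unfolding lin_on_def by (metis smult_minus_left smult_1_left)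
  then show "L (f - g) = L f - L g" using *(3)[of "- g"] g by simp
qed

lemma lin_on_0: "lin_on n m L \<Longrightarrow> L 0 = 0"
  using lin_onD(2)[of n m L 0 0] by simp

lemma lin_on_eqI:
  assumes L: "lin_on n m L" "lin_on n m' L'" and "\<And>i. i < n \<Longrightarrow> L (monom 1 i) = L' (monom 1 i)" and f: "f \<in> kn n"
  shows "L f = L' f"
  using f
proof (induction rule: kn_induct)
  case zero
  then show ?case using lin_on_0 L by metis
next
  case (add f c i)
  then show ?case using lin_onD(2,3)[OF L(1)] lin_onD(2,3)[OF L(2)] assms(3) by (metis kn_closed(5,6))
qed

lemma lin_on_zero: "lin_on n m (\<lambda>_. 0)"
  by (simp add: lin_on_def)

lemma lin_on_id: "lin_on n n (\<lambda>f. f)"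
  by (simp add: lin_on_def)

lemma lin_on_subset: "\<lbrakk>lin_on n m L; n' \<le> n\<rbrakk> \<Longrightarrow> lin_on n' m L"
  unfolding lin_on_def using kn_mono by blast

lemma lin_on_smult: "lin_on n n (\<lambda>f. c *s f)"
  by (simp add: lin_on_def smult_add_right mult.commute)

lemma idem_on_complement: "idem_on n E \<Longrightarrow> idem_on n (\<lambda>f. f - E f)"
proof -
  assume E: "idem_on n E"
  note l = lin_onD[OF E[unfolded idem_on_iff, THEN conjunct1]]
  show ?thesis unfolding idem_on_def
    using E l by (simp add: smult_diff_right idem_on_def)
qed

definition preserves :: "('k::field poly \<Rightarrow> 'k poly) \<Rightarrow> 'k triple set \<Rightarrow> bool" where
  "preserves E R \<longleftrightarrow> (\<forall>u v w. (u, v, w) \<in> R \<longrightarrow> (E u, E v, E w) \<in> R)"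

lemma rigid_iff:
  "rigid n R \<longleftrightarrow> (\<forall>E. idem_on n E \<and> preserves E R \<longrightarrow> (\<forall>f\<in>kn n. E f = 0) \<or> (\<forall>f\<in>kn n. E f = f))"
  unfolding rigid_def preserves_def ..

lemma preserves_complement:
  "\<lbrakk>subspace3 n R; preserves E R\<rbrakk> \<Longrightarrow> preserves (\<lambda>f. f - E f) R"
  unfolding preserves_def using subspace3D(5) by fastforce

text \<open>Since \<open>E\<close> and \<open>1 - E\<close> play symmetric roles, one of them may be assumed to vanish on a subspace
  on which \<open>E\<close> is a scalar.\<close>

lemma rigidI:
  assumes R: "subspace3 n R" and "l \<le> n"
    and scalar: "\<And>E. \<lbrakk>idem_on n E; preserves E R\<rbrakk> \<Longrightarrow> (\<forall>f\<in>kn l. E f = 0) \<or> (\<forall>f\<in>kn l. E f = f)"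
    and zero: "\<And>E f. \<lbrakk>idem_on n E; preserves E R; \<And>f. f \<in> kn l \<Longrightarrow> E f = 0; f \<in> kn n\<rbrakk> \<Longrightarrow> E f = 0"
  shows "rigid n R"
  unfolding rigid_iff
proof (intro allI impI)
  fix E assume E: "idem_on n E \<and> preserves E R"
  then consider "\<And>f. f \<in> kn l \<Longrightarrow> E f = 0" | "\<And>f. f \<in> kn l \<Longrightarrow> E f = f" using scalar by blast
  then show "(\<forall>f\<in>kn n. E f = 0) \<or> (\<forall>f\<in>kn n. E f = f)"
  proof cases
    case 1
    then show ?thesis using zero E by blast
  next
    case 2
    then have "f - E f = 0" if "f \<in> kn n" for f
      using zero[OF idem_on_complement preserves_complement[OF R], of E f] E that by simp
    then show ?thesis by simp
  qed
qed

lemma idem_on_1_scalar: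
  assumes "idem_on n E" "E 1 = [:c:]" "n > 0" shows "c = 0 \<or> c = 1"
proof -
  have 1: "(1 :: 'a poly) \<in> kn n" using assms(3) by (simp add: kn_def)
  have "E [:c:] = c *s E 1" using assms(1) 1 unfolding idem_on_def by (metis smult_one)
  then have "E (E 1) = c *s E 1" using assms(2) by simp
  moreover have "E (E 1) = E 1" using assms(1) 1 unfolding idem_on_def by blast
  ultimately have "c = c * c" using assms(2) by simp
  then show ?thesis by simp
qed

lemma rigid_1: "rigid 1 R"
  unfolding rigid_iff
proof (intro allI impI)
  fix E assume E: "idem_on 1 E \<and> preserves E R"
  then have l: "lin_on 1 1 E" unfolding idem_on_iff by blast
  have "(1 :: 'a poly) \<in> kn 1" by (simp add: kn_def)
  then obtain c where c: "E 1 = [:c:]" using kn_1_cases lin_onD(1)[OF l] by blast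
  have "E f = c *s f" if "f \<in> kn 1" for f
    by (rule lin_on_eqI[OF l lin_on_smult _ that]) (simp add: c)
  then show "(\<forall>f\<in>kn 1. E f = 0) \<or> (\<forall>f\<in>kn 1. E f = f)"
    using idem_on_1_scalar[OF conjunct1[OF E] c] by auto
qed

text \<open>The relations \<open>(f, x f, 0)\<close> define a string module for the first two arrows; its endomorphisms are
  scalars.\<close>

definition string_rel :: "nat \<Rightarrow> 'k::field triple set \<Rightarrow> bool" where
  "string_rel t R \<longleftrightarrow> (\<forall>f g. (f, g, 0) \<in> R \<longleftrightarrow> f \<in> kn t \<and> g = pCons 0 f)"

lemma pCons_0_monom: "pCons 0 (monom c i) = monom c (Suc i)"
  by (simp add: monom_Suc)

text \<open>Here \<open>E\<close> commutes with multiplication by \<open>x\<close> on degrees below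
  \<open>t\<close>, so \<open>E x^i = x^i E 1\<close> for \<open>i \<le> t\<close>. Since
  \<open>E x^(t-1)\<close> again has degree less than \<open>t\<close>, \<open>E 1\<close> is a
  constant, and idempotence makes it 0 or 1. The conclusion reaches degree \<open>t\<close> because
  \<open>x^t\<close> is \<open>x\<close> times \<open>x^(t-1)\<close>.\<close>

lemma string_scalar:
  assumes E: "idem_on n E" "preserves E R" and R: "string_rel t R" and t: "t \<ge> 1" "Suc t \<le> n"
  shows "(\<forall>f\<in>kn (Suc t). E f = 0) \<or> (\<forall>f\<in>kn (Suc t). E f = f)"
proof -
  have l: "lin_on n n E" using E(1) unfolding idem_on_iff by blast
  have sh: "E f \<in> kn t \<and> E (pCons 0 f) = pCons 0 (E f)" if "f \<in> kn t" for f
  proof -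
    have "(f, pCons 0 f, 0) \<in> R" using R that unfolding string_rel_def by blast
    then have "(E f, E (pCons 0 f), 0) \<in> R" using E(2) lin_on_0[OF l] unfolding preserves_def by force
    then show ?thesis using R unfolding string_rel_def by blast
  qed
  have mon: "E (monom 1 i) = monom 1 i * E 1" if "i \<le> t" for i
    using that
  proof (induction i)
    case (Suc i)
    have "monom 1 i \<in> kn t" using Suc by simp
    then have "E (monom 1 (Suc i)) = pCons 0 (E (monom 1 i))" using conjunct2[OF sh[OF \<open>monom 1 i \<in> kn t\<close>]] by (simp add: monom_Suc)
    then show ?case using Suc by (simp add: monom_Suc)
  qed simp
  have "coeff (E 1) j = 0" if "j \<ge> 1" for j
  proof -
    have "monom 1 (t - 1) * E 1 \<in> kn t" using mon[of "t - 1"] sh[of "monom 1 (t - 1)"] t by simp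
    then have "coeff (monom 1 (t - 1) * E 1) (t - 1 + j) = 0" using that t unfolding kn_def by simp
    then show ?thesis by (simp add: coeff_monom_mult)
  qed
  then have c: "E 1 = [:coeff (E 1) 0:]" by (simp add: poly_eq_iff coeff_pCons split: nat.split)
  have ll: "lin_on (Suc t) n E" "lin_on (Suc t) (Suc t) (\<lambda>f. coeff (E 1) 0 *s f)"
    using lin_on_subset[OF l t(2)] lin_on_smult by auto
  have "E f = coeff (E 1) 0 *s f" if "f \<in> kn (Suc t)" for f
  proof (rule lin_on_eqI[OF ll _ that])
    fix i assume "i < Suc t"
    then have "E (monom 1 i) = monom 1 i * [:coeff (E 1) 0:]" using mon[of i] c by simp
    then show "E (monom 1 i) = coeff (E 1) 0 *s monom 1 i" by simp
  qed
  moreover have "coeff (E 1) 0 = 0 \<or> coeff (E 1) 0 = 1" using idem_on_1_scalar[OF E(1) c] t by linarith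
  ultimately show ?thesis by fastforce
qed

lemma rigid_string:
  assumes "string_rel t R"
  shows "rigid (Suc t) R"
proof (cases "t = 0")
  case False
  show ?thesis unfolding rigid_iff
  proof (intro allI impI)
    fix E assume "idem_on (Suc t) E \<and> preserves E R"
    then show "(\<forall>f\<in>kn (Suc t). E f = 0) \<or> (\<forall>f\<in>kn (Suc t). E f = f)"
      using False by (intro string_scalar[of "Suc t" E R, OF _ _ assms]) simp_all
  qed
next
  case True
  then show ?thesis using rigid_1 by (metis One_nat_def)
qed

section \<open>Adding one relation, and accessibility of string modules\<close>

definition add_span :: "'k::field triple \<Rightarrow> 'k triple set \<Rightarrow> 'k triple set" where
  "add_span r R = {s + tscale c r |s c. s \<in> R}"

lemma add_spanI: "s \<in> R \<Longrightarrow> s + tscale c r \<in> add_span r R"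
  unfolding add_span_def by blast

lemma tscale_add: "tscale c (r + s) = tscale c r + tscale c s"
  by (cases r; cases s) (simp add: smult_add_right)

lemma tscale_add_left: "tscale (c + d) r = tscale c r + tscale d r"
  by (cases r) (simp add: smult_add_left)

lemma tscale_tscale: "tscale c (tscale d r) = tscale (c * d) r"
  by (cases r) simp

lemma tscale_0: "tscale 0 r = 0"
  by (cases r) (simp add: zero_prod_def)

lemma tscale_minus_1: "tscale (- 1) r = - r"
  by (cases r) simp

lemma tscale_1: "tscale 1 r = r"
  by (cases r) simp

lemma kn3_closed: "0 \<in> kn3 n" "\<lbrakk>r \<in> kn3 n; s \<in> kn3 n\<rbrakk> \<Longrightarrow> r + s \<in> kn3 n" "r \<in> kn3 n \<Longrightarrow> tscale c r \<in> kn3 n"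
  by (auto simp: kn3_def zero_prod_def)

lemma subspace3_add_span:
  assumes R: "subspace3 n R" and r: "r \<in> kn3 n"
  shows "subspace3 n (add_span r R)"
  unfolding subspace3_def
proof (intro conjI ballI allI subsetI)
  fix s assume "s \<in> add_span r R"
  then obtain s' c where s: "s' \<in> R" "s = s' + tscale c r" unfolding add_span_def by blast
  then show "s \<in> kn3 n" using subspace3D(1)[OF R] kn3_closed r by blast
  { fix d
    have "tscale d s = tscale d s' + tscale (d * c) r" using s by (simp add: tscale_add tscale_tscale)
    then show "tscale d s \<in> add_span r R" using subspace3D(4)[OF R s(1)] unfolding add_span_def by blast }
  fix u assume "u \<in> add_span r R"
  then obtain u' d where u: "u' \<in> R" "u = u' + tscale d r" unfolding add_span_def by blast
  then have "s + u = (s' + u') + tscale (c + d) r" using s by (simp add: tscale_add_left)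
  then show "s + u \<in> add_span r R" using subspace3D(3)[OF R s(1) u(1)] unfolding add_span_def by blast
next
  show "0 \<in> add_span r R" using add_spanI[OF subspace3D(2)[OF R], of 0 r] by (simp add: tscale_0)
qed

lemma add_span_superset: "R \<subseteq> add_span r R"
  using add_spanI[of _ R 0 r] by (auto simp: tscale_0)

lemma add_span_mem: "subspace3 n R \<Longrightarrow> r \<in> add_span r R"
  using add_spanI[OF subspace3D(2), of n R 1 r] by (simp add: tscale_1)

lemma acc_add_span:
  fixes M :: "(kronecker_vertex \<times> nat list \<Rightarrow> 'k::field, 'm) module"
  assumes pres: "presents M n R \<Psi>" and "n > 0" "rigid n R" and r: "r \<in> kn3 n" "r \<notin> R"
    and acc: "\<And>(N :: (kronecker_vertex \<times> nat list \<Rightarrow> 'k, 'm) module) \<Phi>. presents N n (add_span r R) \<Phi> \<Longrightarrow> acc N"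
  shows "acc M"
proof (rule acc_factor[OF pres assms(2,3) subspace3_add_span[OF pres_R[OF pres] r(1)] add_span_superset
      add_span_mem[OF pres_R[OF pres]] r(2) _ acc])
  show "\<exists>c. s - tscale c r \<in> R" if s: "s \<in> add_span r R" for s
  proof -
    obtain s' c where "s' \<in> R" "s = s' + tscale c r" using s unfolding add_span_def by blast
    then show ?thesis by (intro exI[of _ c]) simp
  qed
qed assumption

text \<open>The first two arrows form a string with both ends at the sink; the last hypothesis makes
  the values of the third arrow combinations of values of the first two. Dividing out the end
  \<open>b 1\<close> and then dropping the generator 1 shortens the string by two. Nothing at the
  sink is lost by the second step, because \<open>a 1 = - b x\<close>.\<close>

lemma acc_string:
  fixes M :: "(kronecker_vertex \<times> nat list \<Rightarrow> 'k::field, 'm) module"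
  assumes "presents M (Suc m) R \<Psi>" "string_rel m R" "\<And>w. w \<in> kn (Suc m) \<Longrightarrow> \<exists>u v. (u, v, w) \<in> R"
  shows "acc M"
  using assms
proof (induction m arbitrary: M R \<Psi>)
  case 0
  note R = pres_R[OF "0.prems"(1)]
  have s: "(f, g, 0) \<in> R \<longleftrightarrow> f = 0 \<and> g = 0" for f g using 0(2) unfolding string_rel_def by auto
  show ?case
  \<comment> \<open>There is a single generator 1, with \<open>a 1\<close> and \<open>b 1\<close>
    independent. Dividing out both leaves the simple module at the source.\<close>
  proof (rule acc_add_span[OF 0(1) _ rigid_string[OF 0(2)], of "(0, 1, 0)"])
    fix N :: "(kronecker_vertex \<times> nat list \<Rightarrow> 'k, 'm) module" and \<Phi>
    assume N: "presents N (Suc 0) (add_span (0, 1, 0) R) \<Phi>"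
    show "acc N"
    proof (rule acc_add_span[OF N _ rigid_1[unfolded One_nat_def], of "(1, 0, 0)"])
      fix N' :: "(kronecker_vertex \<times> nat list \<Rightarrow> 'k, 'm) module" and \<Phi>'
      assume N': "presents N' (Suc 0) (add_span (1, 0, 0) (add_span (0, 1, 0) R)) \<Phi>'"
      let ?R = "add_span (1, 0, 0) (add_span (0, 1, 0) R)"
      have "(u, v, w) \<in> ?R" if k: "u \<in> kn (Suc 0)" "v \<in> kn (Suc 0)" "w \<in> kn (Suc 0)" for u v w
      proof -
        obtain u' v' where r: "(u', v', w) \<in> R" using 0(3) k by blast
        then have "u' \<in> kn (Suc 0)" "v' \<in> kn (Suc 0)" using subspace3D(1)[OF R] by (auto simp: kn3_def)
        then obtain a b where "u - u' = [:a:]" "v - v' = [:b:]"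
          using k kn_1_cases[of "u - u'"] kn_1_cases[of "v - v'"] by auto
        then have "(u, v, w) = ((u', v', w) + tscale b (0, 1, 0)) + tscale a (1, 0, 0)"
          by (simp add: algebra_simps)
        then show ?thesis unfolding add_span_def using r by blast
      qed
      then have "?R = kn3 1" using subspace3D(1)[OF pres_R[OF N']] by (auto simp: kn3_def)
      then show "acc N'" using acc_simple[OF N'] by simp
    next
      show "(1, 0, 0) \<notin> add_span (0, 1, 0) R"
      proof
        assume "(1, 0, 0) \<in> add_span (0, 1, 0) R"
        then obtain s c where "s \<in> R" "(1, 0, 0) = s + tscale c (0, 1, 0)" unfolding add_span_def by blast
        moreover then obtain b where "s = (1, b, 0)" "b + [:c:] = 0" by (cases s) simp
        ultimately show False using s by simp
      qed
    qed (simp_all add: kn3_def kn_def)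
  qed (simp_all add: s, simp_all add: kn3_def kn_def)
next
  case (Suc m)
  note R = pres_R[OF Suc.prems(1)]
  let ?n = "Suc (Suc m)" and ?r = "(0, 1, 0) :: 'k triple"
  let ?R1 = "add_span ?r R"
  have s: "(f, g, 0) \<in> R \<longleftrightarrow> f \<in> kn (Suc m) \<and> g = pCons 0 f" for f g using Suc.prems(2) unfolding string_rel_def by auto
  have R1: "subspace3 ?n ?R1" by (rule subspace3_add_span[OF R]) (simp add: kn3_def kn_def)
  have s1: "(f, g, 0) \<in> ?R1 \<longleftrightarrow> f \<in> kn (Suc m) \<and> (\<exists>c. g = pCons c f)" for f g
  proof
    assume "(f, g, 0) \<in> ?R1"
    then obtain q c where q: "q \<in> R" "(f, g, 0) = q + tscale c ?r" unfolding add_span_def by blast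
    then have "q = (f, g - [:c:], 0)" by (cases q) simp
    then have "f \<in> kn (Suc m)" "g - [:c:] = pCons 0 f" using s q(1) by auto
    then show "f \<in> kn (Suc m) \<and> (\<exists>c. g = pCons c f)"
      by (auto intro!: exI[of _ c] simp: algebra_simps)
  next
    assume "f \<in> kn (Suc m) \<and> (\<exists>c. g = pCons c f)"
    then obtain c where "(f, pCons 0 f, 0) \<in> R" "(f, g, 0) = (f, pCons 0 f, 0) + tscale c ?r" using s by auto
    then show "(f, g, 0) \<in> ?R1" unfolding add_span_def by blast
  qed
  \<comment> \<open>Constant terms \<open>u0\<close> and \<open>v0\<close> are removed by the
    relation \<open>(u0, v0 + u0 x, 0)\<close>, which holds once \<open>b 1 = 0\<close>.\<close>
  have adjust: "\<exists>u v. (pCons 0 u, pCons 0 v, w) \<in> ?R1" if w: "w \<in> kn ?n" for w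
  proof -
    obtain u v where uv: "(u, v, w) \<in> R" using Suc.prems(3) w by blast
    obtain u0 u' where u: "u = pCons u0 u'" by (cases u)
    obtain v0 v' where v: "v - pCons 0 [:u0:] = pCons v0 v'" by (cases "v - pCons 0 [:u0:]")
    have "([:u0:], pCons v0 [:u0:], 0) \<in> ?R1" using s1[of "[:u0:]" "pCons v0 [:u0:]"] by auto
    moreover have "(u, v, w) \<in> ?R1" using uv add_span_superset by blast
    ultimately have "(u, v, w) - ([:u0:], pCons v0 [:u0:], 0) \<in> ?R1" using subspace3D(5)[OF R1] by blast
    moreover have "v - pCons v0 [:u0:] = pCons 0 v'"
    proof -
      have "pCons v0 [:u0:] = pCons 0 [:u0:] + [:v0:]" by simp
      then have "v - pCons v0 [:u0:] = (v - pCons 0 [:u0:]) - [:v0:]" by (simp only: diff_diff_eq)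
      then show ?thesis unfolding v by simp
    qed
    ultimately show ?thesis unfolding u by auto
  qed
  show ?case
  proof (rule acc_add_span[OF Suc.prems(1) _ rigid_string[OF Suc.prems(2)], of ?r])
    fix N :: "(kronecker_vertex \<times> nat list \<Rightarrow> 'k, 'm) module" and \<Phi>
    assume N: "presents N ?n ?R1 \<Phi>"
    \<comment> \<open>The relations \<open>(0, g, 0)\<close> are those with constant
      \<open>g\<close>, so \<open>E 1\<close> is constant; this starts the argument with the scalar
      subspace of degree 0.\<close>
    have "rigid ?n ?R1"
    proof (rule rigidI[OF R1, of 1])
      fix E :: "'k poly \<Rightarrow> 'k poly" assume E: "idem_on ?n E" "preserves E ?R1"
      have l: "lin_on ?n ?n E" using E(1) unfolding idem_on_iff by blast
      have e0: "(0, g, 0) \<in> ?R1 \<longleftrightarrow> (\<exists>c. g = [:c:])" for g using s1[of 0 g] by auto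
      have "(0, 1, 0) \<in> ?R1" using e0 by (metis one_pCons)
      then have "(0, E 1, 0) \<in> ?R1" using E(2) lin_on_0[OF l] unfolding preserves_def by force
      then obtain c where c: "E 1 = [:c:]" using e0 by blast
      have "E f = c *s f" if "f \<in> kn 1" for f
        by (rule lin_on_eqI[OF lin_on_subset[OF l] lin_on_smult _ that]) (simp_all add: c)
      then show "(\<forall>f\<in>kn 1. E f = 0) \<or> (\<forall>f\<in>kn 1. E f = f)" using idem_on_1_scalar[OF E(1) c] by auto
    next
      fix E :: "'k poly \<Rightarrow> 'k poly" and f :: "'k poly" assume E: "idem_on ?n E" "preserves E ?R1" and z: "\<And>f. f \<in> kn 1 \<Longrightarrow> E f = 0"
        and f: "f \<in> kn ?n"
      have l: "lin_on ?n ?n E" using E(1) unfolding idem_on_iff by blast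
      \<comment> \<open>If \<open>E\<close> kills \<open>x^i\<close>, then
        \<open>(0, E x^(i+1), 0)\<close> is a relation, so \<open>E x^(i+1)\<close> is a constant.
        Constants are killed by \<open>E\<close>, whereas values of \<open>E\<close> are fixed by
        it.\<close>
      have "E (monom 1 i) = 0" if "i < ?n" for i
        using that
      proof (induction i)
        case (Suc i)
        have "(monom 1 i, monom 1 (Suc i), 0) \<in> ?R1" using s1[of "monom 1 i" "monom 1 (Suc i)"] Suc.prems by (auto simp: monom_Suc)
        then have "(0, E (monom 1 (Suc i)), 0) \<in> ?R1"
          using E(2) lin_on_0[OF l] Suc unfolding preserves_def by (metis Suc_lessD)
        then obtain c where c: "E (monom 1 (Suc i)) = [:c:]" using s1[of 0 "E (monom 1 (Suc i))"] by auto
        moreover have "E [:c:] = 0" using z by simp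
        moreover have "E (E (monom 1 (Suc i))) = E (monom 1 (Suc i))"
          using E(1) Suc.prems unfolding idem_on_iff by (meson kn_closed(6))
        ultimately show ?case by simp
      qed (use z in simp)
      then show "E f = 0" by (intro lin_on_eqI[OF l lin_on_zero _ f])
    qed simp
    then show "acc N"
    proof (rule acc_submodule[OF N refl])
      fix r :: "'k triple" assume r: "r \<in> kn3 ?n"
      obtain u v w where uvw: "r = (u, v, w)" by (cases r)
      obtain w0 w' where w: "w = pCons w0 w'" by (cases w)
      have "[:w0:] \<in> kn ?n" by simp
      then obtain p q where pq: "(pCons 0 p, pCons 0 q, [:w0:]) \<in> ?R1" using adjust by blast
      obtain u0 u' where u: "u = pCons u0 u'" by (cases u)
      obtain v0 v' where v: "v - pCons 0 [:u0:] = pCons v0 v'" by (cases "v - pCons 0 [:u0:]")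
      have v2: "v - pCons v0 [:u0:] = pCons 0 v'"
      proof -
        have "pCons v0 [:u0:] = pCons 0 [:u0:] + [:v0:]" by simp
        then have "v - pCons v0 [:u0:] = (v - pCons 0 [:u0:]) - [:v0:]" by (simp only: diff_diff_eq)
        then show ?thesis unfolding v by simp
      qed
      have "([:u0:], pCons v0 [:u0:], 0) \<in> ?R1" using s1[of "[:u0:]" "pCons v0 [:u0:]"] by auto
      then have R: "([:u0:], pCons v0 [:u0:], 0) + (pCons 0 p, pCons 0 q, [:w0:]) \<in> ?R1" using subspace3D(3)[OF R1] pq by blast
      let ?s = "(u' - p, v' - q, w')"
      have "r - shift3 ?s = ([:u0:], pCons v0 [:u0:], 0) + (pCons 0 p, pCons 0 q, [:w0:])"
      proof -
        have "v - pCons 0 (v' - q) = pCons v0 [:u0:] + pCons 0 q"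
        proof -
          have "pCons 0 (v' - q) = pCons 0 v' - pCons 0 q" by simp
          then show ?thesis using v2 by (simp add: algebra_simps)
        qed
        then show ?thesis unfolding uvw u w by simp
      qed
      moreover have "shift3 ?s \<in> kn3 ?n"
      proof -
        have "r - (([:u0:], pCons v0 [:u0:], 0) + (pCons 0 p, pCons 0 q, [:w0:])) \<in> kn3 ?n"
          using r R subspace3D(1)[OF R1] kn3_closed(2)[OF r kn3_closed(3), of _ "-1"]
          by (metis (no_types, lifting) subsetD diff_conv_add_uminus tscale_minus_1)
        then show ?thesis using calculation by (simp add: algebra_simps)
      qed
      ultimately show "\<exists>s\<in>kn3 (Suc m). r - shift3 s \<in> ?R1" using R by (metis shift3_mem_kn3)
    next
      fix N' :: "(kronecker_vertex \<times> nat list \<Rightarrow> 'k, 'm) module" and \<Phi>'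
      assume N': "presents N' (Suc m) {r \<in> kn3 (Suc m). shift3 r \<in> ?R1} \<Phi>'"
      show "acc N'"
      proof (rule Suc.IH[OF N'])
        show "string_rel m {r \<in> kn3 (Suc m). shift3 r \<in> ?R1}"
          unfolding string_rel_def
        proof (intro allI)
          fix f g
          \<comment> \<open>The degree bound drops by one because it is \<open>x f\<close> that must
            have degree at most \<open>m\<close>. The constant \<open>c\<close> in
            \<open>x g = c + x (x f)\<close> has to be 0.\<close>
          have "(f, g, 0) \<in> {r \<in> kn3 (Suc m). shift3 r \<in> ?R1} \<longleftrightarrow> f \<in> kn (Suc m) \<and> g \<in> kn (Suc m) \<and> f \<in> kn m \<and> g = pCons 0 f"
            using s1[of "pCons 0 f" "pCons 0 g"] by (auto simp: kn3_def)
          also have "\<dots> \<longleftrightarrow> f \<in> kn m \<and> g = pCons 0 f" using kn_mono[of f m "Suc m"] by auto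
          finally show "(f, g, 0) \<in> {r \<in> kn3 (Suc m). shift3 r \<in> ?R1} \<longleftrightarrow> f \<in> kn m \<and> g = pCons 0 f" .
        qed
      next
        fix w :: "'k poly" assume w: "w \<in> kn (Suc m)"
        then obtain u v where uv: "(pCons 0 u, pCons 0 v, pCons 0 w) \<in> ?R1" using adjust[of "pCons 0 w"] by auto
        then have "(pCons 0 u, pCons 0 v, pCons 0 w) \<in> kn3 ?n" using subspace3D(1)[OF R1] by blast
        then show "\<exists>u v. (u, v, w) \<in> {r \<in> kn3 (Suc m). shift3 r \<in> ?R1}" using uv by (auto simp: kn3_def)
      qed
    qed
  next
    show "?r \<notin> R" using s[of 0 1] by simp
  qed (simp_all add: kn3_def kn_def)
qed

section \<open>Chains of factor modules\<close>

definition kn_supp :: "nat set \<Rightarrow> 'k::field poly set" where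
  "kn_supp S = {f. \<forall>i. coeff f i \<noteq> 0 \<longrightarrow> i \<in> S}"

lemma kn_supp_closed:
  "0 \<in> kn_supp S" "\<lbrakk>f \<in> kn_supp S; g \<in> kn_supp S\<rbrakk> \<Longrightarrow> f + g \<in> kn_supp S"
  "\<lbrakk>f \<in> kn_supp S; g \<in> kn_supp S\<rbrakk> \<Longrightarrow> f - g \<in> kn_supp S" "f \<in> kn_supp S \<Longrightarrow> c *s f \<in> kn_supp S"
  by (auto simp: kn_supp_def) (metis add_0 diff_0_right)+

lemma kn_supp_mono: "S \<subseteq> T \<Longrightarrow> kn_supp S \<subseteq> kn_supp T"
  by (auto simp: kn_supp_def)

lemma kn_supp_empty [simp]: "kn_supp {} = {0}"
  by (auto simp: kn_supp_def poly_eq_iff)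

lemma monom_mem_kn_supp: "monom c i \<in> kn_supp S \<longleftrightarrow> c = 0 \<or> i \<in> S"
  by (auto simp: kn_supp_def)

lemma kn_supp_subset_kn: "S \<subseteq> {..<n} \<Longrightarrow> f \<in> kn_supp S \<Longrightarrow> f \<in> kn n"
  by (force simp: kn_supp_def kn_def)

text \<open>Multiplication by the three arrows from the component \<open>k\<^sup>d\<close> to the component \<open>k\<^sup>n\<close>.\<close>

locale arrows =
  fixes d n :: nat and a b c :: "'k::field poly \<Rightarrow> 'k poly"
  assumes a: "lin_on d n a" and b: "lin_on d n b" and c: "lin_on d n c"
    and c_inj: "\<And>v. \<lbrakk>v \<in> kn d; c v = 0\<rbrakk> \<Longrightarrow> v = 0"
begin

text \<open>The stages of the chain: the relations coming from the arrows, the string relations up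
  to degree \<open>t - 1\<close>, and the relations that kill the third arrow on the monomials with
  exponents in \<open>S\<close>.\<close>

definition rel :: "nat \<Rightarrow> nat set \<Rightarrow> 'k triple set" where
  "rel t S = {(a v + f, b v + pCons 0 f, c v + q) |v f q. v \<in> kn d \<and> f \<in> kn t \<and> q \<in> kn_supp S}"

lemma relI: "\<lbrakk>v \<in> kn d; f \<in> kn t; q \<in> kn_supp S\<rbrakk> \<Longrightarrow> (a v + f, b v + pCons 0 f, c v + q) \<in> rel t S"
  unfolding rel_def by blast

lemma relE:
  assumes "(x, y, z) \<in> rel t S"
  obtains v f q where "v \<in> kn d" "f \<in> kn t" "q \<in> kn_supp S" "x = a v + f" "y = b v + pCons 0 f" "z = c v + q"
  using assms unfolding rel_def by blast

lemma subspace3_rel: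
  assumes t: "t < n" and S: "S \<subseteq> {..<n}"
  shows "subspace3 n (rel t S)"
  unfolding subspace3_def
proof (intro conjI ballI allI subsetI)
  fix r assume "r \<in> rel t S"
  then obtain v f q where r: "v \<in> kn d" "f \<in> kn t" "q \<in> kn_supp S" "r = (a v + f, b v + pCons 0 f, c v + q)"
    unfolding rel_def by blast
  have "pCons 0 f \<in> kn n" "f \<in> kn n" using r(2) t kn_mono[of "pCons 0 f" "Suc t" n] kn_mono[of f t n] by simp_all
  then show "r \<in> kn3 n" using lin_onD(1)[OF a] lin_onD(1)[OF b] lin_onD(1)[OF c] r
    by (simp add: kn3_def kn_supp_subset_kn[OF S])
  { fix e
    have "tscale e r = (a (e *s v) + e *s f, b (e *s v) + pCons 0 (e *s f), c (e *s v) + e *s q)"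
      using r lin_onD(2)[OF a r(1)] lin_onD(2)[OF b r(1)] lin_onD(2)[OF c r(1)] by (simp add: smult_add_right)
    then show "tscale e r \<in> rel t S" using relI[of "e *s v" "e *s f" t "e *s q" S] r by (simp add: kn_supp_closed) }
  fix s assume "s \<in> rel t S"
  then obtain v' f' q' where s: "v' \<in> kn d" "f' \<in> kn t" "q' \<in> kn_supp S" "s = (a v' + f', b v' + pCons 0 f', c v' + q')"
    unfolding rel_def by blast
  have e: "r + s = (a (v + v') + (f + f'), b (v + v') + pCons 0 (f + f'), c (v + v') + (q + q'))"
    using r s lin_onD(3)[OF a r(1) s(1)] lin_onD(3)[OF b r(1) s(1)] lin_onD(3)[OF c r(1) s(1)] by (simp add: algebra_simps)
  show "r + s \<in> rel t S" unfolding e by (rule relI) (use r s in \<open>simp_all add: kn_supp_closed\<close>)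
next
  show "0 \<in> rel t S" using relI[of 0 0 t 0 S] lin_on_0[OF a] lin_on_0[OF b] lin_on_0[OF c]
    by (simp add: zero_prod_def kn_supp_closed)
qed

text \<open>If the third component \<open>c v + q\<close> is 0, then \<open>c v\<close> is supported
  in \<open>S\<close>. So the string structure survives as long as the span of these monomials meets
  the image of \<open>c\<close> trivially.\<close>

lemma string_rel_rel:
  assumes "\<And>v. \<lbrakk>v \<in> kn d; c v \<in> kn_supp S\<rbrakk> \<Longrightarrow> v = 0"
  shows "string_rel t (rel t S)"
  unfolding string_rel_def
proof (intro allI iffI)
  fix f g :: "'k poly" assume "(f, g, 0) \<in> rel t S"
  then obtain v h q where r: "v \<in> kn d" "h \<in> kn t" "q \<in> kn_supp S" "f = a v + h" "g = b v + pCons 0 h" "0 = c v + q"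
    by (rule relE)
  have "c v = 0 - q" using r(6) by (simp add: eq_neg_iff_add_eq_0)
  then have "c v \<in> kn_supp S" using kn_supp_closed(3)[OF kn_supp_closed(1) r(3)] by simp
  then have "v = 0" using assms r(1) by blast
  then show "f \<in> kn t \<and> g = pCons 0 f" using r lin_on_0[OF a] lin_on_0[OF b] by simp
next
  fix f g :: "'k poly" assume "f \<in> kn t \<and> g = pCons 0 f"
  then show "(f, g, 0) \<in> rel t S" using relI[of 0 f t 0 S] lin_on_0[OF a] lin_on_0[OF b] lin_on_0[OF c] by (simp add: kn_supp_closed)
qed

lemma string_rel_rel_empty: "string_rel t (rel t {})"
  by (rule string_rel_rel) (simp add: c_inj)

lemma rel_Suc: "rel (Suc t) {} \<subseteq> add_span (monom 1 t, monom 1 (Suc t), 0) (rel t {})"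
proof
  fix r assume "r \<in> rel (Suc t) {}"
  then obtain v f where r: "v \<in> kn d" "f \<in> kn (Suc t)" "r = (a v + f, b v + pCons 0 f, c v)"
    unfolding rel_def by auto
  let ?e = "coeff f t" and ?g = "f - monom (coeff f t) t"
  have g: "?g \<in> kn t" using r(2) unfolding kn_def by (auto simp: not_less_eq_eq le_Suc_eq)
  have e: "r = (a v + ?g, b v + pCons 0 ?g, c v + 0) + tscale ?e (monom 1 t, monom 1 (Suc t), 0)"
    unfolding r(3) by (simp add: smult_monom monom_Suc)
  show "r \<in> add_span (monom 1 t, monom 1 (Suc t), 0) (rel t {})"
    unfolding e by (intro add_spanI relI[OF r(1) g]) simp
qed

lemma rel_Suc_eq: "t < n \<Longrightarrow> Suc t < n \<Longrightarrow> add_span (monom 1 t, monom 1 (Suc t), 0) (rel t {}) = rel (Suc t) {}"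
proof (intro equalityI subsetI)
  fix r assume t: "t < n" "Suc t < n" and "r \<in> add_span (monom 1 t, monom 1 (Suc t), 0) (rel t {})"
  then obtain s e where s: "s \<in> rel t {}" "r = s + tscale e (monom 1 t, monom 1 (Suc t), 0)" unfolding add_span_def by blast
  have "s \<in> rel (Suc t) {}" using s(1) kn_mono[of _ t "Suc t"] unfolding rel_def by fastforce
  moreover have "(monom 1 t, monom 1 (Suc t), 0) \<in> rel (Suc t) {}"
    using string_rel_rel_empty[of "Suc t"] unfolding string_rel_def by (simp add: monom_Suc)
  ultimately show "r \<in> rel (Suc t) {}"
    unfolding s(2) using subspace3D(3,4)[OF subspace3_rel[OF t(2), of "{}"]] by blast
qed (use rel_Suc in blast)

lemma rel_insert_eq:
  assumes t: "t < n" and S: "S \<subseteq> {..<n}" "i < n" "i \<notin> S"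
  shows "add_span (0, 0, monom 1 i) (rel t S) = rel t (insert i S)"
proof (intro equalityI subsetI)
  fix r assume "r \<in> add_span (0, 0, monom 1 i) (rel t S)"
  then obtain s e where s: "s \<in> rel t S" "r = s + tscale e (0, 0, monom 1 i)" unfolding add_span_def by blast
  have "s \<in> rel t (insert i S)" using s(1) kn_supp_mono[of S "insert i S"] unfolding rel_def by fastforce
  moreover have "(0, 0, monom 1 i) \<in> rel t (insert i S)"
    using relI[of 0 0 t "monom 1 i" "insert i S"] lin_on_0[OF a] lin_on_0[OF b] lin_on_0[OF c]
    by (simp add: monom_mem_kn_supp)
  moreover have "subspace3 n (rel t (insert i S))" using subspace3_rel t S by simp
  ultimately show "r \<in> rel t (insert i S)" unfolding s(2) using subspace3D(3,4) by blast
next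
  fix r assume "r \<in> rel t (insert i S)"
  then obtain v f q where r: "v \<in> kn d" "f \<in> kn t" "q \<in> kn_supp (insert i S)" "r = (a v + f, b v + pCons 0 f, c v + q)"
    unfolding rel_def by blast
  let ?p = "q - monom (coeff q i) i"
  have p: "?p \<in> kn_supp S" using r(3) unfolding kn_supp_def by auto
  have e: "r = (a v + f, b v + pCons 0 f, c v + ?p) + tscale (coeff q i) (0, 0, monom 1 i)"
    unfolding r(4) by (simp add: smult_monom)
  show "r \<in> add_span (0, 0, monom 1 i) (rel t S)"
    unfolding e by (intro add_spanI relI[OF r(1,2) p])
qed

text \<open>The monomials in \<open>P\<close> span a complement of the image of \<open>c\<close>.
  Therefore, once all string relations are present, killing these monomials one by one keeps the
  string structure and thus rigidity, and in the end every \<open>w\<close> is the third component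
  of a relation, as \<open>acc_string\<close> requires. Only the stages \<open>t < m\<close> need
  rigidity as input.\<close>

lemma acc_if_rigid:
  fixes M :: "(kronecker_vertex \<times> nat list \<Rightarrow> 'k, 'm) module"
  assumes n: "n = Suc m" and P: "P \<subseteq> {..<n}"
    and compl: "\<And>v. \<lbrakk>v \<in> kn d; c v \<in> kn_supp P\<rbrakk> \<Longrightarrow> v = 0"
      "\<And>w. w \<in> kn n \<Longrightarrow> \<exists>v\<in>kn d. w - c v \<in> kn_supp P"
    and rigid: "\<And>t. t < m \<Longrightarrow> rigid n (rel t {})"
    and M: "presents M n (rel 0 {}) \<Psi>"
  shows "acc M"
proof -
  have supp: "v = 0" if "v \<in> kn d" "c v \<in> kn_supp S" "S \<subseteq> P" for v S
    using compl(1) that kn_supp_mono[OF that(3)] by blast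
  have A: "acc N" if "S \<subseteq> P" "presents N n (rel m S) \<Phi>" for S and N :: "(kronecker_vertex \<times> nat list \<Rightarrow> 'k, 'm) module" and \<Phi>
    using that
  proof (induction "card (P - S)" arbitrary: S N \<Phi>)
    case 0
    have "finite P" using P finite_subset by blast
    then have "S = P" using 0 by auto
    then have s: "string_rel m (rel m S)" using string_rel_rel[of S m] supp[of _ S] by blast
    show ?case
    proof (rule acc_string[OF _ s])
      show "presents N (Suc m) (rel m S) \<Phi>" using 0 n by simp
      fix w :: "'k poly" assume "w \<in> kn (Suc m)"
      then obtain v where v: "v \<in> kn d" "w - c v \<in> kn_supp P" using compl(2) n by blast
      show "\<exists>u v. (u, v, w) \<in> rel m S" using relI[OF v(1) kn_closed(1) v(2), of m] \<open>S = P\<close> by auto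
    qed
  next
    case (Suc k)
    then obtain i where i: "i \<in> P" "i \<notin> S" by (metis Diff_eq_empty_iff card.empty nat.distinct(1) subsetI)
    have s: "string_rel m (rel m S)" using string_rel_rel[of S m] supp[OF _ _ Suc.prems(1)] by blast
    show ?case
    proof (rule acc_add_span[OF Suc.prems(2), of "(0, 0, monom 1 i)"])
      show "rigid n (rel m S)" using rigid_string[OF s] n by simp
      show "(0, 0, monom 1 i) \<in> kn3 n" using i P by (auto simp: kn3_def)
      show "(0, 0, monom 1 i) \<notin> rel m S"
      proof
        assume "(0, 0, monom 1 i) \<in> rel m S"
        then obtain v f q where r: "v \<in> kn d" "q \<in> kn_supp S" "monom 1 i = c v + q" by (rule relE)
        have q: "q \<in> kn_supp P" using r(2) kn_supp_mono[OF Suc.prems(1)] by blast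
        have "c v = monom 1 i - q" using r(3) by simp
        then have "c v \<in> kn_supp P" using kn_supp_closed(3)[OF _ q] i by (simp add: monom_mem_kn_supp)
        then have "v = 0" using compl(1) r(1) by blast
        then have "q = monom 1 i" using r(3) lin_on_0[OF c] by simp
        then have "monom (1::'k) i \<in> kn_supp S" using r(2) by blast
        then show False using i by (simp add: monom_mem_kn_supp)
      qed
      fix N' :: "(kronecker_vertex \<times> nat list \<Rightarrow> 'k, 'm) module" and \<Phi>'
      assume "presents N' n (add_span (0, 0, monom 1 i) (rel m S)) \<Phi>'"
      then have N': "presents N' n (rel m (insert i S)) \<Phi>'"
        using rel_insert_eq[of m S i] n order_trans[OF Suc.prems(1) P] i P by auto
      have "finite P" using P finite_subset by blast
      moreover have "P - insert i S = (P - S) - {i}" by blast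
      ultimately have "k = card (P - insert i S)" using Suc(2) i by simp
      then show "acc N'" using Suc(1)[OF _ _ N'] Suc.prems(1) i by simp
    qed (use n in simp)
  qed
  have B: "acc N" if "t \<le> m" "presents N n (rel t {}) \<Phi>" for t and N :: "(kronecker_vertex \<times> nat list \<Rightarrow> 'k, 'm) module" and \<Phi>
    using that
  proof (induction "m - t" arbitrary: t N \<Phi>)
    case 0
    then show ?case using A[of "{}" N \<Phi>] by simp
  next
    case (Suc k)
    then have t: "t < m" by simp
    show ?case
    proof (rule acc_add_span[OF Suc.prems(2) _ rigid[OF t], of "(monom 1 t, monom 1 (Suc t), 0)"])
      show "(monom 1 t, monom 1 (Suc t), 0) \<notin> rel t {}"
        using string_rel_rel_empty[of t] unfolding string_rel_def by (simp add: kn_def)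
      fix N' :: "(kronecker_vertex \<times> nat list \<Rightarrow> 'k, 'm) module" and \<Phi>'
      assume "presents N' n (add_span (monom 1 t, monom 1 (Suc t), 0) (rel t {})) \<Phi>'"
      then have N': "presents N' n (rel (Suc t) {}) \<Phi>'"
        using rel_Suc_eq[of t] n t by simp
      show "acc N'" using Suc(1)[OF _ _ N'] Suc(2) t by simp
    qed (use n t in \<open>simp_all add: kn3_def\<close>)
  qed
  show ?thesis using B[OF _ M] by simp
qed

end


section \<open>Descent of idempotents to the previous level\<close>

locale exact_arrows = arrows d n a b c
  for d n :: nat and a b c :: "'k::field poly \<Rightarrow> 'k poly" +
  assumes gen: "\<And>w. w \<in> kn n \<Longrightarrow> \<exists>u\<in>kn d. \<exists>v\<in>kn d. \<exists>z\<in>kn d. w = a u + b v + c z"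
begin

text \<open>An idempotent endomorphism \<open>E\<close> of \<open>k\<^sup>n\<close> that respects the relations induces an idempotent endomorphism \<open>D\<close> of \<open>k\<^sup>d\<close>.\<close>

definition descends :: "nat \<Rightarrow> ('k poly \<Rightarrow> 'k poly) \<Rightarrow> ('k poly \<Rightarrow> 'k poly) \<Rightarrow> bool" where
  "descends t E D \<longleftrightarrow> idem_on n E \<and> idem_on d D \<and> (\<forall>v\<in>kn d. E (c v) = c (D v) \<and>
    (\<exists>f\<in>kn t. E (a v) = a (D v) + f \<and> E (b v) = b (D v) + pCons 0 f))"

text \<open>The image of the relation \<open>(a v, b v, c v)\<close> under \<open>E\<close> is again
  a relation, whose third component is \<open>c u\<close> for some \<open>u\<close>. Since
  \<open>c\<close> is injective, \<open>D v = u\<close> is unique, so linearity and idempotence pass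
  from \<open>E\<close> to \<open>D\<close>.\<close>

lemma ex_descends:
  assumes E: "idem_on n E" "preserves E (rel t {})"
  shows "\<exists>D. descends t E D"
proof -
  have l: "lin_on n n E" using E(1) unfolding idem_on_iff by blast
  have "\<exists>u\<in>kn d. E (c v) = c u \<and> (\<exists>f\<in>kn t. E (a v) = a u + f \<and> E (b v) = b u + pCons 0 f)" if "v \<in> kn d" for v
  proof -
    have "(a v, b v, c v) \<in> rel t {}" using relI[OF that kn_closed(1), of 0 "{}"] by simp
    then have "(E (a v), E (b v), E (c v)) \<in> rel t {}" using E(2) unfolding preserves_def by blast
    then show ?thesis by (rule relE) auto
  qed
  then obtain D where D: "\<And>v. v \<in> kn d \<Longrightarrow> D v \<in> kn d \<and> E (c v) = c (D v) \<and>
      (\<exists>f\<in>kn t. E (a v) = a (D v) + f \<and> E (b v) = b (D v) + pCons 0 f)" by metis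
  have cD: "c v \<in> kn n" if "v \<in> kn d" for v using lin_onD(1)[OF c that] .
  have uniq: "D v = u" if "v \<in> kn d" "u \<in> kn d" "E (c v) = c u" for u v
  proof -
    have "c (D v - u) = 0" using lin_onD(5)[OF c] D[OF that(1)] that by simp
    then show ?thesis using c_inj[of "D v - u"] D[OF that(1)] that by simp
  qed
  have "idem_on d D" unfolding idem_on_def
  proof (intro ballI conjI allI)
    fix f :: "'k poly" assume f: "f \<in> kn d"
    show "D f \<in> kn d" using D f by blast
    have "E (E (c f)) = E (c f)" using E(1) cD[OF f] unfolding idem_on_def by blast
    then show "D (D f) = D f" using uniq[of "D f" "D f"] D[OF f] by simp
    fix e
    have "E (c (e *s f)) = c (e *s D f)" using lin_onD(2)[OF c] lin_onD(2)[OF l cD[OF f]] D[OF f] f by simp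
    then show "D (e *s f) = e *s D f" using uniq D[OF f] f by simp
  next
    fix f g :: "'k poly" assume fg: "f \<in> kn d" "g \<in> kn d"
    have "E (c (f + g)) = c (D f + D g)"
    proof -
      have "E (c (f + g)) = E (c f) + E (c g)"
        using lin_onD(3)[OF c fg] lin_onD(3)[OF l cD[OF fg(1)] cD[OF fg(2)]] by simp
      also have "\<dots> = c (D f + D g)" using lin_onD(3)[OF c, of "D f" "D g"] D[OF fg(1)] D[OF fg(2)] by simp
      finally show ?thesis .
    qed
    moreover have "D f + D g \<in> kn d" using D fg by blast
    ultimately show "D (f + g) = D f + D g" using uniq[of "f + g" "D f + D g"] fg by blast
  qed
  then show ?thesis unfolding descends_def using D E(1) by blast
qed

context
  fixes t :: nat and E D :: "'k poly \<Rightarrow> 'k poly"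
  assumes desc: "descends t E D"
begin

lemma desc_idem: "idem_on n E" "idem_on d D" and desc_lin: "lin_on n n E" "lin_on d d D"
  using desc unfolding descends_def idem_on_iff by blast+

lemma desc_c: "v \<in> kn d \<Longrightarrow> E (c v) = c (D v)"
  using desc unfolding descends_def by blast

lemma desc_ab: "v \<in> kn d \<Longrightarrow> \<exists>f\<in>kn t. E (a v) = a (D v) + f \<and> E (b v) = b (D v) + pCons 0 f"
  using desc unfolding descends_def by blast

lemma desc_sum:
  assumes v: "u \<in> kn d" "v \<in> kn d" "z \<in> kn d"
  shows "\<exists>f\<in>kn t. \<exists>g\<in>kn t. E (a u + b v + c z) = a (D u) + b (D v) + c (D z) + (f + pCons 0 g)"
proof -
  obtain f where f: "f \<in> kn t" "E (a u) = a (D u) + f" using desc_ab[OF v(1)] by blast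
  obtain g where g: "g \<in> kn t" "E (b v) = b (D v) + pCons 0 g" using desc_ab[OF v(2)] by blast
  have k: "a u \<in> kn n" "b v \<in> kn n" "c z \<in> kn n" using lin_onD(1)[OF a] lin_onD(1)[OF b] lin_onD(1)[OF c] v by blast+
  have "E (a u + b v + c z) = E (a u) + E (b v) + E (c z)"
    using lin_onD(3)[OF desc_lin(1)] k by simp
  then show ?thesis using f g desc_c[OF v(3)] by (intro bexI[OF _ f(1)] bexI[OF _ g(1)]) simp
qed

text \<open>The value \<open>E (a v)\<close> is then the error term \<open>f\<close> itself. It is
  fixed by \<open>E\<close>, being a value of an idempotent, and killed by \<open>E\<close>, being
  in \<open>kn t\<close>.\<close>

lemma desc_zero:
  assumes kill: "\<And>f. f \<in> kn t \<Longrightarrow> E f = 0" and v: "v \<in> kn d" "D v = 0"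
  shows "E (a v) = 0" "E (b v) = 0" "E (c v) = 0"
proof -
  obtain f where f: "f \<in> kn t" "E (a v) = a (D v) + f" "E (b v) = b (D v) + pCons 0 f"
    using desc_ab[OF v(1)] by blast
  have "E (E (a v)) = E (a v)" using desc_idem(1) lin_onD(1)[OF a v(1)] unfolding idem_on_def by blast
  moreover have "E (a v) = f" using f(2) v(2) lin_on_0[OF a] by simp
  ultimately have "f = 0" using kill[OF f(1)] by simp
  then show "E (a v) = 0" "E (b v) = 0" "E (c v) = 0"
    using f v(2) lin_on_0[OF a] lin_on_0[OF b] lin_on_0[OF c] desc_c[OF v(1)] by simp_all
qed

lemma desc_all_zero:
  assumes kill: "\<And>f. f \<in> kn t \<Longrightarrow> E f = 0" and z: "\<And>v. v \<in> kn d \<Longrightarrow> D v = 0" and f: "f \<in> kn n"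
  shows "E f = 0"
proof -
  obtain u v w where g: "u \<in> kn d" "v \<in> kn d" "w \<in> kn d" "f = a u + b v + c w" using gen[OF f] by blast
  have k: "a u \<in> kn n" "b v \<in> kn n" "c w \<in> kn n" using lin_onD(1)[OF a] lin_onD(1)[OF b] lin_onD(1)[OF c] g by blast+
  have "E f = E (a u) + E (b v) + E (c w)" unfolding g(4) using lin_onD(3)[OF desc_lin(1)] k by simp
  then show ?thesis using desc_zero[OF kill g(1) z[OF g(1)]] desc_zero[OF kill g(2) z[OF g(2)]] desc_zero[OF kill g(3) z[OF g(3)]]
    by simp
qed

lemma desc_c_zero: "\<lbrakk>v \<in> kn d; E (c v) = 0\<rbrakk> \<Longrightarrow> D v = 0"
  using desc_c[of v] c_inj[of "D v"] lin_onD(1)[OF desc_lin(2), of v] by simp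

end

text \<open>For \<open>s = 0\<close>, these are the relations that hold between the three arrows; the arrows of the previous level
  generate them.\<close>

definition sum_rel :: "nat \<Rightarrow> 'k triple set" where
  "sum_rel s = {(u, v, z). u \<in> kn d \<and> v \<in> kn d \<and> z \<in> kn d \<and> a u + b v + c z \<in> kn s}"

text \<open>Without string relations there are no error terms, so \<open>D\<close> preserves the
  relations between the arrows, and \<open>E\<close> is determined by \<open>D\<close> because the
  three arrows generate.\<close>

lemma rigid_rel_0:
  assumes "n > 0" and rigid: "rigid d (sum_rel 0)"
  shows "rigid n (rel 0 {})"
  unfolding rigid_iff
proof (intro allI impI)
  fix E assume E: "idem_on n E \<and> preserves E (rel 0 {})"
  then obtain D where D: "descends 0 E D" using ex_descends by blast
  note l = desc_lin[OF D]
  have sum: "E (a u + b v + c z) = a (D u) + b (D v) + c (D z)" if "u \<in> kn d" "v \<in> kn d" "z \<in> kn d" for u v z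
    using desc_sum[OF D that] by auto
  have "preserves D (sum_rel 0)"
    unfolding preserves_def
  proof (intro allI impI)
    fix u v w assume "(u, v, w) \<in> sum_rel 0"
    then have k: "u \<in> kn d" "v \<in> kn d" "w \<in> kn d" "a u + b v + c w = 0" unfolding sum_rel_def by auto
    then have "a (D u) + b (D v) + c (D w) = 0" using sum[OF k(1-3)] lin_on_0[OF l(1)] by simp
    then show "(D u, D v, D w) \<in> sum_rel 0" unfolding sum_rel_def using k lin_onD(1)[OF l(2)] by simp
  qed
  then consider "\<And>v. v \<in> kn d \<Longrightarrow> D v = 0" | "\<And>v. v \<in> kn d \<Longrightarrow> D v = v"
    using rigid desc_idem(2)[OF D] unfolding rigid_iff by blast
  then show "(\<forall>f\<in>kn n. E f = 0) \<or> (\<forall>f\<in>kn n. E f = f)"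
  proof cases
    case 1
    then show ?thesis using desc_all_zero[OF D] lin_on_0[OF l(1)] by simp
  next
    case 2
    have "E f = f" if f: "f \<in> kn n" for f
    proof -
      obtain u v w where g: "u \<in> kn d" "v \<in> kn d" "w \<in> kn d" "f = a u + b v + c w" using gen[OF f] by blast
      show ?thesis unfolding g(4) sum[OF g(1-3)] using 2 g by simp
    qed
    then show ?thesis by blast
  qed
qed

text \<open>By \<open>string_scalar\<close>, \<open>E\<close> is 0 or 1 on
  \<open>kn (Suc t)\<close>, and passing to \<open>1 - E\<close> it may be assumed to vanish there.
  What remains is that \<open>D\<close> vanishes, as then \<open>E\<close> does.\<close>

lemma rigid_rel_pos:
  assumes t: "t \<ge> 1" "Suc t \<le> n"
    and zero: "\<And>E D v. \<lbrakk>descends t E D; \<And>f. f \<in> kn (Suc t) \<Longrightarrow> E f = 0; v \<in> kn d\<rbrakk> \<Longrightarrow> D v = 0"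
  shows "rigid n (rel t {})"
proof (rule rigidI[of _ _ "Suc t"])
  show "subspace3 n (rel t {})" using subspace3_rel t by simp
  fix E :: "'k poly \<Rightarrow> 'k poly" assume E: "idem_on n E" "preserves E (rel t {})"
  show "(\<forall>f\<in>kn (Suc t). E f = 0) \<or> (\<forall>f\<in>kn (Suc t). E f = f)"
    using string_scalar[OF E string_rel_rel_empty t] .
  fix f :: "'k poly" assume kill: "\<And>f. f \<in> kn (Suc t) \<Longrightarrow> E f = 0" and f: "f \<in> kn n"
  obtain D where D: "descends t E D" using ex_descends[OF E] by blast
  have "E f = 0" if "f \<in> kn t" for f using kill kn_mono[OF that, of "Suc t"] by simp
  then show "E f = 0" using desc_all_zero[OF D _ zero[OF D kill] f] by blast
qed (use t in simp)

text \<open>The error terms of a sum have the form \<open>f + x g\<close> with degree at most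
  \<open>t\<close>. If \<open>E\<close> kills these degrees, then applying \<open>D\<close> to the
  summands keeps the sum within them.\<close>

lemma preserves_sum_rel:
  assumes D: "descends t E D" and kill: "\<And>f. f \<in> kn (Suc t) \<Longrightarrow> E f = 0"
  shows "preserves D (sum_rel (Suc t))"
  unfolding preserves_def
proof (intro allI impI)
  fix u v w assume "(u, v, w) \<in> sum_rel (Suc t)"
  then have k: "u \<in> kn d" "v \<in> kn d" "w \<in> kn d" "a u + b v + c w \<in> kn (Suc t)" unfolding sum_rel_def by auto
  obtain f g where fg: "f \<in> kn t" "g \<in> kn t" "E (a u + b v + c w) = a (D u) + b (D v) + c (D w) + (f + pCons 0 g)"
    using desc_sum[OF D k(1-3)] by blast
  then have "a (D u) + b (D v) + c (D w) = - (f + pCons 0 g)"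
    using kill[OF k(4)] by (simp only: eq_neg_iff_add_eq_0)
  moreover have "- (f + pCons 0 g) \<in> kn (Suc t)" using fg kn_mono[OF fg(1), of "Suc t"] by (intro kn_closed) simp_all
  ultimately show "(D u, D v, D w) \<in> sum_rel (Suc t)"
    unfolding sum_rel_def using k lin_onD(1)[OF desc_lin(2)[OF D]] by simp
qed

end


section \<open>The arrows of the preprojective component\<close>

text \<open>The maps \<open>k \<rightarrow> k\<^sup>3 \<rightarrow> k\<^sup>8 \<rightarrow> k\<^sup>2\<^sup>1\<close> below are the three arrows of \<open>P\<^sub>1\<close>, \<open>P\<^sub>2\<close> and \<open>P\<^sub>3\<close>. The spaces are spanned by
  words in the arrows modulo \<open>u a a + u b b + u c c = 0\<close>, and the powers of \<open>x\<close> enumerate the basis \<open>c, a, b\<close>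
  of \<open>k\<^sup>3\<close>, the basis \<open>a c, b c, a a, a b, b a, b b, c a, c b\<close> of \<open>k\<^sup>8\<close> (so that \<open>c c = - a a - b b\<close>), and a basis
  of \<open>k\<^sup>2\<^sup>1\<close> which starts with \<open>w\<^sub>j a + w\<^sub>j\<^sub>+\<^sub>1 b\<close> for the basis vectors \<open>w\<^sub>j\<close> of \<open>k\<^sup>8\<close>.\<close>

definition a1 :: "'k::field poly \<Rightarrow> 'k poly" where "a1 v = monom (coeff v 0) 1"
definition b1 :: "'k::field poly \<Rightarrow> 'k poly" where "b1 v = monom (coeff v 0) 2"
definition c1 :: "'k::field poly \<Rightarrow> 'k poly" where "c1 v = monom (coeff v 0) 0"

definition a2 :: "'k::field poly \<Rightarrow> 'k poly" where
  "a2 v = monom (coeff v 0) 6 + monom (coeff v 1) 2 + monom (coeff v 2) 4"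
definition b2 :: "'k::field poly \<Rightarrow> 'k poly" where
  "b2 v = monom (coeff v 0) 7 + monom (coeff v 1) 3 + monom (coeff v 2) 5"
definition c2 :: "'k::field poly \<Rightarrow> 'k poly" where
  "c2 v = monom (coeff v 1) 0 + monom (coeff v 2) 1 - monom (coeff v 0) 2 - monom (coeff v 0) 5"

text \<open>From \<open>x^j = w_j a + w_(j+1) b\<close> and the choice
  \<open>w_(j+1) b = x^(12+j)\<close> for \<open>j < 7\<close> follows
  \<open>w_j a = x^j - x^(12+j)\<close>. Taking \<open>x^19 = x^7 - w_7 a\<close> makes this formula
  hold for \<open>j = 7\<close> as well; \<open>w_0 b\<close> is the remaining basis vector
  \<open>x^20\<close>.\<close>

definition a3 :: "'k::field poly \<Rightarrow> 'k poly" where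
  "a3 v = v - monom 1 12 * v"
definition b3 :: "'k::field poly \<Rightarrow> 'k poly" where
  "b3 v = monom 1 11 * (v - [:coeff v 0:]) + monom (coeff v 0) 20"
text \<open>The relations give \<open>acc = - (aaa + abb) = - x^2\<close> and
  \<open>bcc = - (baa + bbb) = - x^4\<close>. Moreover
  \<open>aac + bbc = - ccc = caa + cbb = x^6\<close>, so with \<open>aac = x^7\<close> the word
  \<open>bbc\<close> is \<open>x^6 - x^7\<close>. The words \<open>abc\<close>, \<open>bac\<close>,
  \<open>cac\<close>, \<open>cbc\<close> are \<open>x^8\<close> to \<open>x^11\<close>.\<close>

definition c3 :: "'k::field poly \<Rightarrow> 'k poly" where
  "c3 v = monom (coeff v 2) 7 + monom (coeff v 3) 8 + monom (coeff v 4) 9 + monom (coeff v 5) 6 - monom (coeff v 5) 7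
     + monom (coeff v 6) 10 + monom (coeff v 7) 11 - monom (coeff v 0) 2 - monom (coeff v 1) 4"

lemmas letter_defs = a1_def b1_def c1_def a2_def b2_def c2_def a3_def b3_def c3_def

lemma kn_eqI: "\<lbrakk>f \<in> kn n; g \<in> kn n; \<forall>i\<in>{..<n}. coeff f i = coeff g i\<rbrakk> \<Longrightarrow> f = g"
proof (rule poly_eqI)
  fix i assume "f \<in> kn n" "g \<in> kn n" "\<forall>i\<in>{..<n}. coeff f i = coeff g i"
  then show "coeff f i = coeff g i" by (cases "i < n") (simp_all add: kn_def)
qed

lemma coeff_kn: "\<lbrakk>f \<in> kn n; n \<le> i\<rbrakk> \<Longrightarrow> coeff f i = 0"
  by (simp add: kn_def)

lemma lin_onI:
  assumes "\<And>f. f \<in> kn n \<Longrightarrow> L f \<in> kn m" "\<And>e f. L (e *s f) = e *s L f" "\<And>f g. L (f + g) = L f + L g"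
  shows "lin_on n m L"
  using assms by (simp add: lin_on_def)

lemma triple_set_eqI: "(\<And>u v z. (u, v, z) \<in> A \<longleftrightarrow> (u, v, z) \<in> B) \<Longrightarrow> A = B"
  by auto

lemma lin_on_letters_1: "lin_on 1 3 a1" "lin_on 1 3 b1" "lin_on 1 3 c1"
  by (rule lin_onI; simp add: letter_defs add_monom smult_monom)+

lemma lin_on_letters_2: "lin_on 3 8 a2" "lin_on 3 8 b2" "lin_on 3 8 c2"
  by (rule lin_onI; simp add: letter_defs; simp add: poly_eq_iff algebra_simps)+

lemma lin_on_letters_3:
  shows "lin_on 8 21 (a3 :: 'k::field poly \<Rightarrow> 'k poly)" "lin_on 8 21 (b3 :: 'k poly \<Rightarrow> 'k poly)"
    "lin_on 8 21 (c3 :: 'k poly \<Rightarrow> 'k poly)"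
proof -
  show "lin_on 8 21 (a3 :: 'k poly \<Rightarrow> 'k poly)"
    by (rule lin_onI) (auto simp: a3_def smult_diff_right distrib_left kn_def coeff_monom_mult)
  show "lin_on 8 21 (b3 :: 'k poly \<Rightarrow> 'k poly)"
  proof (rule lin_onI)
    fix f :: "'k poly" assume "f \<in> kn 8"
    then show "b3 f \<in> kn 21"
      by (auto simp: b3_def kn_def coeff_monom_mult coeff_pCons split: nat.split)
  qed (auto simp: b3_def coeff_monom_mult coeff_pCons poly_eq_iff algebra_simps split: nat.split)
  show "lin_on 8 21 (c3 :: 'k poly \<Rightarrow> 'k poly)"
    by (rule lin_onI; simp add: c3_def; simp add: poly_eq_iff algebra_simps)
qed

interpretation A1: exact_arrows 1 3 a1 b1 c1
proof
  fix v :: "'a poly" assume v: "v \<in> kn 1" "c1 v = 0"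
  then have "coeff v 0 = 0" by (simp add: c1_def)
  then show "v = 0" by (intro kn_eqI[OF v(1)]) simp_all
next
  fix w :: "'a poly" assume w: "w \<in> kn 3"
  have "w = a1 [:coeff w 1:] + b1 [:coeff w 2:] + c1 [:coeff w 0:]"
    by (rule kn_eqI[OF w]) (simp_all add: a1_def b1_def c1_def lessThan_nat_numeral)
  then show "\<exists>u\<in>kn 1. \<exists>v\<in>kn 1. \<exists>z\<in>kn 1. w = a1 u + b1 v + c1 z" by (meson const_mem_kn zero_less_one)
qed (rule lin_on_letters_1)+

interpretation A2: exact_arrows 3 8 a2 b2 c2
proof
  fix v :: "'a poly" assume v: "v \<in> kn 3" "c2 v = 0"
  have "coeff (c2 v) 0 = 0" "coeff (c2 v) 1 = 0" "coeff (c2 v) 2 = 0" unfolding v(2) by simp_all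
  then show "v = 0" by (intro kn_eqI[OF v(1)]) (simp_all add: c2_def lessThan_nat_numeral)
next
  fix w :: "'a poly" assume w: "w \<in> kn 8"
  let ?m = "\<lambda>i. monom (coeff w i)"
  have "w = a2 (?m 6 0 + ?m 2 1 + ?m 4 2) + b2 (?m 7 0 + ?m 3 1 + ?m 5 2) + c2 (?m 0 1 + ?m 1 2)"
    by (rule kn_eqI[OF w]) (simp_all add: a2_def b2_def c2_def lessThan_nat_numeral)
  moreover have "?m 6 0 + ?m 2 1 + ?m 4 2 \<in> kn 3" "?m 7 0 + ?m 3 1 + ?m 5 2 \<in> kn 3" "?m 0 1 + ?m 1 2 \<in> kn 3"
    by (intro kn_closed; simp)+
  ultimately show "\<exists>u\<in>kn 3. \<exists>v\<in>kn 3. \<exists>z\<in>kn 3. w = a2 u + b2 v + c2 z" by blast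
qed (rule lin_on_letters_2)+

interpretation A3: exact_arrows 8 21 a3 b3 c3
proof
  fix v :: "'a poly" assume v: "v \<in> kn 8" "c3 v = 0"
  have "coeff (c3 v) i = 0" for i unfolding v(2) by simp
  from this[of 2] this[of 4] this[of 6] this[of 7] this[of 8] this[of 9] this[of 10] this[of 11]
  show "v = 0" by (intro kn_eqI[OF v(1)]) (simp_all add: c3_def lessThan_nat_numeral)
next
  fix w :: "'a poly" assume w: "w \<in> kn 21"
  let ?m = "\<lambda>i. monom (coeff w i)" and ?s = "\<lambda>i j. monom (coeff w i + coeff w (12 + i)) j"
  \<comment> \<open>Solved basis vector by basis vector: \<open>x^j = a3 x^j + b3 x^(j+1)\<close>
    for \<open>j < 7\<close>, the powers 7 to 11 come from \<open>c3\<close>,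
    \<open>x^(12+j) = b3 x^(j+1)\<close>, \<open>x^19 = c3 x^2 - a3 x^7\<close> and
    \<open>x^20 = b3 1\<close>.\<close>
  let ?u = "?m 0 0 + ?m 1 1 + ?m 2 2 + ?m 3 3 + ?m 4 4 + ?m 5 5 + ?m 6 6 - ?m 19 7"
  let ?v = "?m 20 0 + ?s 0 1 + ?s 1 2 + ?s 2 3 + ?s 3 4 + ?s 4 5 + ?s 5 6 + ?s 6 7"
  let ?z = "monom (coeff w 7 + coeff w 19) 2 + ?m 8 3 + ?m 9 4 + ?m 10 6 + ?m 11 7"
  have k: "?u \<in> kn 8" "?v \<in> kn 8" "?z \<in> kn 8" by (intro kn_closed; simp)+
  have "w = a3 ?u + b3 ?v + c3 ?z"
  proof (rule kn_eqI[OF w])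
    show "a3 ?u + b3 ?v + c3 ?z \<in> kn 21"
      using k lin_onD(1)[OF lin_on_letters_3(1)] lin_onD(1)[OF lin_on_letters_3(2)] lin_onD(1)[OF lin_on_letters_3(3)]
      by (intro kn_closed) blast+
    show "\<forall>i\<in>{..<21}. coeff w i = coeff (a3 ?u + b3 ?v + c3 ?z) i"
      by (simp add: a3_def b3_def c3_def lessThan_nat_numeral coeff_monom_mult coeff_pCons)
  qed
  then show "\<exists>u\<in>kn 8. \<exists>v\<in>kn 8. \<exists>z\<in>kn 8. w = a3 u + b3 v + c3 z" using k by blast
qed (rule lin_on_letters_3)+

section \<open>Exactness: the relations between the arrows of successive levels\<close>

lemma sum_rel_2: "A2.sum_rel 0 = A1.rel 0 {}"
proof (rule triple_set_eqI, rule iffI)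
  fix u v z :: "'a poly" assume "(u, v, z) \<in> A2.sum_rel 0"
  then have k: "u \<in> kn 3" "v \<in> kn 3" "z \<in> kn 3" and "a2 u + b2 v + c2 z = 0" unfolding A2.sum_rel_def by auto
  then have s: "coeff (a2 u + b2 v + c2 z) i = 0" for i by simp
  from s[of 0] s[of 1] s[of 2] s[of 3] s[of 4] s[of 5] s[of 6] s[of 7]
  have e: "u = a1 [:coeff z 0:]" "v = b1 [:coeff z 0:]" "z = c1 [:coeff z 0:]"
    by (intro kn_eqI[OF k(1)] kn_eqI[OF k(2)] kn_eqI[OF k(3)];
        simp add: letter_defs lessThan_nat_numeral add_eq_0_iff)+
  show "(u, v, z) \<in> A1.rel 0 {}" using A1.relI[of "[:coeff z 0:]" 0 0 0 "{}"] e by simp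
next
  fix u v z :: "'a poly" assume "(u, v, z) \<in> A1.rel 0 {}"
  then obtain f where f: "f \<in> kn 1" "u = a1 f" "v = b1 f" "z = c1 f" by (rule A1.relE) auto
  have "a2 u + b2 v + c2 z = 0" unfolding f by (simp add: letter_defs)
  then show "(u, v, z) \<in> A2.sum_rel 0" unfolding A2.sum_rel_def f
    using lin_onD(1)[OF lin_on_letters_1(1) f(1)] lin_onD(1)[OF lin_on_letters_1(2) f(1)] lin_onD(1)[OF lin_on_letters_1(3) f(1)]
    by simp
qed

lemma sum_rel_3_0: "A3.sum_rel 0 = A2.rel 0 {}"
proof (rule triple_set_eqI, rule iffI)
  fix u v z :: "'a poly" assume "(u, v, z) \<in> A3.sum_rel 0"
  then have k: "u \<in> kn 8" "v \<in> kn 8" "z \<in> kn 8" and "a3 u + b3 v + c3 z = 0" unfolding A3.sum_rel_def by auto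
  then have s: "coeff (a3 u + b3 v + c3 z) i = 0" for i by simp
  note k8 = coeff_kn[OF k(1)] coeff_kn[OF k(2)] coeff_kn[OF k(3)]
  \<comment> \<open>The vector is read off from \<open>z = c2 w\<close>, whose coefficients at 5, 0
    and 1 are \<open>- w_0\<close>, \<open>w_1\<close> and \<open>w_2\<close>.\<close>
  let ?w = "monom (- coeff z 5) 0 + monom (coeff z 0) 1 + monom (coeff z 1) 2"
  have w: "?w \<in> kn 3" by (intro kn_closed; simp)
  have "u = a2 ?w"
  proof (rule kn_eqI[OF k(1) lin_onD(1)[OF lin_on_letters_2(1) w]])
    show "\<forall>i\<in>{..<8}. coeff u i = coeff (a2 ?w) i"
      using s[of 0] s[of 1] s[of 2] s[of 3] s[of 4] s[of 5] s[of 6] s[of 19]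
      by (simp add: letter_defs lessThan_nat_numeral coeff_monom_mult coeff_pCons k8 eq_neg_iff_add_eq_0)
  qed
  moreover have "v = b2 ?w"
  proof (rule kn_eqI[OF k(2) lin_onD(1)[OF lin_on_letters_2(2) w]])
    show "\<forall>i\<in>{..<8}. coeff v i = coeff (b2 ?w) i"
      using s[of 20] s[of 12] s[of 13] s[of 14] s[of 15] s[of 16] s[of 17] s[of 18] \<open>u = a2 ?w\<close>
      by (simp add: letter_defs lessThan_nat_numeral coeff_monom_mult coeff_pCons k8 eq_neg_iff_add_eq_0)
  qed
  moreover have "z = c2 ?w"
  proof (rule kn_eqI[OF k(3) lin_onD(1)[OF lin_on_letters_2(3) w]])
    show "\<forall>i\<in>{..<8}. coeff z i = coeff (c2 ?w) i"
      using s[of 7] s[of 8] s[of 9] s[of 10] s[of 11] s[of 19]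
      by (simp add: letter_defs lessThan_nat_numeral coeff_monom_mult coeff_pCons k8)
  qed
  ultimately show "(u, v, z) \<in> A2.rel 0 {}" using A2.relI[OF w, of 0 0 0 "{}"] by simp
next
  fix u v z :: "'a poly" assume "(u, v, z) \<in> A2.rel 0 {}"
  then obtain f where f: "f \<in> kn 3" "u = a2 f" "v = b2 f" "z = c2 f" by (rule A2.relE) auto
  have k: "u \<in> kn 8" "v \<in> kn 8" "z \<in> kn 8" unfolding f
    using lin_onD(1)[OF lin_on_letters_2(1) f(1)] lin_onD(1)[OF lin_on_letters_2(2) f(1)] lin_onD(1)[OF lin_on_letters_2(3) f(1)] by simp_all
  have "a3 u + b3 v + c3 z = 0"
  proof (rule kn_eqI[of _ 21])
    show "a3 u + b3 v + c3 z \<in> kn 21"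
      using lin_onD(1)[OF lin_on_letters_3(1) k(1)] lin_onD(1)[OF lin_on_letters_3(2) k(2)] lin_onD(1)[OF lin_on_letters_3(3) k(3)] by simp
    show "\<forall>i\<in>{..<21}. coeff (a3 u + b3 v + c3 z) i = coeff 0 i" unfolding f
      by (simp add: letter_defs lessThan_nat_numeral coeff_monom_mult coeff_pCons)
  qed simp
  then show "(u, v, z) \<in> A3.sum_rel 0" unfolding A3.sum_rel_def using k by simp
qed

text \<open>On multiples of \<open>x\<close>, \<open>b3\<close> is multiplication by
  \<open>x^11\<close>, so the term \<open>- x^12 f\<close> of \<open>a3 f\<close> cancels. The basis
  of the last space was chosen for this identity.\<close>

lemma a3_b3_string: "f \<in> kn 7 \<Longrightarrow> a3 f + b3 (pCons 0 f) = f"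
  by (simp add: a3_def b3_def monom_Suc eval_nat_numeral)

lemma pCons_kn_8: "f \<in> kn 7 \<Longrightarrow> pCons 0 f \<in> kn 8"
  using kn_pCons[of 0 f 7] by simp

text \<open>If the sum of a triple is \<open>f\<close>, then subtracting \<open>(f, x f, 0)\<close>
  leaves a triple with sum 0, since that triple has the same sum \<open>f\<close>. So a low degree
  of the sum amounts to a string relation one level below.\<close>

lemma sum_rel_3:
  assumes "t \<le> 7"
  shows "A3.sum_rel t = A2.rel t {}"
proof -
  have m: "f \<in> kn 7" "f \<in> kn 8" if "f \<in> kn t" for f :: "'a poly" using kn_mono[OF that] assms by simp_all
  show ?thesis
  proof (rule triple_set_eqI, rule iffI)
    fix u v z :: "'a poly" assume "(u, v, z) \<in> A3.sum_rel t"
    then have k: "u \<in> kn 8" "v \<in> kn 8" "z \<in> kn 8" "a3 u + b3 v + c3 z \<in> kn t" unfolding A3.sum_rel_def by auto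
    define f where "f = a3 u + b3 v + c3 z"
    have ft: "f \<in> kn t" using k(4) unfolding f_def .
    have f: "f \<in> kn 8" "pCons 0 f \<in> kn 8" using m[OF ft] pCons_kn_8 by simp_all
    have "a3 (u - f) + b3 (v - pCons 0 f) + c3 z = a3 u + b3 v + c3 z - (a3 f + b3 (pCons 0 f))"
      unfolding lin_onD(5)[OF lin_on_letters_3(1) k(1) f(1)] lin_onD(5)[OF lin_on_letters_3(2) k(2) f(2)] by simp
    also have "\<dots> = f - f" unfolding a3_b3_string[OF m(1)[OF ft]] f_def[symmetric] ..
    also have "\<dots> = 0" by simp
    finally have "a3 (u - f) + b3 (v - pCons 0 f) + c3 z = 0" .
    then have "(u - f, v - pCons 0 f, z) \<in> A2.rel 0 {}"
      unfolding sum_rel_3_0[symmetric] A3.sum_rel_def using k f by simp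
    then obtain w where w: "w \<in> kn 3" "u - f = a2 w" "v - pCons 0 f = b2 w" "z = c2 w" by (rule A2.relE) auto
    have "u = a2 w + f" "v = b2 w + pCons 0 f" using w by (simp_all only: diff_eq_eq)
    then show "(u, v, z) \<in> A2.rel t {}" using A2.relI[OF w(1) ft, of 0 "{}"] w(4) by simp
  next
    fix u v z :: "'a poly" assume "(u, v, z) \<in> A2.rel t {}"
    then obtain w f where w: "w \<in> kn 3" "f \<in> kn t" "u = a2 w + f" "v = b2 w + pCons 0 f" "z = c2 w" by (rule A2.relE) auto
    have "(a2 w, b2 w, c2 w) \<in> A3.sum_rel 0" unfolding sum_rel_3_0 using A2.relI[OF w(1), of 0 0 0 "{}"] by simp
    then have k: "a2 w \<in> kn 8" "b2 w \<in> kn 8" "c2 w \<in> kn 8" "a3 (a2 w) + b3 (b2 w) + c3 (c2 w) = 0"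
      unfolding A3.sum_rel_def by auto
    have f: "f \<in> kn 8" "pCons 0 f \<in> kn 8" using m[OF w(2)] pCons_kn_8 by simp_all
    have "a3 u + b3 v + c3 z = (a3 (a2 w) + b3 (b2 w) + c3 (c2 w)) + (a3 f + b3 (pCons 0 f))"
      unfolding w(3-5) using lin_onD(3)[OF lin_on_letters_3(1) k(1) f(1)] lin_onD(3)[OF lin_on_letters_3(2) k(2) f(2)]
      by (simp add: algebra_simps)
    also have "\<dots> = f" using k(4) a3_b3_string[OF m(1)[OF w(2)]] by simp
    finally show "(u, v, z) \<in> A3.sum_rel t" unfolding A3.sum_rel_def using w k f by simp
  qed
qed

text \<open>With third component 0, the coefficients of the sum from 12 on must vanish: 12 to 18
  give \<open>g_(j+1) = f_j\<close>, 19 gives \<open>f_7 = 0\<close>, and 20 gives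
  \<open>g_0 = 0\<close>. Conversely, the bound \<open>t \<ge> 7\<close> admits all sums
  \<open>f\<close> of degree less than 7.\<close>

lemma string_rel_sum_rel_3:
  assumes "7 \<le> t" "t \<le> 11"
  shows "string_rel 7 (A3.sum_rel t)"
  unfolding string_rel_def
proof (intro allI iffI)
  fix f g :: "'a poly" assume "(f, g, 0) \<in> A3.sum_rel t"
  then have k: "f \<in> kn 8" "g \<in> kn 8" "a3 f + b3 g \<in> kn t" unfolding A3.sum_rel_def
    by (auto simp: lin_on_0[OF lin_on_letters_3(3)])
  note k8 = coeff_kn[OF k(1)] coeff_kn[OF k(2)]
  have s: "coeff (a3 f + b3 g) i = 0" if "i \<ge> 12" for i using coeff_kn[OF k(3)] that assms by simp
  have "coeff f 7 = 0" using s[of 19] by (simp add: letter_defs coeff_monom_mult coeff_pCons k8)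
  moreover have "coeff f i = 0" if "i \<ge> 7" "i \<noteq> 7" for i using k8(1) that by simp
  ultimately have f: "f \<in> kn 7" unfolding kn_def by blast
  have "g = pCons 0 f"
  proof (rule kn_eqI[OF k(2) pCons_kn_8[OF f]])
    show "\<forall>i\<in>{..<8}. coeff g i = coeff (pCons 0 f) i"
      using s[of 20] s[of 12] s[of 13] s[of 14] s[of 15] s[of 16] s[of 17] s[of 18]
      by (simp add: letter_defs lessThan_nat_numeral coeff_monom_mult coeff_pCons k8)
  qed
  then show "f \<in> kn 7 \<and> g = pCons 0 f" using f by blast
next
  fix f g :: "'a poly" assume fg: "f \<in> kn 7 \<and> g = pCons 0 f"
  then show "(f, g, 0) \<in> A3.sum_rel t" unfolding A3.sum_rel_def
    using a3_b3_string[of f] pCons_kn_8[of f] kn_mono[of f 7 8] kn_mono[of f 7 t] assms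
    by (auto simp: lin_on_0[OF lin_on_letters_3(3)])
qed


section \<open>Rigidity of the intermediate relations\<close>

lemma rigid_1_rel: "t < 2 \<Longrightarrow> rigid 3 (A1.rel t {})"
proof (cases "t = 0")
  case True
  then show ?thesis by (simp only: A1.rigid_rel_0 rigid_1 zero_less_numeral)
next
  case False
  assume "t < 2"
  show ?thesis
  proof (rule A1.rigid_rel_pos)
    fix E D :: "'a poly \<Rightarrow> 'a poly" and v :: "'a poly"
    assume D: "A1.descends t E D" and kill: "\<And>f. f \<in> kn (Suc t) \<Longrightarrow> E f = 0" and v: "v \<in> kn 1"
    have "c1 v \<in> kn (Suc t)" by (simp add: c1_def)
    then show "D v = 0" using A1.desc_c_zero[OF D v] kill by simp
  qed (use False \<open>t < 2\<close> in simp_all)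
qed

text \<open>\<open>E\<close> kills \<open>a c\<close> and \<open>b c\<close>, hence \<open>D\<close> kills \<open>a\<close> and \<open>b\<close>, hence \<open>E\<close> kills \<open>c c = - a a - b b\<close>.\<close>

lemma rigid_2_rel: "t < 7 \<Longrightarrow> rigid 8 (A2.rel t {})"
proof (cases "t = 0")
  case True
  have "rigid 3 (A2.sum_rel 0)" unfolding sum_rel_2 by (rule rigid_1_rel) simp
  then show ?thesis unfolding True by (intro A2.rigid_rel_0) simp_all
next
  case False
  assume "t < 7"
  show ?thesis
  proof (rule A2.rigid_rel_pos)
    fix E D :: "'a poly \<Rightarrow> 'a poly" and v :: "'a poly"
    assume D: "A2.descends t E D" and kill: "\<And>f. f \<in> kn (Suc t) \<Longrightarrow> E f = 0" and v: "v \<in> kn 3"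
    note l = A2.desc_lin[OF D]
    have kill': "E f = 0" if "f \<in> kn t" for f using kill kn_mono[OF that, of "Suc t"] by simp
    have k: "monom (1::'a) i \<in> kn 3" if "i < 3" for i using that by simp
    have "c2 (monom 1 1) \<in> kn (Suc t)" "c2 (monom 1 2) \<in> kn (Suc t)" using False by (simp_all add: c2_def)
    then have D12: "D (monom 1 1) = 0" "D (monom 1 2) = 0"
      using A2.desc_c_zero[OF D k[of 1] kill] A2.desc_c_zero[OF D k[of 2] kill] by simp_all
    have z: "E (a2 (monom 1 1)) = 0" "E (b2 (monom 1 2)) = 0"
      using A2.desc_zero(1)[OF D kill' k[of 1] D12(1)] A2.desc_zero(2)[OF D kill' k[of 2] D12(2)] by simp_all
    have ab: "a2 (monom 1 1) \<in> kn 8" "b2 (monom 1 2) \<in> kn 8" by (simp_all add: a2_def b2_def)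
    have e: "c2 (monom 1 0) = - (a2 (monom 1 1) + b2 (monom 1 2))" by (simp add: letter_defs)
    have "E (c2 (monom 1 0)) = 0"
      unfolding e using lin_onD(4)[OF l(1) kn_closed(2)[OF ab]] lin_onD(3)[OF l(1) ab] z by simp
    then have D0: "D (monom 1 0) = 0" using A2.desc_c_zero[OF D k[of 0]] by simp
    have "D (monom 1 i) = 0" if "i < 3" for i
    proof -
      have "i = 0 \<or> i = 1 \<or> i = 2" using that by linarith
      then show ?thesis using D0 D12 by blast
    qed
    then show "D v = 0" by (intro lin_on_eqI[OF l(2) lin_on_zero _ v])
  qed (use False \<open>t < 7\<close> in simp_all)
qed

text \<open>If \<open>t \<ge> 11\<close>, then \<open>E\<close> kills the whole image of
  \<open>c3\<close>, which has degree at most 11, so \<open>D = 0\<close>. For smaller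
  \<open>t\<close>, \<open>D\<close> is 0 or 1, by rigidity of the previous level or by its string
  structure. The case \<open>D = 1\<close> is excluded by \<open>c3 1 = - x^2\<close>.\<close>

lemma rigid_3_rel: "t < 20 \<Longrightarrow> rigid 21 (A3.rel t {})"
proof (cases "t = 0")
  case True
  have "rigid 8 (A3.sum_rel 0)" unfolding sum_rel_3_0 by (rule rigid_2_rel) simp
  then show ?thesis unfolding True by (intro A3.rigid_rel_0) simp_all
next
  case False
  assume t20: "t < 20"
  show ?thesis
  proof (rule A3.rigid_rel_pos)
    fix E D :: "'a poly \<Rightarrow> 'a poly" and v :: "'a poly"
    assume D: "A3.descends t E D" and kill: "\<And>f. f \<in> kn (Suc t) \<Longrightarrow> E f = 0" and v: "v \<in> kn 8"
    note l = A3.desc_lin[OF D]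
    have k: "monom (1::'a) i \<in> kn 8" if "i < 8" for i using that by simp
    show "D v = 0"
    proof (cases "t \<ge> 11")
      case True
      have "c3 v \<in> kn 12" by (simp add: c3_def)
      then have "c3 v \<in> kn (Suc t)" using True kn_mono[of "c3 v" 12 "Suc t"] by simp
      then show ?thesis using A3.desc_c_zero[OF D v] kill by blast
    next
      case False
      have P: "preserves D (A3.sum_rel (Suc t))" using A3.preserves_sum_rel[OF D kill] .
      have "(\<forall>f\<in>kn 8. D f = 0) \<or> (\<forall>f\<in>kn 8. D f = f)"
      proof (cases "t \<le> 5")
        case True
        then have "Suc t \<le> 7" "Suc t < 7" by simp_all
        then have "rigid 8 (A3.sum_rel (Suc t) :: 'a triple set)"
          by (simp only: sum_rel_3 rigid_2_rel)
        then show ?thesis using P A3.desc_idem(2)[OF D] unfolding rigid_iff by blast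
      next
        case f5: False
        have s: "string_rel 7 (A3.sum_rel (Suc t) :: 'a triple set)"
          by (rule string_rel_sum_rel_3) (use f5 False in simp_all)
        show ?thesis using string_scalar[OF A3.desc_idem(2)[OF D] P s] by (simp add: eval_nat_numeral)
      qed
      moreover have False if id: "\<forall>f\<in>kn 8. D f = f"
      proof -
        have cz: "c3 (monom (1::'a) 0) = - monom 1 2" by (simp add: c3_def minus_monom)
        have m2: "monom (1::'a) 2 \<in> kn 21" "monom (1::'a) 2 \<noteq> 0" by (simp_all add: monom_eq_0_iff)
        show False
        proof (cases "t \<ge> 2")
          case True
          have "E (monom 1 2) = 0" using kill True by simp
          then have "E (c3 (monom 1 0)) = 0" unfolding cz using lin_onD(4)[OF l(1) m2(1)] by simp
          then show False using A3.desc_c[OF D k[of 0]] id cz m2(2) by simp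
        next
          case f2: False
          \<comment> \<open>Now \<open>x^2\<close> is not killed in advance. Instead the error terms
            are constants \<open>p u\<close>, and their values on \<open>x\<close> and
            \<open>x^2\<close> lead to a contradiction.\<close>
          then have t1: "t = 1" using \<open>t \<noteq> 0\<close> by linarith
          have E01: "E (monom 1 0) = 0" "E (monom 1 1) = 0" using kill t1 by simp_all
          have "\<exists>p. E (a3 u) = a3 u + [:p:] \<and> E (b3 u) = b3 u + [:0, p:]" if u: "u \<in> kn 8" for u
          proof -
            obtain f where f: "f \<in> kn 1" "E (a3 u) = a3 (D u) + f" "E (b3 u) = b3 (D u) + pCons 0 f"
              using A3.desc_ab[OF D u] t1 by blast
            moreover obtain p where "f = [:p:]" using kn_1_cases[OF f(1)] by blast
            ultimately show ?thesis using id u by auto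
          qed
          then obtain p where p: "\<And>u. u \<in> kn 8 \<Longrightarrow> E (a3 u) = a3 u + [:p u:] \<and> E (b3 u) = b3 u + [:0, p u:]"
            by metis
          have step: "E (monom 1 i) = monom 1 i + [:p (monom 1 i), p (monom 1 (Suc i)):]" if i: "i < 7" for i
          proof -
            have m: "monom 1 i = a3 (monom 1 i) + b3 (monom 1 (Suc i))"
              by (rule sym) (simp add: a3_b3_string i flip: pCons_0_monom)
            have ki: "monom (1::'a) i \<in> kn 8" "monom (1::'a) (Suc i) \<in> kn 8" using i by simp_all
            have "E (monom 1 i) = E (a3 (monom 1 i)) + E (b3 (monom 1 (Suc i)))"
              using lin_onD(3)[OF l(1) lin_onD(1)[OF lin_on_letters_3(1) ki(1)] lin_onD(1)[OF lin_on_letters_3(2) ki(2)]]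
              by (simp flip: m)
            also have "\<dots> = (a3 (monom 1 i) + b3 (monom 1 (Suc i))) + [:p (monom 1 i), p (monom 1 (Suc i)):]"
              using p[OF ki(1)] p[OF ki(2)] by simp
            finally show ?thesis unfolding m[symmetric] .
          qed
          have "E (monom 1 2) = monom 1 2"
          proof -
            have "E (c3 (monom 1 0)) = c3 (monom 1 0)" using A3.desc_c[OF D k[of 0]] id k[of 0] by simp
            then show ?thesis unfolding cz using lin_onD(4)[OF l(1) m2(1)] by simp
          qed
          then have p2: "p (monom 1 2) = 0" using step[of 2] by simp
          \<comment> \<open>The coefficient of \<open>x\<close> in \<open>E x = 0\<close> is
            \<open>1 + p (x^2)\<close>, whereas \<open>p (x^2) = 0\<close>.\<close>
          have "coeff (monom 1 1 + [:p (monom 1 1), p (monom 1 (Suc 1)):]) 1 = 0" using step[of 1] E01 by simp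
          then show False using p2 by (simp add: eval_nat_numeral)
        qed
      qed
      ultimately show ?thesis using v by blast
    qed
  qed (use False t20 in simp_all)
qed

section \<open>Accessibility of the presented modules, level by level\<close>

lemma kn_suppI: "(\<And>i. coeff f i \<noteq> 0 \<Longrightarrow> i \<in> S) \<Longrightarrow> f \<in> kn_supp S"
  by (simp add: kn_supp_def)

text \<open>The free case fits the general scheme with arrows starting at the zero space, so that
  the complement of the image of \<open>c\<close> is everything.\<close>

lemma acc_level_0:
  fixes M :: "(kronecker_vertex \<times> nat list \<Rightarrow> 'k::field, 'm) module"
  assumes "presents M 1 {0} \<Psi>"
  shows "acc M"
proof -
  interpret arrows 0 1 "\<lambda>_. 0 :: 'k poly" "\<lambda>_. 0" "\<lambda>_. 0"
    by unfold_locales (simp_all add: lin_on_def)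
  have "rel 0 {} = {0}" unfolding rel_def by (auto simp: zero_prod_def)
  moreover have "(kn_supp {0} :: 'k poly set) = kn 1" unfolding kn_supp_def kn_def by (auto simp: Suc_le_eq)
  ultimately show ?thesis using assms by (intro acc_if_rigid[of 0 "{0}"]) simp_all
qed

lemma acc_level_1:
  fixes M :: "(kronecker_vertex \<times> nat list \<Rightarrow> 'k::field, 'm) module"
  assumes "presents M 3 (A1.rel 0 {}) \<Psi>"
  shows "acc M"
proof (rule A1.acc_if_rigid[of 2 "{1, 2}", OF _ _ _ _ _ assms])
  fix v :: "'k poly" assume v: "v \<in> kn 1" "c1 v \<in> kn_supp {1, 2}"
  then have "coeff (c1 v) 0 = 0" unfolding kn_supp_def by force
  then show "v = 0" by (intro kn_eqI[OF v(1)]) (simp_all add: c1_def)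
next
  fix w :: "'k poly" assume w: "w \<in> kn 3"
  let ?v = "[:coeff w 0:]"
  have "i \<in> {1, 2}" if nz: "coeff (w - c1 ?v) i \<noteq> 0" for i
  proof (rule ccontr)
    assume "i \<notin> {1, 2}"
    then consider "i = 0" | "3 \<le> i" by force
    then show False using nz coeff_kn[OF w, of i] by cases (auto simp: c1_def)
  qed
  then show "\<exists>v\<in>kn 1. w - c1 v \<in> kn_supp {1, 2}" by (intro bexI[of _ ?v] kn_suppI) simp_all
next
  fix t :: nat assume "t < 2"
  then show "rigid 3 (A1.rel t {} :: 'k triple set)" by (rule rigid_1_rel)
qed simp_all


text \<open>The image of \<open>c2\<close> is spanned by \<open>1\<close>, \<open>x\<close> and
  \<open>x^2 + x^5\<close>. The coefficients at 0, 1 and 5 are pivots, and the other exponents form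
  the complement.\<close>

lemma acc_level_2:
  fixes M :: "(kronecker_vertex \<times> nat list \<Rightarrow> 'k::field, 'm) module"
  assumes "presents M 8 (A2.rel 0 {}) \<Psi>"
  shows "acc M"
proof (rule A2.acc_if_rigid[of 7 "{2, 3, 4, 6, 7}", OF _ _ _ _ _ assms])
  fix v :: "'k poly" assume v: "v \<in> kn 3" "c2 v \<in> kn_supp {2, 3, 4, 6, 7}"
  then have "coeff (c2 v) i = 0" if "i \<notin> {2, 3, 4, 6, 7}" for i using that unfolding kn_supp_def by blast
  from this[of 0] this[of 1] this[of 5] show "v = 0"
    by (intro kn_eqI[OF v(1)]) (simp_all add: c2_def lessThan_nat_numeral)
next
  fix w :: "'k poly" assume w: "w \<in> kn 8"
  let ?v = "monom (- coeff w 5) 0 + monom (coeff w 0) 1 + monom (coeff w 1) 2"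
  have "i \<in> {2, 3, 4, 6, 7}" if "coeff (w - c2 ?v) i \<noteq> 0" for i
  proof (rule ccontr)
    assume i: "i \<notin> {2, 3, 4, 6, 7}"
    have "i = 0 \<or> i = 1 \<or> i = 5 \<or> 8 \<le> i" using i by auto
    then show False using that coeff_kn[OF w, of i] by (auto simp: c2_def)
  qed
  then have "w - c2 ?v \<in> kn_supp {2, 3, 4, 6, 7}" by (rule kn_suppI)
  moreover have "?v \<in> kn 3" by (intro kn_closed; simp)
  ultimately show "\<exists>v\<in>kn 3. w - c2 v \<in> kn_supp {2, 3, 4, 6, 7}" by blast
next
  fix t :: nat assume "t < 7"
  then show "rigid 8 (A2.rel t {} :: 'k triple set)" by (rule rigid_2_rel)
qed auto

text \<open>The coefficients at 2, 4 and 6 to 11 determine a vector in the image of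
  \<open>c3\<close>; the remaining exponents give a complement.\<close>

lemma acc_level_3:
  fixes M :: "(kronecker_vertex \<times> nat list \<Rightarrow> 'k::field, 'm) module"
  assumes "presents M 21 (A3.rel 0 {}) \<Psi>"
  shows "acc M"
proof (rule A3.acc_if_rigid[of 20 "{..<21} - {2, 4, 6, 7, 8, 9, 10, 11}", OF _ _ _ _ _ assms])
  fix v :: "'k poly" assume v: "v \<in> kn 8" "c3 v \<in> kn_supp ({..<21} - {2, 4, 6, 7, 8, 9, 10, 11})"
  then have s: "coeff (c3 v) i = 0" if "i \<in> {2, 4, 6, 7, 8, 9, 10, 11}" for i using that unfolding kn_supp_def by blast
  from s[of 2] s[of 4] s[of 6] s[of 7] s[of 8] s[of 9] s[of 10] s[of 11]
  show "v = 0" by (intro kn_eqI[OF v(1)]) (simp_all add: c3_def lessThan_nat_numeral)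
next
  fix w :: "'k poly" assume w: "w \<in> kn 21"
  let ?m = "\<lambda>i. monom (coeff w i)"
  let ?v = "monom (- coeff w 2) 0 + monom (- coeff w 4) 1 + monom (coeff w 7 + coeff w 6) 2 + ?m 8 3 + ?m 9 4 + ?m 6 5
    + ?m 10 6 + ?m 11 7"
  have "i \<in> {..<21} - {2, 4, 6, 7, 8, 9, 10, 11}" if nz: "coeff (w - c3 ?v) i \<noteq> 0" for i
  proof (rule ccontr)
    assume i: "i \<notin> {..<21} - {2, 4, 6, 7, 8, 9, 10, 11}"
    then consider "i \<in> {2, 4, 6, 7, 8, 9, 10, 11}" | "i \<ge> 21" by auto
    then show False using nz coeff_kn[OF w, of i] by cases (auto simp: c3_def)
  qed
  then have "w - c3 ?v \<in> kn_supp ({..<21} - {2, 4, 6, 7, 8, 9, 10, 11})" by (rule kn_suppI)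
  moreover have "?v \<in> kn 8" by (intro kn_closed; simp)
  ultimately show "\<exists>v\<in>kn 8. w - c3 v \<in> kn_supp ({..<21} - {2, 4, 6, 7, 8, 9, 10, 11})" by blast
next
  fix t :: nat assume "t < 20"
  then show "rigid 21 (A3.rel t {} :: 'k triple set)" by (rule rigid_3_rel)
qed auto


section \<open>Projective covers\<close>

lemma mod_homD:
  assumes "h \<in> mod_hom A M N"
  shows "x \<in> carrier M \<Longrightarrow> h x \<in> carrier N"
    "\<lbrakk>x \<in> carrier M; y \<in> carrier M\<rbrakk> \<Longrightarrow> h (x \<oplus>\<^bsub>M\<^esub> y) = h x \<oplus>\<^bsub>N\<^esub> h y"
    "\<lbrakk>a \<in> carrier A; x \<in> carrier M\<rbrakk> \<Longrightarrow> h (a \<odot>\<^bsub>M\<^esub> x) = a \<odot>\<^bsub>N\<^esub> h x"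
  using assms unfolding mod_hom_def by auto

lemma mod_homI:
  assumes "\<And>x. x \<in> carrier M \<Longrightarrow> h x \<in> carrier N"
    "\<And>x y. \<lbrakk>x \<in> carrier M; y \<in> carrier M\<rbrakk> \<Longrightarrow> h (x \<oplus>\<^bsub>M\<^esub> y) = h x \<oplus>\<^bsub>N\<^esub> h y"
    "\<And>a x. \<lbrakk>a \<in> carrier A; x \<in> carrier M\<rbrakk> \<Longrightarrow> h (a \<odot>\<^bsub>M\<^esub> x) = a \<odot>\<^bsub>N\<^esub> h x"
  shows "h \<in> mod_hom A M N"
  using assms unfolding mod_hom_def by auto

lemma mod_hom_comp: "\<lbrakk>h \<in> mod_hom A M N; k \<in> mod_hom A N P\<rbrakk> \<Longrightarrow> (\<lambda>x. k (h x)) \<in> mod_hom A M P"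
  by (rule mod_homI) (simp_all add: mod_homD)

context
  fixes A :: "('a, 'r) ring_scheme" and M :: "('a, 'm) module" and N :: "('a, 'n) module" and h
  assumes M: "left_module A M" and N: "left_module A N" and h: "h \<in> mod_hom A M N"
begin

interpretation M: left_module A M by (rule M)
interpretation N: left_module A N by (rule N)

lemma mod_hom_zero: "h \<zero>\<^bsub>M\<^esub> = \<zero>\<^bsub>N\<^esub>"
proof -
  have "\<zero>\<^bsub>A\<^esub> \<odot>\<^bsub>M\<^esub> \<zero>\<^bsub>M\<^esub> = \<zero>\<^bsub>M\<^esub>" by simp
  then show ?thesis using mod_homD(3)[OF h, of "\<zero>\<^bsub>A\<^esub>" "\<zero>\<^bsub>M\<^esub>"] mod_homD(1)[OF h] by simp
qed

lemma mod_hom_diff: "\<lbrakk>x \<in> carrier M; y \<in> carrier M\<rbrakk> \<Longrightarrow> h (x \<ominus>\<^bsub>M\<^esub> y) = h x \<ominus>\<^bsub>N\<^esub> h y"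
proof -
  assume xy: "x \<in> carrier M" "y \<in> carrier M"
  have "h (\<ominus>\<^bsub>M\<^esub> y) = \<ominus>\<^bsub>N\<^esub> h y"
    using mod_homD(3)[OF h, of "\<ominus>\<^bsub>A\<^esub> \<one>\<^bsub>A\<^esub>" y] xy mod_homD(1)[OF h]
    by (simp add: M.smult_minus_one N.smult_minus_one)
  then show ?thesis using mod_homD(2)[OF h, of x "\<ominus>\<^bsub>M\<^esub> y"] xy by (simp add: a_minus_def)
qed

lemma a_kernel_eq: "a_kernel M N h = {x \<in> carrier M. h x = \<zero>\<^bsub>N\<^esub>}"
  by (simp add: a_kernel_def kernel_def)

lemma submodule_a_kernel: "submodule (a_kernel M N h) A M"
  unfolding M.submodule_iff a_kernel_eq using mod_homD[OF h] mod_hom_zero by auto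

lemma submodule_mod_hom_image:
  assumes U: "submodule U A M" shows "submodule (h ` U) A N"
proof -
  note u = U[unfolded M.submodule_iff]
  have c: "x \<in> carrier M" if "x \<in> U" for x using u that by blast
  have "h x \<oplus>\<^bsub>N\<^esub> h y \<in> h ` U" if "x \<in> U" "y \<in> U" for x y
    using that c u by (simp flip: mod_homD(2)[OF h])
  moreover have "a \<odot>\<^bsub>N\<^esub> h x \<in> h ` U" if "x \<in> U" "a \<in> carrier A" for x a
    using that c u by (simp flip: mod_homD(3)[OF h])
  moreover have "\<zero>\<^bsub>N\<^esub> \<in> h ` U" using u by (simp flip: mod_hom_zero)
  moreover have "h ` U \<subseteq> carrier N" using c mod_homD(1)[OF h] by blast
  ultimately show ?thesis unfolding N.submodule_iff by blast
qed

end

lemma mod_hom_inv: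
  assumes h: "h \<in> mod_hom A M N" "bij_betw h (carrier M) (carrier N)" and M: "left_module A M"
  shows "inv_into (carrier M) h \<in> mod_hom A N M"
proof -
  interpret left_module A M by (rule M)
  let ?g = "inv_into (carrier M) h"
  have g: "?g y \<in> carrier M" "h (?g y) = y" if "y \<in> carrier N" for y
    using that h(2) by (auto simp: bij_betw_def inv_into_into f_inv_into_f)
  have gh: "?g (h x) = x" if "x \<in> carrier M" for x
    using that h(2) by (simp add: bij_betw_def inv_into_f_f)
  show ?thesis
  proof (rule mod_homI)
    fix x y assume "x \<in> carrier N" "y \<in> carrier N"
    then show "?g (x \<oplus>\<^bsub>N\<^esub> y) = ?g x \<oplus>\<^bsub>M\<^esub> ?g y"
      using gh[of "?g x \<oplus>\<^bsub>M\<^esub> ?g y"] mod_homD(2)[OF h(1), of "?g x" "?g y"] g by simp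
  next
    fix a x assume "a \<in> carrier A" "x \<in> carrier N"
    then show "?g (a \<odot>\<^bsub>N\<^esub> x) = a \<odot>\<^bsub>M\<^esub> ?g x"
      using gh[of "a \<odot>\<^bsub>M\<^esub> ?g x"] mod_homD(3)[OF h(1), of a "?g x"] g by simp
  qed (rule g)
qed

primrec lincomb :: "('a, 'm) module \<Rightarrow> (nat \<Rightarrow> 'm) \<Rightarrow> nat \<Rightarrow> (nat \<Rightarrow> 'a) \<Rightarrow> 'm" where
  "lincomb M x 0 f = \<zero>\<^bsub>M\<^esub>"
| "lincomb M x (Suc m) f = lincomb M x m f \<oplus>\<^bsub>M\<^esub> f m \<odot>\<^bsub>M\<^esub> x m"

lemma free_module_simps [simp]:
  "carrier (free_module A n) = {..<n} \<rightarrow>\<^sub>E carrier A" "zero (free_module A n) = (\<lambda>i\<in>{..<n}. \<zero>\<^bsub>A\<^esub>)"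
  "add (free_module A n) f g = (\<lambda>i\<in>{..<n}. f i \<oplus>\<^bsub>A\<^esub> g i)" "a \<odot>\<^bsub>free_module A n\<^esub> f = (\<lambda>i\<in>{..<n}. a \<otimes>\<^bsub>A\<^esub> f i)"
  by (simp_all add: free_module_def)

lemma lincomb_mod_hom:
  fixes A :: "('k, 'a) module"
  assumes M: "left_module A M" and x: "\<And>i. i < n \<Longrightarrow> x i \<in> carrier M"
  shows "lincomb M x n \<in> mod_hom A (free_module A n) M"
proof -
  interpret left_module A M by (rule M)
  have cl: "lincomb M x m f \<in> carrier M" if "m \<le> n" "\<And>i. i < n \<Longrightarrow> f i \<in> carrier A" for m f
    using that by (induction m) (simp_all add: x)
  have add: "lincomb M x m (\<lambda>i\<in>{..<n}. f i \<oplus>\<^bsub>A\<^esub> g i) = lincomb M x m f \<oplus>\<^bsub>M\<^esub> lincomb M x m g"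
    if "m \<le> n" "\<And>i. i < n \<Longrightarrow> f i \<in> carrier A" "\<And>i. i < n \<Longrightarrow> g i \<in> carrier A" for m f g
    using that(1)
  proof (induction m)
    case (Suc m)
    then show ?case using cl[of m f] cl[of m g] that x[of m] by (simp add: smult_l_distr M.a_ac)
  qed simp
  have sm: "lincomb M x m (\<lambda>i\<in>{..<n}. a \<otimes>\<^bsub>A\<^esub> f i) = a \<odot>\<^bsub>M\<^esub> lincomb M x m f"
    if "m \<le> n" "\<And>i. i < n \<Longrightarrow> f i \<in> carrier A" "a \<in> carrier A" for m f a
    using that(1)
  proof (induction m)
    case (Suc m)
    then show ?case using cl[of m f] that x[of m] by (simp add: smult_r_distr smult_assoc1)
  qed (use that in simp)
  show ?thesis
  proof (rule mod_homI)
    fix f assume "f \<in> carrier (free_module A n)"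
    then show "lincomb M x n f \<in> carrier M" using cl[of n f] by auto
  next
    fix f g assume "f \<in> carrier (free_module A n)" "g \<in> carrier (free_module A n)"
    then show "lincomb M x n (f \<oplus>\<^bsub>free_module A n\<^esub> g) = lincomb M x n f \<oplus>\<^bsub>M\<^esub> lincomb M x n g"
      using add[of n f g] by (auto simp: PiE_iff)
  next
    fix a f assume "a \<in> carrier A" "f \<in> carrier (free_module A n)"
    then show "lincomb M x n (a \<odot>\<^bsub>free_module A n\<^esub> f) = a \<odot>\<^bsub>M\<^esub> lincomb M x n f"
      using sm[of n f a] by (auto simp: PiE_iff)
  qed
qed

definition unit_vec :: "('k, 'a) module \<Rightarrow> nat \<Rightarrow> nat \<Rightarrow> nat \<Rightarrow> 'a" where
  "unit_vec A n i = (\<lambda>j\<in>{..<n}. if j = i then \<one>\<^bsub>A\<^esub> else \<zero>\<^bsub>A\<^esub>)"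

lemma mod_hom_free_eq_lincomb:
  fixes A :: "('k, 'a) module"
  assumes M: "left_module A M" and h: "h \<in> mod_hom A (free_module A n) M" and f: "f \<in> carrier (free_module A n)"
  shows "h f = lincomb M (\<lambda>i. h (unit_vec A n i)) n f"
proof -
  interpret left_module A M by (rule M)
  \<comment> \<open>Truncations of \<open>f\<close> to its first \<open>m\<close> coordinates; each
    step adds one multiple of a unit vector.\<close>
  define tr where "tr m = (\<lambda>i\<in>{..<n}. if i < m then f i else \<zero>\<^bsub>A\<^esub>)" for m
  have fc: "f i \<in> carrier A" if "i < n" for i using f that by auto
  have uc: "unit_vec A n i \<in> carrier (free_module A n)" for i unfolding unit_vec_def by auto
  have tc: "tr m \<in> carrier (free_module A n)" for m unfolding tr_def using fc by auto
  have "h (tr m) = lincomb M (\<lambda>i. h (unit_vec A n i)) m f" if "m \<le> n" for m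
    using that
  proof (induction m)
    case 0
    have "tr 0 = \<zero>\<^bsub>A\<^esub> \<odot>\<^bsub>free_module A n\<^esub> tr 0" unfolding tr_def by (auto simp: fun_eq_iff)
    then have "h (tr 0) = \<zero>\<^bsub>A\<^esub> \<odot>\<^bsub>M\<^esub> h (tr 0)" using mod_homD(3)[OF h R.zero_closed tc] by metis
    then show ?case using mod_homD(1)[OF h tc] by simp
  next
    case (Suc m)
    have "tr (Suc m) = tr m \<oplus>\<^bsub>free_module A n\<^esub> (f m \<odot>\<^bsub>free_module A n\<^esub> unit_vec A n m)"
      unfolding tr_def unit_vec_def using fc Suc.prems by (auto simp: fun_eq_iff less_Suc_eq)
    moreover have fu: "f m \<odot>\<^bsub>free_module A n\<^esub> unit_vec A n m \<in> carrier (free_module A n)"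
      unfolding unit_vec_def using fc Suc.prems by auto
    ultimately have "h (tr (Suc m)) = h (tr m) \<oplus>\<^bsub>M\<^esub> h (f m \<odot>\<^bsub>free_module A n\<^esub> unit_vec A n m)"
      using mod_homD(2)[OF h tc fu] by metis
    also have "h (f m \<odot>\<^bsub>free_module A n\<^esub> unit_vec A n m) = f m \<odot>\<^bsub>M\<^esub> h (unit_vec A n m)"
      using mod_homD(3)[OF h fc uc] Suc.prems by simp
    finally have "h (tr (Suc m)) = h (tr m) \<oplus>\<^bsub>M\<^esub> f m \<odot>\<^bsub>M\<^esub> h (unit_vec A n m)" .
    then show ?case using Suc by simp
  qed
  moreover have "tr n = f" unfolding tr_def using f by (auto simp: fun_eq_iff PiE_iff extensional_def)
  ultimately show ?thesis by (metis order_refl)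
qed

text \<open>The images of the unit vectors of the ambient free module are lifted, extended linearly,
  and restricted along the embedding of the summand.\<close>

lemma projective_lift:
  fixes A :: "('k, 'a) module" and P :: "('a, 'p) module" and X :: "('a, 'x) module" and Y :: "('a, 'y) module"
  assumes P: "projective_module A P" and lm: "left_module A X" "left_module A Y"
    and g: "g \<in> mod_hom A X Y" "g ` carrier X = carrier Y" and h: "h \<in> mod_hom A P Y"
  shows "\<exists>u\<in>mod_hom A P X. \<forall>p\<in>carrier P. g (u p) = h p"
proof -
  obtain n s r where s: "s \<in> mod_hom A P (free_module A n)" and r: "r \<in> mod_hom A (free_module A n) P"
    and rs: "\<And>x. x \<in> carrier P \<Longrightarrow> r (s x) = x" using P unfolding projective_module_def by blast
  interpret X: left_module A X by (rule lm(1))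
  have uc: "unit_vec A n i \<in> carrier (free_module A n)" for i unfolding unit_vec_def by auto
  note hr = mod_hom_comp[OF r h]
  have "\<exists>x\<in>carrier X. g x = h (r (unit_vec A n i))" for i
    using mod_homD(1)[OF hr uc, of i] g(2) by (metis imageE)
  then obtain x where x: "\<And>i. x i \<in> carrier X" "\<And>i. g (x i) = h (r (unit_vec A n i))" by metis
  have L: "lincomb X x n \<in> mod_hom A (free_module A n) X" using lincomb_mod_hom[OF lm(1)] x(1) by blast
  note gL = mod_hom_comp[OF L g(1)]
  have gl: "g (lincomb X x m f) = lincomb Y (\<lambda>i. h (r (unit_vec A n i))) m f"
    if "m \<le> n" "\<And>i. i < n \<Longrightarrow> f i \<in> carrier A" for m f
    using that(1)
  proof (induction m)
    case 0
    then show ?case using mod_hom_zero[OF lm g(1)] by simp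
  next
    case (Suc m)
    have "lincomb X x k f \<in> carrier X" if "k \<le> m" for k
      using that Suc.prems \<open>\<And>i. i < n \<Longrightarrow> f i \<in> carrier A\<close> by (induction k) (simp_all add: x(1))
    then show ?case using Suc \<open>\<And>i. i < n \<Longrightarrow> f i \<in> carrier A\<close>[of m] x
      by (simp add: mod_homD(2,3)[OF g(1)])
  qed
  have "g (lincomb X x n (s p)) = h p" if p: "p \<in> carrier P" for p
  proof -
    have sp: "s p \<in> carrier (free_module A n)" using mod_homD(1)[OF s p] .
    have "h p = h (r (s p))" using rs[OF p] by simp
    also have "\<dots> = lincomb Y (\<lambda>i. h (r (unit_vec A n i))) n (s p)"
      using mod_hom_free_eq_lincomb[OF lm(2) hr sp] .
    also have "\<dots> = g (lincomb X x n (s p))" using gl[of n "s p"] sp by (simp add: PiE_iff)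
    finally show ?thesis by simp
  qed
  then show ?thesis by (intro bexI[OF _ mod_hom_comp[OF s L]]) simp
qed

lemma superfluousD:
  "\<lbrakk>superfluous A M K; submodule U A M; \<And>x. x \<in> carrier M \<Longrightarrow> \<exists>u\<in>U. \<exists>k\<in>K. x = u \<oplus>\<^bsub>M\<^esub> k; K \<subseteq> carrier M; left_module A M\<rbrakk>
    \<Longrightarrow> U = carrier M"
proof -
  assume s: "superfluous A M K" and U: "submodule U A M" and gen: "\<And>x. x \<in> carrier M \<Longrightarrow> \<exists>u\<in>U. \<exists>k\<in>K. x = u \<oplus>\<^bsub>M\<^esub> k"
    and K: "K \<subseteq> carrier M" and M: "left_module A M"
  interpret left_module A M by (rule M)
  have "U \<subseteq> carrier M" using U unfolding submodule_iff by blast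
  then have "U <+>\<^bsub>M\<^esub> K = carrier M" unfolding set_add_def' using gen K by (auto simp: subset_iff)
  then show ?thesis using s U unfolding superfluous_def by blast
qed

lemma projective_cover_unique:
  fixes A :: "('k, 'a) module" and P :: "('a, 'p) module" and P' :: "('a, 'q) module" and M :: "('a, 'm) module"
  assumes lm: "left_module A P" "left_module A P'" "left_module A M"
    and P: "projective_module A P" "h \<in> mod_hom A P M" "h ` carrier P = carrier M" "superfluous A P (a_kernel P M h)"
    and P': "projective_module A P'" "h' \<in> mod_hom A P' M" "h' ` carrier P' = carrier M" "superfluous A P' (a_kernel P' M h')"
  shows "\<exists>u\<in>mod_hom A P P'. bij_betw u (carrier P) (carrier P') \<and> (\<forall>p\<in>carrier P. h' (u p) = h p)"
proof -
  interpret P: left_module A P by (rule lm(1))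
  interpret P': left_module A P' by (rule lm(2))
  interpret M: left_module A M by (rule lm(3))
  obtain u where u: "u \<in> mod_hom A P P'" "\<And>p. p \<in> carrier P \<Longrightarrow> h' (u p) = h p"
    using projective_lift[OF P(1) lm(2,3) P'(2,3) P(2)] by blast
  have "u ` carrier P = carrier P'"
  proof (rule superfluousD[OF P'(4) _ _ _ lm(2)])
    show "submodule (u ` carrier P) A P'" using submodule_mod_hom_image[OF lm(1,2) u(1) P.submodule_carrier] .
    show "a_kernel P' M h' \<subseteq> carrier P'" by (auto simp: a_kernel_def kernel_def)
    fix x assume x: "x \<in> carrier P'"
    then have "h' x \<in> h ` carrier P" using mod_homD(1)[OF P'(2)] P(3) by simp
    then obtain p where p: "p \<in> carrier P" "h' x = h p" by blast
    have up: "u p \<in> carrier P'" using mod_homD(1)[OF u(1) p(1)] .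
    have "h' (x \<ominus>\<^bsub>P'\<^esub> u p) = \<zero>\<^bsub>M\<^esub>"
      using mod_hom_diff[OF lm(2,3) P'(2) x up] p u(2) M.diff_eq_zero_iff mod_homD(1)[OF P(2)] by simp
    then have "x \<ominus>\<^bsub>P'\<^esub> u p \<in> a_kernel P' M h'" using x up by (simp add: a_kernel_def kernel_def)
    moreover have "x = u p \<oplus>\<^bsub>P'\<^esub> (x \<ominus>\<^bsub>P'\<^esub> u p)"
      using x up by (simp add: a_minus_def P'.M.a_lcomm P'.M.r_neg)
    ultimately show "\<exists>y\<in>u ` carrier P. \<exists>k\<in>a_kernel P' M h'. x = y \<oplus>\<^bsub>P'\<^esub> k" using p(1) by blast
  qed
  note us = this
  have "(\<lambda>x. x) \<in> mod_hom A P' P'" by (rule mod_homI) simp_all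
  then obtain s where s: "s \<in> mod_hom A P' P" "\<And>x. x \<in> carrier P' \<Longrightarrow> u (s x) = x"
    using projective_lift[OF P'(1) lm(1,2) u(1) us] by blast
  have ss: "s ` carrier P' = carrier P"
  proof (rule superfluousD[OF P(4) _ _ _ lm(1)])
    show "submodule (s ` carrier P') A P" using submodule_mod_hom_image[OF lm(2,1) s(1) P'.submodule_carrier] .
    show "a_kernel P M h \<subseteq> carrier P" by (auto simp: a_kernel_def kernel_def)
    fix x assume x: "x \<in> carrier P"
    have ux: "u x \<in> carrier P'" using mod_homD(1)[OF u(1) x] .
    have sx: "s (u x) \<in> carrier P" using mod_homD(1)[OF s(1) ux] .
    have "h (s (u x)) = h x" using u(2)[OF sx] u(2)[OF x] s(2)[OF ux] by simp
    then have "h (x \<ominus>\<^bsub>P\<^esub> s (u x)) = \<zero>\<^bsub>M\<^esub>"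
      using mod_hom_diff[OF lm(1,3) P(2) x sx] M.diff_eq_zero_iff mod_homD(1)[OF P(2)] x by simp
    then have "x \<ominus>\<^bsub>P\<^esub> s (u x) \<in> a_kernel P M h" using x sx by (simp add: a_kernel_def kernel_def)
    moreover have "x = s (u x) \<oplus>\<^bsub>P\<^esub> (x \<ominus>\<^bsub>P\<^esub> s (u x))"
      using x sx by (simp add: a_minus_def P.M.a_lcomm P.M.r_neg)
    ultimately show "\<exists>y\<in>s ` carrier P'. \<exists>k\<in>a_kernel P M h. x = y \<oplus>\<^bsub>P\<^esub> k" using ux by blast
  qed
  have "inj_on u (carrier P)"
  proof (rule inj_onI)
    fix x y assume "x \<in> carrier P" "y \<in> carrier P" and e: "u x = u y"
    then obtain x' y' where "x = s x'" "x' \<in> carrier P'" "y = s y'" "y' \<in> carrier P'" using ss by blast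
    then show "x = y" using s(2) e by metis
  qed
  then show ?thesis using u us unfolding bij_betw_def by blast
qed


section \<open>The inverse Auslander--Reiten translate\<close>

definition pairing :: "nat \<Rightarrow> 'k::field poly \<Rightarrow> 'k poly \<Rightarrow> 'k" where
  "pairing n f g = (\<Sum>i<n. coeff f i * coeff g i)"

lemma pairing_add_left: "pairing n (f + g) h = pairing n f h + pairing n g h"
  by (simp add: pairing_def distrib_right sum.distrib)

lemma pairing_add_right: "pairing n f (g + h) = pairing n f g + pairing n f h"
  by (simp add: pairing_def distrib_left sum.distrib)

lemma pairing_smult_left: "pairing n (e *s f) g = e * pairing n f g"
  by (simp add: pairing_def sum_distrib_left mult.assoc)

lemma pairing_smult_right: "pairing n f (e *s g) = e * pairing n f g"
  by (simp add: pairing_def sum_distrib_left mult.left_commute)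

lemma pairing_0 [simp]: "pairing n 0 g = 0" "pairing n f 0 = 0"
  by (simp_all add: pairing_def)

lemma pairing_diff_right: "pairing n f (g - h) = pairing n f g - pairing n f h"
  by (simp add: pairing_def right_diff_distrib sum_subtractf)

lemma pairing_monom:
  assumes "i < n"
  shows "pairing n (monom 1 i) g = coeff g i" "pairing n g (monom 1 i) = coeff g i"
  using assms by (simp_all add: pairing_def if_distrib[of "\<lambda>x. x * _"] if_distrib[of "\<lambda>x. _ * x"] sum.delta' cong: if_cong)

lemmas pairing_simps = pairing_add_left pairing_add_right pairing_smult_left pairing_smult_right pairing_diff_right

definition poly_of :: "nat \<Rightarrow> (nat \<Rightarrow> 'k::field) \<Rightarrow> 'k poly" where
  "poly_of n g = (\<Sum>i<n. monom (g i) i)"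

lemma coeff_poly_of: "coeff (poly_of n g) i = (if i < n then g i else 0)"
  by (auto simp: poly_of_def coeff_sum if_distrib cong: if_cong)

lemma poly_of_mem [simp]: "poly_of n g \<in> kn n"
  by (simp add: kn_def coeff_poly_of)

lemma poly_of_add: "poly_of n (\<lambda>i. g i + h i) = poly_of n g + poly_of n h"
  by (simp add: poly_eq_iff coeff_poly_of)

lemma poly_of_smult: "poly_of n (\<lambda>i. e * g i) = e *s poly_of n g"
  by (simp add: poly_eq_iff coeff_poly_of)

text \<open>The transposed matrix with respect to the monomial bases.\<close>

definition adjoint :: "nat \<Rightarrow> nat \<Rightarrow> ('k::field poly \<Rightarrow> 'k poly) \<Rightarrow> 'k poly \<Rightarrow> 'k poly" where
  "adjoint n m L f = poly_of n (\<lambda>i. pairing m f (L (monom 1 i)))"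

lemma adjoint_mem [simp]: "adjoint n m L f \<in> kn n"
  by (simp add: adjoint_def)

lemma adjoint_add: "adjoint n m L (f + g) = adjoint n m L f + adjoint n m L g"
  by (simp add: adjoint_def pairing_add_left poly_of_add)

lemma adjoint_smult: "adjoint n m L (e *s f) = e *s adjoint n m L f"
  by (simp add: adjoint_def pairing_smult_left poly_of_smult)

lemma pairing_adjoint:
  assumes L: "lin_on n m L" and g: "g \<in> kn n"
  shows "pairing n (adjoint n m L f) g = pairing m f (L g)"
  using g
proof (induction rule: kn_induct)
  case zero
  then show ?case using lin_on_0[OF L] by simp
next
  case (add g c i)
  have m: "monom 1 i \<in> kn n" using add.hyps(2) by simp
  have "pairing n (adjoint n m L f) (monom 1 i) = pairing m f (L (monom 1 i))"
    using add.hyps(2) by (simp add: pairing_monom adjoint_def coeff_poly_of)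
  then show ?case using add lin_onD(3)[OF L add.hyps(1) kn_closed(5)[OF m]] lin_onD(2)[OF L m]
    by (simp add: pairing_simps)
qed

lemma opp_simps [simp]:
  "carrier (opp A) = carrier A" "one (opp A) = one A" "zero (opp A) = zero A" "add (opp A) = add A"
  "module.smult (opp A) = module.smult A" "a \<otimes>\<^bsub>opp A\<^esub> b = b \<otimes>\<^bsub>A\<^esub> a" "opp (opp A) = A"
  by (simp_all add: opp_def)

lemma scalar_opp [simp]: "scalar (opp A) = scalar A"
  by (simp add: fun_eq_iff scalar_def)

lemma dual_module_simps [simp]:
  "zero (dual_module A M) = (\<lambda>x\<in>carrier M. 0)" "add (dual_module A M) \<phi> \<psi> = (\<lambda>x\<in>carrier M. \<phi> x + \<psi> x)"
  "a \<odot>\<^bsub>dual_module A M\<^esub> \<phi> = (\<lambda>x\<in>carrier M. \<phi> (a \<odot>\<^bsub>M\<^esub> x))"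
  by (simp_all add: dual_module_def)

lemma dual_module_carrier:
  "\<phi> \<in> carrier (dual_module A M) \<longleftrightarrow> \<phi> \<in> extensional (carrier M) \<and>
    (\<forall>x\<in>carrier M. \<forall>y\<in>carrier M. \<phi> (x \<oplus>\<^bsub>M\<^esub> y) = \<phi> x + \<phi> y) \<and>
    (\<forall>c. \<forall>x\<in>carrier M. \<phi> (scalar A c \<odot>\<^bsub>M\<^esub> x) = c * \<phi> x)"
  by (simp add: dual_module_def)

lemma left_module_dual_module:
  fixes M :: "(kronecker_vertex \<times> nat list \<Rightarrow> 'k::field, 'm) module"
  assumes "ring (opp K3 :: ('k, _) module)" and M: "left_module K3 M"
  shows "left_module (opp K3) (dual_module K3 M)"
proof -
  interpret left_module K3 M by (rule M)
  let ?D = "dual_module K3 M"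
  have cl: "(\<lambda>x\<in>carrier M. \<phi> x + \<psi> x) \<in> carrier ?D" if "\<phi> \<in> carrier ?D" "\<psi> \<in> carrier ?D" for \<phi> \<psi>
    using that by (simp add: dual_module_carrier distrib_left)
  have "abelian_group ?D"
  proof (intro abelian_groupI)
    fix \<phi> assume p: "\<phi> \<in> carrier ?D"
    show "\<exists>\<psi>\<in>carrier ?D. \<psi> \<oplus>\<^bsub>?D\<^esub> \<phi> = \<zero>\<^bsub>?D\<^esub>"
      by (rule bexI[of _ "\<lambda>x\<in>carrier M. - \<phi> x"]) (use p in \<open>auto simp: dual_module_carrier fun_eq_iff\<close>)
    show "\<zero>\<^bsub>?D\<^esub> \<oplus>\<^bsub>?D\<^esub> \<phi> = \<phi>" using p by (auto simp: dual_module_carrier extensional_def fun_eq_iff)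
  next
    fix \<phi> \<psi> assume "\<phi> \<in> carrier ?D" "\<psi> \<in> carrier ?D"
    then show "\<phi> \<oplus>\<^bsub>?D\<^esub> \<psi> \<in> carrier ?D" using cl by simp
  next
    show "\<zero>\<^bsub>?D\<^esub> \<in> carrier ?D" by (simp add: dual_module_carrier)
  qed (auto simp: fun_eq_iff add.commute add.assoc)
  moreover have "left_module_axioms (opp K3) ?D"
  proof (rule left_module_axioms.intro)
    fix a :: "kronecker_vertex \<times> nat list \<Rightarrow> 'k" and \<phi> assume a: "a \<in> carrier (opp K3)" and p: "\<phi> \<in> carrier ?D"
    \<comment> \<open>Scalars are central in the path algebra, so composing a linear form with the
      action of \<open>a\<close> gives a linear form again.\<close>
    have sa: "a \<odot>\<^bsub>M\<^esub> (scalar K3 e \<odot>\<^bsub>M\<^esub> x) = scalar K3 e \<odot>\<^bsub>M\<^esub> (a \<odot>\<^bsub>M\<^esub> x)" if "x \<in> carrier M" for e x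
    proof -
      obtain p q r s t where "a = pathalg_elem p q r s t" using a by (auto elim: pathalg_elem_cases)
      then have "a \<otimes>\<^bsub>K3\<^esub> scalar K3 e = scalar K3 e \<otimes>\<^bsub>K3\<^esub> a" by (simp add: scalar_K3 mult.commute)
      then show ?thesis using smult_assoc1[of a "scalar K3 e" x] smult_assoc1[of "scalar K3 e" a x] a that by simp
    qed
    show "a \<odot>\<^bsub>?D\<^esub> \<phi> \<in> carrier ?D"
      using a p by (simp add: dual_module_carrier smult_r_distr sa)
    fix b :: "kronecker_vertex \<times> nat list \<Rightarrow> 'k" assume b: "b \<in> carrier (opp K3)"
    show "(a \<oplus>\<^bsub>opp K3\<^esub> b) \<odot>\<^bsub>?D\<^esub> \<phi> = a \<odot>\<^bsub>?D\<^esub> \<phi> \<oplus>\<^bsub>?D\<^esub> b \<odot>\<^bsub>?D\<^esub> \<phi>"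
      using a b p by (auto simp: dual_module_carrier fun_eq_iff smult_l_distr)
    show "(a \<otimes>\<^bsub>opp K3\<^esub> b) \<odot>\<^bsub>?D\<^esub> \<phi> = a \<odot>\<^bsub>?D\<^esub> (b \<odot>\<^bsub>?D\<^esub> \<phi>)"
      using a b p by (auto simp: fun_eq_iff smult_assoc1)
  next
    fix a :: "kronecker_vertex \<times> nat list \<Rightarrow> 'k" and \<phi> \<psi>
    assume "a \<in> carrier (opp K3)" "\<phi> \<in> carrier ?D" "\<psi> \<in> carrier ?D"
    then show "a \<odot>\<^bsub>?D\<^esub> (\<phi> \<oplus>\<^bsub>?D\<^esub> \<psi>) = a \<odot>\<^bsub>?D\<^esub> \<phi> \<oplus>\<^bsub>?D\<^esub> a \<odot>\<^bsub>?D\<^esub> \<psi>"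
      by (auto simp: fun_eq_iff)
  next
    fix \<phi> assume "\<phi> \<in> carrier ?D"
    then show "\<one>\<^bsub>opp K3\<^esub> \<odot>\<^bsub>?D\<^esub> \<phi> = \<phi>" by (auto simp: dual_module_carrier fun_eq_iff extensional_def)
  qed
  ultimately show ?thesis using assms(1) by (simp add: left_module.intro)
qed

text \<open>The right modules \<open>(e\<^sub>y \<Lambda>\<^sub>3)\<^sup>n\<close> and \<open>(e\<^sub>x \<Lambda>\<^sub>3)\<^sup>n\<close>. Exchanging the coefficients of \<open>e\<^sub>x\<close> and \<open>e\<^sub>y\<close> is an
  anti-automorphism of \<open>\<Lambda>\<^sub>3\<close>.\<close>

definition anti :: "(kronecker_vertex \<times> nat list \<Rightarrow> 'k::field) \<Rightarrow> kronecker_vertex \<times> nat list \<Rightarrow> 'k" where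
  "anti a = pathalg_elem (a (VY, [])) (a (VX, [])) (a (VX, [0])) (a (VX, [1])) (a (VX, [2]))"

lemma anti_pathalg_elem [simp]: "anti (pathalg_elem p q a b c) = pathalg_elem q p a b c"
  by (simp add: anti_def)

definition right_proj_y :: "nat \<Rightarrow> (kronecker_vertex \<times> nat list \<Rightarrow> 'k::field, 'k poly \<times> 'k triple) module" where
  "right_proj_y n = \<lparr>carrier = kn n \<times> kn3 n, mult = undefined, one = undefined, zero = 0, add = (+), smult = (\<lambda>a. act (anti a))\<rparr>"

text \<open>The only path ending at the source is trivial, so this right module is semisimple and
  only the coefficient of that path acts.\<close>

definition right_proj_x :: "nat \<Rightarrow> (kronecker_vertex \<times> nat list \<Rightarrow> 'k::field, 'k poly) module" where
  "right_proj_x n = \<lparr>carrier = kn n, mult = undefined, one = undefined, zero = 0, add = (+), smult = (\<lambda>a f. a (VX, []) *s f)\<rparr>"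

lemma right_proj_simps [simp]:
  "carrier (right_proj_y n) = kn n \<times> kn3 n" "zero (right_proj_y n) = 0" "add (right_proj_y n) = (+)"
  "a \<odot>\<^bsub>right_proj_y n\<^esub> q = act (anti a) q"
  "carrier (right_proj_x n) = kn n" "zero (right_proj_x n) = 0" "add (right_proj_x n) = (+)"
  "a \<odot>\<^bsub>right_proj_x n\<^esub> f = a (VX, []) *s f"
  by (simp_all add: right_proj_y_def right_proj_x_def)

text \<open>The axioms are those of \<open>proj_x n\<close>, read through the anti-automorphism
  \<open>anti\<close>.\<close>

lemma left_module_right_proj_y:
  assumes op: "ring (opp K3 :: ('k::field, _) module)" and K3: "ring (K3 :: ('k, _) module)"
  shows "left_module (opp K3) (right_proj_y n :: (_, 'k poly \<times> 'k triple) module)"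
proof -
  interpret F: left_module "K3 :: ('k, _) module" "proj_x n :: (_, 'k poly \<times> 'k triple) module"
    by (rule left_module_proj_x[OF K3])
  have "abelian_group (right_proj_y n :: (_, 'k poly \<times> 'k triple) module)"
  proof (intro abelian_groupI)
    fix x :: "'k poly \<times> 'k triple" assume "x \<in> carrier (right_proj_y n)"
    then show "\<exists>y\<in>carrier (right_proj_y n). y \<oplus>\<^bsub>right_proj_y n\<^esub> x = \<zero>\<^bsub>right_proj_y n\<^esub>"
      by (intro bexI[of _ "- x"]) (auto simp: kn3_def)
  qed (auto simp: kn3_def zero_prod_def add.assoc add.commute)
  moreover have "left_module_axioms (opp K3) (right_proj_y n :: (_, 'k poly \<times> 'k triple) module)"
  proof (rule left_module_axioms.intro)
    fix a b :: "kronecker_vertex \<times> nat list \<Rightarrow> 'k" and x :: "'k poly \<times> 'k triple"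
    assume ab: "a \<in> carrier (opp K3)" "b \<in> carrier (opp K3)" and x: "x \<in> carrier (right_proj_y n)"
    obtain a0 a1 a2 a3 a4 where a: "a = pathalg_elem a0 a1 a2 a3 a4" using ab(1) by (auto elim: pathalg_elem_cases)
    obtain b0 b1 b2 b3 b4 where b: "b = pathalg_elem b0 b1 b2 b3 b4" using ab(2) by (auto elim: pathalg_elem_cases)
    show "(a \<oplus>\<^bsub>opp K3\<^esub> b) \<odot>\<^bsub>right_proj_y n\<^esub> x = a \<odot>\<^bsub>right_proj_y n\<^esub> x \<oplus>\<^bsub>right_proj_y n\<^esub> b \<odot>\<^bsub>right_proj_y n\<^esub> x"
      using F.smult_l_distr[of "anti a" "anti b" x] x by (simp add: a b)
    show "(a \<otimes>\<^bsub>opp K3\<^esub> b) \<odot>\<^bsub>right_proj_y n\<^esub> x = a \<odot>\<^bsub>right_proj_y n\<^esub> (b \<odot>\<^bsub>right_proj_y n\<^esub> x)"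
      using F.smult_assoc1[of "anti a" "anti b" x] x by (simp add: a b algebra_simps)
  next
    fix a :: "kronecker_vertex \<times> nat list \<Rightarrow> 'k" and x y :: "'k poly \<times> 'k triple"
    assume "a \<in> carrier (opp K3)" "x \<in> carrier (right_proj_y n)" "y \<in> carrier (right_proj_y n)"
    then show "a \<odot>\<^bsub>right_proj_y n\<^esub> (x \<oplus>\<^bsub>right_proj_y n\<^esub> y) = a \<odot>\<^bsub>right_proj_y n\<^esub> x \<oplus>\<^bsub>right_proj_y n\<^esub> a \<odot>\<^bsub>right_proj_y n\<^esub> y"
      using F.smult_r_distr[of "anti a" x y] by (simp add: anti_def)
  next
    fix a :: "kronecker_vertex \<times> nat list \<Rightarrow> 'k" and x :: "'k poly \<times> 'k triple"
    assume "a \<in> carrier (opp K3)" "x \<in> carrier (right_proj_y n)"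
    then show "a \<odot>\<^bsub>right_proj_y n\<^esub> x \<in> carrier (right_proj_y n)" using act_closed by simp
  next
    fix x :: "'k poly \<times> 'k triple" assume "x \<in> carrier (right_proj_y n)"
    then show "\<one>\<^bsub>opp K3\<^esub> \<odot>\<^bsub>right_proj_y n\<^esub> x = x" by (cases x) (auto simp: pathalg_elem_one)
  qed
  ultimately show ?thesis using op by (simp add: left_module.intro)
qed

lemma left_module_right_proj_x:
  assumes op: "ring (opp K3 :: ('k::field, _) module)"
  shows "left_module (opp K3) (right_proj_x n :: (_, 'k poly) module)"
proof -
  have "abelian_group (right_proj_x n :: (_, 'k poly) module)"
  proof (intro abelian_groupI)
    fix x :: "'k poly" assume "x \<in> carrier (right_proj_x n)"
    then show "\<exists>y\<in>carrier (right_proj_x n). y \<oplus>\<^bsub>right_proj_x n\<^esub> x = \<zero>\<^bsub>right_proj_x n\<^esub>"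
      by (intro bexI[of _ "- x"]) simp_all
  qed (auto simp: add.assoc add.commute)
  moreover have "left_module_axioms (opp K3) (right_proj_x n :: (_, 'k poly) module)"
    by (rule left_module_axioms.intro)
      (auto elim!: pathalg_elem_cases simp: pathalg_elem_one smult_add_left smult_add_right mult.commute)
  ultimately show ?thesis using op by (simp add: left_module.intro)
qed

text \<open>A direct summand of a free right module: \<open>s\<close> fills in the missing
  coefficient of the trivial path at the source by 0, and \<open>r\<close> forgets it.\<close>

lemma projective_right_proj_y: "projective_module (opp K3) (right_proj_y n :: (kronecker_vertex \<times> nat list \<Rightarrow> 'k::field, _) module)"
proof -
  define s where "s = (\<lambda>(y, u, v, w). \<lambda>i\<in>{..<n}. pathalg_elem (0::'k) (coeff y i) (coeff u i) (coeff v i) (coeff w i))"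
  define r where "r f = (poly_of n (\<lambda>i. f i (VY, [])), poly_of n (\<lambda>i. f i (VX, [0])), poly_of n (\<lambda>i. f i (VX, [1])), poly_of n (\<lambda>i. f i (VX, [2])))"
    for f :: "nat \<Rightarrow> kronecker_vertex \<times> nat list \<Rightarrow> 'k"
  have "s \<in> mod_hom (opp K3) (right_proj_y n) (free_module (opp K3) n)"
    by (rule mod_homI) (auto simp: s_def fun_eq_iff mult.commute add.commute elim!: pathalg_elem_cases)
  moreover have "r \<in> mod_hom (opp K3) (free_module (opp K3) n) (right_proj_y n)"
  proof (rule mod_homI)
    fix f :: "nat \<Rightarrow> kronecker_vertex \<times> nat list \<Rightarrow> 'k" assume "f \<in> carrier (free_module (opp K3) n)"
    then show "r f \<in> carrier (right_proj_y n)" by (simp add: r_def kn3_def)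
  next
    fix f g :: "nat \<Rightarrow> kronecker_vertex \<times> nat list \<Rightarrow> 'k"
    show "r (f \<oplus>\<^bsub>free_module (opp K3) n\<^esub> g) = r f \<oplus>\<^bsub>right_proj_y n\<^esub> r g"
      by (simp add: r_def poly_eq_iff coeff_poly_of path_algebra_def)
  next
    fix a :: "kronecker_vertex \<times> nat list \<Rightarrow> 'k" and f :: "nat \<Rightarrow> kronecker_vertex \<times> nat list \<Rightarrow> 'k"
    assume a: "a \<in> carrier (opp K3)" and f: "f \<in> carrier (free_module (opp K3) n)"
    obtain p q a' b' c' where ae: "a = pathalg_elem p q a' b' c'" using a by (auto elim: pathalg_elem_cases)
    have fa: "f i \<otimes>\<^bsub>K3\<^esub> a = pathalg_elem (f i (VX, []) * p) (f i (VY, []) * q) (f i (VX, [0]) * p + f i (VY, []) * a')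
      (f i (VX, [1]) * p + f i (VY, []) * b') (f i (VX, [2]) * p + f i (VY, []) * c')" if "i < n" for i
    proof -
      have "f i \<in> carrier K3" using f that by auto
      then have "f i = pathalg_elem (f i (VX, [])) (f i (VY, [])) (f i (VX, [0])) (f i (VX, [1])) (f i (VX, [2]))"
        unfolding carrier_K3 .
      then show ?thesis unfolding ae by (metis pathalg_elem_mult)
    qed
    show "r (a \<odot>\<^bsub>free_module (opp K3) n\<^esub> f) = a \<odot>\<^bsub>right_proj_y n\<^esub> r f"
      by (simp add: r_def ae poly_eq_iff coeff_poly_of fa[unfolded ae] algebra_simps)
  qed
  moreover have "r (s x) = x" if "x \<in> carrier (right_proj_y n)" for x
    using that by (cases x) (auto simp: r_def s_def kn3_def poly_eq_iff coeff_poly_of kn_def)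
  ultimately show ?thesis unfolding projective_module_def by blast
qed

lemma projective_right_proj_x: "projective_module (opp K3) (right_proj_x n :: (kronecker_vertex \<times> nat list \<Rightarrow> 'k::field, _) module)"
proof -
  define s where "s y = (\<lambda>i\<in>{..<n}. pathalg_elem (coeff y i) (0::'k) 0 0 0)" for y
  define r where "r f = poly_of n (\<lambda>i. f i (VX, []))" for f :: "nat \<Rightarrow> kronecker_vertex \<times> nat list \<Rightarrow> 'k"
  have "s \<in> mod_hom (opp K3) (right_proj_x n) (free_module (opp K3) n)"
    by (rule mod_homI) (auto simp: s_def fun_eq_iff mult.commute add.commute elim!: pathalg_elem_cases)
  moreover have "r \<in> mod_hom (opp K3) (free_module (opp K3) n) (right_proj_x n)"
  proof (rule mod_homI)
    fix a :: "kronecker_vertex \<times> nat list \<Rightarrow> 'k" and f :: "nat \<Rightarrow> kronecker_vertex \<times> nat list \<Rightarrow> 'k"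
    assume a: "a \<in> carrier (opp K3)" and f: "f \<in> carrier (free_module (opp K3) n)"
    have fa: "(f i \<otimes>\<^bsub>K3\<^esub> a) (VX, []) = f i (VX, []) * a (VX, [])" for i
      by (simp add: path_algebra_def pre_digraph.awalk_verts.simps)
    show "r (a \<odot>\<^bsub>free_module (opp K3) n\<^esub> f) = a \<odot>\<^bsub>right_proj_x n\<^esub> r f"
      by (simp add: r_def poly_eq_iff coeff_poly_of fa mult.commute)
  qed (simp_all add: r_def poly_eq_iff coeff_poly_of path_algebra_def)
  moreover have "r (s x) = x" if "x \<in> carrier (right_proj_x n)" for x
    using that by (auto simp: r_def s_def poly_eq_iff coeff_poly_of kn_def)
  ultimately show ?thesis unfolding projective_module_def by blast
qed


text \<open>\<open>M\<close> is the representation with the spaces \<open>k\<^sup>l\<close> and \<open>k\<^sup>n\<close> at the vertices \<open>x\<close> and \<open>y\<close> and with the arrows \<open>a, b, c\<close>.\<close>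

definition realizes ::
  "(kronecker_vertex \<times> nat list \<Rightarrow> 'k::field, 'm) module \<Rightarrow> nat \<Rightarrow> nat \<Rightarrow> ('k poly \<Rightarrow> 'k poly) \<Rightarrow> ('k poly \<Rightarrow> 'k poly) \<Rightarrow>
    ('k poly \<Rightarrow> 'k poly) \<Rightarrow> ('k poly \<times> 'k poly \<Rightarrow> 'm) \<Rightarrow> bool" where
  "realizes M l n a b c \<Phi> \<longleftrightarrow> left_module K3 M \<and> bij_betw \<Phi> (kn l \<times> kn n) (carrier M) \<and>
    (\<forall>p\<in>kn l. \<forall>q\<in>kn n. \<forall>p'\<in>kn l. \<forall>q'\<in>kn n. \<Phi> (p + p', q + q') = \<Phi> (p, q) \<oplus>\<^bsub>M\<^esub> \<Phi> (p', q')) \<and>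
    (\<forall>x y r s t. \<forall>p\<in>kn l. \<forall>q\<in>kn n. pathalg_elem x y r s t \<odot>\<^bsub>M\<^esub> \<Phi> (p, q) =
      \<Phi> (x *s p, y *s q + (r *s a p + s *s b p + t *s c p)))"

text \<open>In the applications \<open>M\<close> is some \<open>P_i\<close> with arrows
  \<open>a, b, c\<close>, the primed arrows are those of \<open>P_(i+1)\<close>, and
  \<open>exact\<close> says that they compose to zero without further relations. The retraction
  \<open>\<rho>\<close> of \<open>c\<close> extends linear forms from the image of
  \<open>c\<close>.\<close>

locale tau_link = A: arrows l n a b c + B: exact_arrows n d a' b' c'
  for l n d :: nat and a b c a' b' c' :: "'k::field poly \<Rightarrow> 'k poly" +
  fixes \<rho> :: "'k poly \<Rightarrow> 'k poly"
    and M :: "(kronecker_vertex \<times> nat list \<Rightarrow> 'k, 'm) module" and \<Phi>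
  assumes exact: "B.sum_rel 0 = A.rel 0 {}"
    and \<rho>: "lin_on n l \<rho>" "\<And>p. p \<in> kn l \<Longrightarrow> \<rho> (c p) = p"
    and real: "realizes M l n a b c \<Phi>"
    and ring_opp: "ring (opp K3 :: ('k, _) module)"
begin

lemma lmM: "left_module K3 M"
  using real unfolding realizes_def by blast

interpretation M: left_module K3 M by (rule lmM)

definition \<pi> :: "'m \<Rightarrow> 'k poly \<times> 'k poly" where "\<pi> = inv_into (kn l \<times> kn n) \<Phi>"

lemma \<pi>_\<Phi>: "\<lbrakk>p \<in> kn l; q \<in> kn n\<rbrakk> \<Longrightarrow> \<pi> (\<Phi> (p, q)) = (p, q)"
  using real unfolding realizes_def \<pi>_def bij_betw_def by (simp add: inv_into_f_f)

lemma \<Phi>_closed: "\<lbrakk>p \<in> kn l; q \<in> kn n\<rbrakk> \<Longrightarrow> \<Phi> (p, q) \<in> carrier M"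
  using real unfolding realizes_def bij_betw_def by blast

lemma \<Phi>_cases:
  assumes "m \<in> carrier M"
  obtains p q where "m = \<Phi> (p, q)" "p \<in> kn l" "q \<in> kn n"
  using assms real unfolding realizes_def bij_betw_def by blast

lemma \<Phi>_add: "\<lbrakk>p \<in> kn l; q \<in> kn n; p' \<in> kn l; q' \<in> kn n\<rbrakk> \<Longrightarrow> \<Phi> (p, q) \<oplus>\<^bsub>M\<^esub> \<Phi> (p', q') = \<Phi> (p + p', q + q')"
  using real unfolding realizes_def by simp

lemma \<Phi>_smult: "\<lbrakk>p \<in> kn l; q \<in> kn n\<rbrakk> \<Longrightarrow>
    pathalg_elem x y r s t \<odot>\<^bsub>M\<^esub> \<Phi> (p, q) = \<Phi> (x *s p, y *s q + (r *s a p + s *s b p + t *s c p))"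
  using real unfolding realizes_def by simp

lemma abc_closed: "p \<in> kn l \<Longrightarrow> a p \<in> kn n" "p \<in> kn l \<Longrightarrow> b p \<in> kn n" "p \<in> kn l \<Longrightarrow> c p \<in> kn n"
  using lin_onD(1)[OF A.a] lin_onD(1)[OF A.b] lin_onD(1)[OF A.c] by simp_all

section \<open>The minimal projective presentation of the dual module\<close>

abbreviation DM where "DM \<equiv> dual_module K3 M"
abbreviation P0 :: "(kronecker_vertex \<times> nat list \<Rightarrow> 'k, 'k poly \<times> 'k triple) module" where "P0 \<equiv> right_proj_y n"
abbreviation P1 :: "(kronecker_vertex \<times> nat list \<Rightarrow> 'k, 'k poly) module" where "P1 \<equiv> right_proj_x d"

lemma lmD: "left_module (opp K3) DM"
  using left_module_dual_module[OF ring_opp lmM] .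

lemma lmP0: "left_module (opp K3) P0"
  using left_module_right_proj_y[OF ring_opp M.R.ring_axioms] .

lemma lmP1: "left_module (opp K3) P1"
  using left_module_right_proj_x[OF ring_opp] .

text \<open>The projective cover of the dual: a generator is sent to a coordinate form at the sink,
  and multiplying it by an arrow composes this form with the corresponding map of
  \<open>M\<close>.\<close>

definition gval :: "'k poly \<times> 'k triple \<Rightarrow> 'k poly \<times> 'k poly \<Rightarrow> 'k" where
  "gval = (\<lambda>(y, u, v, w) (p, q). pairing n y q + (pairing n u (a p) + pairing n v (b p) + pairing n w (c p)))"

definition g :: "'k poly \<times> 'k triple \<Rightarrow> 'm \<Rightarrow> 'k" where
  "g z = (\<lambda>m\<in>carrier M. gval z (\<pi> m))"

lemma g_\<Phi>: "\<lbrakk>p \<in> kn l; q \<in> kn n\<rbrakk> \<Longrightarrow>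
    g (y, u, v, w) (\<Phi> (p, q)) = pairing n y q + (pairing n u (a p) + pairing n v (b p) + pairing n w (c p))"
  by (simp add: g_def \<Phi>_closed \<pi>_\<Phi> gval_def)

lemma g_ext: "g z \<in> extensional (carrier M)"
  by (simp add: g_def)

lemma ext_M_eqI:
  assumes "\<phi> \<in> extensional (carrier M)" "\<psi> \<in> extensional (carrier M)"
    "\<And>p q. \<lbrakk>p \<in> kn l; q \<in> kn n\<rbrakk> \<Longrightarrow> \<phi> (\<Phi> (p, q)) = \<psi> (\<Phi> (p, q))"
  shows "\<phi> = \<psi>"
proof (rule extensionalityI[OF assms(1,2)])
  fix m assume "m \<in> carrier M"
  then show "\<phi> m = \<psi> m" using assms(3) by (metis \<Phi>_cases)
qed

lemma g_mod_hom: "g \<in> mod_hom (opp K3) P0 DM"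
proof (rule mod_homI)
  fix z assume "z \<in> carrier P0"
  obtain y u v w where z: "z = (y, u, v, w)" by (cases z)
  show "g z \<in> carrier DM" unfolding dual_module_carrier z
  proof (intro conjI ballI allI g_ext)
    fix m m' assume "m \<in> carrier M" "m' \<in> carrier M"
    then obtain p q p' q' where m: "m = \<Phi> (p, q)" "p \<in> kn l" "q \<in> kn n" "m' = \<Phi> (p', q')" "p' \<in> kn l" "q' \<in> kn n"
      by (metis \<Phi>_cases)
    show "g (y, u, v, w) (m \<oplus>\<^bsub>M\<^esub> m') = g (y, u, v, w) m + g (y, u, v, w) m'"
      using m lin_onD(3)[OF A.a m(2,5)] lin_onD(3)[OF A.b m(2,5)] lin_onD(3)[OF A.c m(2,5)]
      by (simp add: \<Phi>_add g_\<Phi> pairing_simps)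
  next
    fix e m assume "m \<in> carrier M"
    then obtain p q where m: "m = \<Phi> (p, q)" "p \<in> kn l" "q \<in> kn n" by (metis \<Phi>_cases)
    show "g (y, u, v, w) (scalar K3 e \<odot>\<^bsub>M\<^esub> m) = e * g (y, u, v, w) m"
      using m lin_onD(2)[OF A.a m(2)] lin_onD(2)[OF A.b m(2)] lin_onD(2)[OF A.c m(2)]
      by (simp add: scalar_K3 \<Phi>_smult g_\<Phi> pairing_simps distrib_left)
  qed
next
  fix z z' :: "'k poly \<times> 'k triple"
  obtain y u v w where z: "z = (y, u, v, w)" by (cases z)
  obtain y' u' v' w' where z': "z' = (y', u', v', w')" by (cases z')
  show "g (z \<oplus>\<^bsub>P0\<^esub> z') = g z \<oplus>\<^bsub>DM\<^esub> g z'"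
    by (rule ext_M_eqI) (simp_all add: g_ext z z' g_\<Phi> \<Phi>_closed pairing_simps)
next
  fix e :: "kronecker_vertex \<times> nat list \<Rightarrow> 'k" and z :: "'k poly \<times> 'k triple" assume "e \<in> carrier (opp K3)"
  then obtain x t r1 r2 r3 where e: "e = pathalg_elem x t r1 r2 r3" by (auto elim: pathalg_elem_cases)
  obtain y u v w where z: "z = (y, u, v, w)" by (cases z)
  show "g (e \<odot>\<^bsub>P0\<^esub> z) = e \<odot>\<^bsub>DM\<^esub> g z"
  proof (rule ext_M_eqI)
    fix p q :: "'k poly" assume p: "p \<in> kn l" "q \<in> kn n"
    show "g (e \<odot>\<^bsub>P0\<^esub> z) (\<Phi> (p, q)) = (e \<odot>\<^bsub>DM\<^esub> g z) (\<Phi> (p, q))"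
      using p abc_closed[OF p(1)] lin_onD(2)[OF A.a p(1)] lin_onD(2)[OF A.b p(1)] lin_onD(2)[OF A.c p(1)]
      by (simp add: e z g_\<Phi> \<Phi>_closed \<Phi>_smult pairing_simps algebra_simps)
  qed (simp_all add: g_ext)
qed

lemma pairing_poly_of: "\<lbrakk>lin_on n m L; q \<in> kn n; \<And>f h. \<lbrakk>f \<in> kn n; h \<in> kn n\<rbrakk> \<Longrightarrow> F (f + h) = F f + F h;
    \<And>f e. f \<in> kn n \<Longrightarrow> F (e *s f) = e * F f\<rbrakk> \<Longrightarrow> pairing n (poly_of n (\<lambda>i. F (monom 1 i))) q = F q"
proof -
  assume F: "\<And>f h. \<lbrakk>f \<in> kn n; h \<in> kn n\<rbrakk> \<Longrightarrow> F (f + h) = F f + F h" "\<And>f e. f \<in> kn n \<Longrightarrow> F (e *s f) = e * F f"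
  assume "q \<in> kn n"
  then show ?thesis
  proof (induction rule: kn_induct)
    case zero
    then show ?case using F(2)[of 0 0] by simp
  next
    case (add f e i)
    have m: "monom 1 i \<in> kn n" using add.hyps(2) by simp
    show ?case using add.IH F(1)[OF add.hyps(1) kn_closed(5)[OF m]] F(2)[OF m] add.hyps(2)
      by (simp add: pairing_simps pairing_monom coeff_poly_of)
  qed
qed

text \<open>A linear form on \<open>M\<close> is a form on the sink component plus one on the source
  component. The latter factors through the injective \<open>c\<close> by means of
  \<open>\<rho>\<close>, so the slots of the other two arrows may be 0.\<close>

lemma g_surj: "g ` carrier P0 = carrier DM"
proof (intro equalityI subsetI)
  fix \<phi> assume "\<phi> \<in> carrier DM"
  then have e: "\<phi> \<in> extensional (carrier M)"
    and add: "\<And>m m'. \<lbrakk>m \<in> carrier M; m' \<in> carrier M\<rbrakk> \<Longrightarrow> \<phi> (m \<oplus>\<^bsub>M\<^esub> m') = \<phi> m + \<phi> m'"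
    and sm: "\<And>e m. m \<in> carrier M \<Longrightarrow> \<phi> (scalar K3 e \<odot>\<^bsub>M\<^esub> m) = e * \<phi> m" unfolding dual_module_carrier by blast+
  define F1 where "F1 q = \<phi> (\<Phi> (0, q))" for q
  define F2 where "F2 q = \<phi> (\<Phi> (\<rho> q, 0))" for q
  have F1: "pairing n (poly_of n (\<lambda>i. F1 (monom 1 i))) q = F1 q" if "q \<in> kn n" for q
  proof (rule pairing_poly_of[OF lin_on_id that])
    fix f h :: "'k poly" assume "f \<in> kn n" "h \<in> kn n"
    then show "F1 (f + h) = F1 f + F1 h" using add[of "\<Phi> (0, f)" "\<Phi> (0, h)"] by (simp add: F1_def \<Phi>_closed \<Phi>_add)
  next
    fix f :: "'k poly" and e assume "f \<in> kn n"
    then show "F1 (e *s f) = e * F1 f"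
      using sm[of "\<Phi> (0, f)" e] by (simp add: F1_def \<Phi>_closed \<Phi>_smult scalar_K3)
  qed
  have F2: "pairing n (poly_of n (\<lambda>i. F2 (monom 1 i))) q = F2 q" if "q \<in> kn n" for q
  proof (rule pairing_poly_of[OF lin_on_id that])
    fix f h :: "'k poly" assume "f \<in> kn n" "h \<in> kn n"
    then show "F2 (f + h) = F2 f + F2 h" using add[of "\<Phi> (\<rho> f, 0)" "\<Phi> (\<rho> h, 0)"]
      by (simp add: F2_def \<Phi>_closed \<Phi>_add lin_onD[OF \<rho>(1)])
  next
    fix f :: "'k poly" and e assume "f \<in> kn n"
    then show "F2 (e *s f) = e * F2 f"
      using sm[of "\<Phi> (\<rho> f, 0)" e] by (simp add: F2_def \<Phi>_closed \<Phi>_smult scalar_K3 lin_onD[OF \<rho>(1)])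
  qed
  let ?z = "(poly_of n (\<lambda>i. F1 (monom 1 i)), 0, 0, poly_of n (\<lambda>i. F2 (monom 1 i)))"
  have "g ?z = \<phi>"
  proof (rule ext_M_eqI[OF g_ext e])
    fix p q :: "'k poly" assume p: "p \<in> kn l" "q \<in> kn n"
    have "\<phi> (\<Phi> (p, q)) = F1 q + F2 (c p)"
      using add[of "\<Phi> (0, q)" "\<Phi> (p, 0)"] p by (simp add: F1_def F2_def \<Phi>_closed \<Phi>_add \<rho>(2))
    then show "g ?z (\<Phi> (p, q)) = \<phi> (\<Phi> (p, q))" using p abc_closed[OF p(1)] by (simp add: g_\<Phi> F1 F2)
  qed
  moreover have "?z \<in> carrier P0" by (simp add: kn3_def)
  ultimately show "\<phi> \<in> g ` carrier P0" by (metis imageI)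
qed (use mod_homD(1)[OF g_mod_hom] in blast)

lemma g_zero_iff:
  assumes "y \<in> kn n"
  shows "g (y, u, v, w) = \<zero>\<^bsub>DM\<^esub> \<longleftrightarrow> y = 0 \<and> (\<forall>p\<in>kn l. pairing n u (a p) + pairing n v (b p) + pairing n w (c p) = 0)"
proof
  assume z: "g (y, u, v, w) = \<zero>\<^bsub>DM\<^esub>"
  have v: "pairing n y q + (pairing n u (a p) + pairing n v (b p) + pairing n w (c p)) = 0" if "p \<in> kn l" "q \<in> kn n" for p q
    using arg_cong[OF z, of "\<lambda>\<phi>. \<phi> (\<Phi> (p, q))"] that by (simp add: g_\<Phi> \<Phi>_closed)
  have "coeff y i = 0" if "i < n" for i
    using v[of 0 "monom 1 i"] that lin_on_0[OF A.a] lin_on_0[OF A.b] lin_on_0[OF A.c] by (simp add: pairing_monom)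
  then have "y = 0" by (intro kn_eqI[OF assms]) simp_all
  then show "y = 0 \<and> (\<forall>p\<in>kn l. pairing n u (a p) + pairing n v (b p) + pairing n w (c p) = 0)" using v[of _ 0] by simp
next
  assume "y = 0 \<and> (\<forall>p\<in>kn l. pairing n u (a p) + pairing n v (b p) + pairing n w (c p) = 0)"
  then show "g (y, u, v, w) = \<zero>\<^bsub>DM\<^esub>" by (intro ext_M_eqI) (simp_all add: g_ext g_\<Phi> \<Phi>_closed)
qed

lemma ker_g: "a_kernel P0 DM g = {z \<in> carrier P0. g z = \<zero>\<^bsub>DM\<^esub>}"
  using a_kernel_eq[OF lmP0 lmD g_mod_hom] .

text \<open>The kernel consists of elements of the radical, i.e. without component at \<open>e\<^sub>y\<close>.\<close>

lemma g_superfluous: "superfluous (opp K3) P0 (a_kernel P0 DM g)"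
  unfolding superfluous_def
proof (intro allI impI)
  fix U assume U: "submodule U (opp K3) P0 \<and> U <+>\<^bsub>P0\<^esub> a_kernel P0 DM g = carrier P0"
  interpret P0: left_module "opp K3 :: ('k, _) module" P0 by (rule lmP0)
  have Uc: "U \<subseteq> kn n \<times> kn3 n" and Uadd: "\<And>z z'. \<lbrakk>z \<in> U; z' \<in> U\<rbrakk> \<Longrightarrow> z + z' \<in> U"
    and Uact: "\<And>x y r s t z. z \<in> U \<Longrightarrow> act (pathalg_elem x y r s t) z \<in> U"
  proof -
    show "U \<subseteq> kn n \<times> kn3 n" "\<And>z z'. \<lbrakk>z \<in> U; z' \<in> U\<rbrakk> \<Longrightarrow> z + z' \<in> U"
      using U unfolding P0.submodule_iff by auto
    fix x y r s t z assume "z \<in> U"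
    then have "pathalg_elem y x r s t \<odot>\<^bsub>P0\<^esub> z \<in> U" using U unfolding P0.submodule_iff by (metis opp_simps(1) pathalg_elem_closed)
    then show "act (pathalg_elem x y r s t) z \<in> U" by simp
  qed
  have top: "\<exists>u v w. (y, u, v, w) \<in> U" if "y \<in> kn n" for y
  proof -
    have "(y, 0, 0, 0) \<in> U <+>\<^bsub>P0\<^esub> a_kernel P0 DM g" using U that by (simp add: kn3_def)
    then obtain z k where zk: "z \<in> U" "k \<in> a_kernel P0 DM g" "(y, 0, 0, 0) = z + k" unfolding set_add_def' by auto
    obtain k0 k1 k2 k3 where k: "k = (k0, k1, k2, k3)" by (cases k)
    have "k0 = 0" using zk(2) g_zero_iff[of k0 k1 k2 k3] unfolding ker_g k by (simp add: kn3_def)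
    then show ?thesis using zk k by (cases z) auto
  qed
  \<comment> \<open>Multiplying by arrows annihilates the unknown components \<open>u, v, w\<close>,
    and so yields all radical elements.\<close>
  have e: "(0, r *s y, s *s y, t *s y) \<in> U" if "y \<in> kn n" for y r s t
  proof -
    obtain u v w where "(y, u, v, w) \<in> U" using top \<open>y \<in> kn n\<close> by blast
    from Uact[OF this, of 0 0 r s t] show ?thesis by simp
  qed
  have "(y, u, v, w) \<in> U" if k: "y \<in> kn n" "u \<in> kn n" "v \<in> kn n" "w \<in> kn n" for y u v w
  proof -
    obtain u' v' w' where z: "(y, u', v', w') \<in> U" using top k(1) by blast
    then have k': "u' \<in> kn n" "v' \<in> kn n" "w' \<in> kn n" using Uc by (auto simp: kn3_def)
    have "(0, u - u', 0, 0) \<in> U" "(0, 0, v - v', 0) \<in> U" "(0, 0, 0, w - w') \<in> U"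
      using e[of "u - u'" 1 0 0] e[of "v - v'" 0 1 0] e[of "w - w'" 0 0 1] k k' by simp_all
    then have "(y, u', v', w') + (0, u - u', 0, 0) + (0, 0, v - v', 0) + (0, 0, 0, w - w') \<in> U"
      using Uadd z by blast
    then show ?thesis by simp
  qed
  then show "U = carrier P0" using Uc by (auto simp: kn3_def)
qed

text \<open>The transpose of the map that sums the values of the three primed arrows.\<close>

definition f :: "'k poly \<Rightarrow> 'k poly \<times> 'k triple" where
  "f \<xi> = (0, adjoint n d a' \<xi>, adjoint n d b' \<xi>, adjoint n d c' \<xi>)"

lemma f_closed: "f \<xi> \<in> carrier P0"
  by (simp add: f_def kn3_def)

lemma f_mod_hom: "f \<in> mod_hom (opp K3) P1 P0"
  by (rule mod_homI) (auto simp: f_def kn3_def adjoint_add adjoint_smult elim!: pathalg_elem_cases)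

lemma f_inj: "\<lbrakk>\<xi> \<in> kn d; f \<xi> = 0\<rbrakk> \<Longrightarrow> \<xi> = 0"
proof -
  assume \<xi>: "\<xi> \<in> kn d" "f \<xi> = 0"
  have z: "adjoint n d a' \<xi> = 0" "adjoint n d b' \<xi> = 0" "adjoint n d c' \<xi> = 0"
    using \<xi>(2) by (simp_all add: f_def zero_prod_def)
  have "coeff \<xi> i = 0" if i: "i < d" for i
  proof -
    have "monom (1::'k) i \<in> kn d" using i by simp
    then obtain u v w where u: "u \<in> kn n" "v \<in> kn n" "w \<in> kn n" "monom 1 i = a' u + b' v + c' w" using B.gen by blast
    have "coeff \<xi> i = pairing d \<xi> (monom 1 i)" using pairing_monom(2)[OF i] by metis
    also have "\<dots> = 0" unfolding u(4) pairing_add_right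
        pairing_adjoint[OF B.a u(1), symmetric] pairing_adjoint[OF B.b u(2), symmetric] pairing_adjoint[OF B.c u(3), symmetric] z
      by simp
    finally show ?thesis .
  qed
  then show "\<xi> = 0" by (intro kn_eqI[OF \<xi>(1)]) simp_all
qed

text \<open>The dual of exactness: the forms on triples that vanish on all
  \<open>(a p, b p, c p)\<close> are those that factor through the sum of the primed arrows.\<close>

lemma f_image: "f ` carrier P1 = a_kernel P0 DM g"
proof (intro equalityI subsetI)
  fix z assume "z \<in> f ` carrier P1"
  then obtain \<xi> where z: "z = f \<xi>" by blast
  have "pairing n (adjoint n d a' \<xi>) (a p) + pairing n (adjoint n d b' \<xi>) (b p) + pairing n (adjoint n d c' \<xi>) (c p) = 0"
    if p: "p \<in> kn l" for p
  proof -
    have "(a p, b p, c p) \<in> B.sum_rel 0" unfolding exact using A.relI[OF p, of 0 0 0 "{}"] by simp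
    then have "a' (a p) + b' (b p) + c' (c p) = 0" unfolding B.sum_rel_def by simp
    then show ?thesis
      unfolding pairing_adjoint[OF B.a abc_closed(1)[OF p]] pairing_adjoint[OF B.b abc_closed(2)[OF p]] pairing_adjoint[OF B.c abc_closed(3)[OF p]]
      by (simp flip: pairing_add_right)
  qed
  then have "g (f \<xi>) = \<zero>\<^bsub>DM\<^esub>" unfolding f_def using g_zero_iff by simp
  then show "z \<in> a_kernel P0 DM g" unfolding z ker_g using f_closed by simp
next
  fix z assume "z \<in> a_kernel P0 DM g"
  moreover obtain y u v w where z: "z = (y, u, v, w)" by (cases z)
  ultimately have k: "y \<in> kn n" "u \<in> kn n" "v \<in> kn n" "w \<in> kn n" "g (y, u, v, w) = \<zero>\<^bsub>DM\<^esub>" unfolding ker_g by (auto simp: kn3_def)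
  define T where "T = (\<lambda>(r, s, t). pairing n u r + pairing n v s + pairing n w t)"
  have y: "y = 0" and T0: "\<And>p. p \<in> kn l \<Longrightarrow> T (a p, b p, c p) = 0" using g_zero_iff[OF k(1)] k(5) unfolding T_def by simp_all
  have "\<exists>q. i < d \<longrightarrow> fst q \<in> kn n \<and> fst (snd q) \<in> kn n \<and> snd (snd q) \<in> kn n \<and>
      monom 1 i = a' (fst q) + b' (fst (snd q)) + c' (snd (snd q))" for i
  proof (cases "i < d")
    case True
    then have "monom (1::'k) i \<in> kn d" by simp
    then obtain r s t where "r \<in> kn n" "s \<in> kn n" "t \<in> kn n" "monom 1 i = a' r + b' s + c' t" using B.gen by blast
    then show ?thesis by (intro exI[of _ "(r, s, t)"]) simp
  qed simp
  then obtain q where q: "\<And>i. i < d \<Longrightarrow> fst (q i) \<in> kn n \<and> fst (snd (q i)) \<in> kn n \<and> snd (snd (q i)) \<in> kn n \<and>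
      monom 1 i = a' (fst (q i)) + b' (fst (snd (q i))) + c' (snd (snd (q i)))" by metis
  \<comment> \<open>\<open>T\<close> vanishes on the triples with sum 0 and so induces a form on the
    sums. Its coordinates are the values of \<open>T\<close> on chosen triples \<open>q i\<close>
    with sum \<open>x^i\<close>.\<close>
  define \<xi> where "\<xi> = poly_of d (\<lambda>i. T (q i))"
  have main: "\<forall>r\<in>kn n. \<forall>s\<in>kn n. \<forall>t\<in>kn n. a' r + b' s + c' t = x \<longrightarrow> T (r, s, t) = pairing d \<xi> x" if "x \<in> kn d" for x
    using that
  proof (induction rule: kn_induct)
    case zero
    show ?case
    proof (intro ballI impI)
      fix r s t :: "'k poly" assume "r \<in> kn n" "s \<in> kn n" "t \<in> kn n" "a' r + b' s + c' t = 0"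
      then have "(r, s, t) \<in> A.rel 0 {}" unfolding exact[symmetric] B.sum_rel_def by simp
      then obtain p where "p \<in> kn l" "r = a p" "s = b p" "t = c p" by (rule A.relE) auto
      then show "T (r, s, t) = pairing d \<xi> 0" using T0 by simp
    qed
  next
    case (add x e i)
    obtain r0 s0 t0 where qi: "q i = (r0, s0, t0)" by (cases "q i")
    have k0: "r0 \<in> kn n" "s0 \<in> kn n" "t0 \<in> kn n" "monom 1 i = a' r0 + b' s0 + c' t0" using q[OF add.hyps(2)] qi by simp_all
    show ?case
    proof (intro ballI impI)
      fix r s t :: "'k poly" assume k: "r \<in> kn n" "s \<in> kn n" "t \<in> kn n" "a' r + b' s + c' t = x + e *s monom 1 i"
      have "a' (r - e *s r0) + b' (s - e *s s0) + c' (t - e *s t0) = a' r + b' s + c' t - e *s (a' r0 + b' s0 + c' t0)"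
        using lin_onD(5)[OF B.a k(1) kn_closed(5)[OF k0(1)]] lin_onD(5)[OF B.b k(2) kn_closed(5)[OF k0(2)]]
          lin_onD(5)[OF B.c k(3) kn_closed(5)[OF k0(3)]] lin_onD(2)[OF B.a k0(1)] lin_onD(2)[OF B.b k0(2)] lin_onD(2)[OF B.c k0(3)]
        by (simp add: smult_add_right)
      also have "\<dots> = x" unfolding k(4) k0(4)[symmetric] by simp
      finally have "T (r - e *s r0, s - e *s s0, t - e *s t0) = pairing d \<xi> x" using add.IH k k0 by simp
      moreover have "T (r0, s0, t0) = coeff \<xi> i" using add.hyps(2) qi by (simp add: \<xi>_def coeff_poly_of)
      moreover have "T (r, s, t) = T (r - e *s r0, s - e *s s0, t - e *s t0) + e * T (r0, s0, t0)"
        by (simp add: T_def pairing_simps algebra_simps)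
      ultimately show "T (r, s, t) = pairing d \<xi> (x + e *s monom 1 i)"
        using add.hyps(2) by (simp add: pairing_simps pairing_monom)
    qed
  qed
  have adj: "adjoint n d L \<xi> = h" if "h \<in> kn n" "\<And>i. i < n \<Longrightarrow> pairing d \<xi> (L (monom 1 i)) = coeff h i" for L h
    by (rule kn_eqI[OF adjoint_mem that(1)]) (simp add: adjoint_def coeff_poly_of that(2))
  have "f \<xi> = z" unfolding f_def z y
  proof (intro arg_cong2[where f = Pair] refl adj k)
    fix i assume i: "i < n"
    have m: "monom (1::'k) i \<in> kn n" "a' (monom 1 i) \<in> kn d" "b' (monom 1 i) \<in> kn d" "c' (monom 1 i) \<in> kn d"
      using i lin_onD(1)[OF B.a] lin_onD(1)[OF B.b] lin_onD(1)[OF B.c] by simp_all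
    have "T (monom 1 i, 0, 0) = pairing d \<xi> (a' (monom 1 i))" "T (0, monom 1 i, 0) = pairing d \<xi> (b' (monom 1 i))"
      "T (0, 0, monom 1 i) = pairing d \<xi> (c' (monom 1 i))"
      using main[OF m(2)] main[OF m(3)] main[OF m(4)] m(1) lin_on_0[OF B.a] lin_on_0[OF B.b] lin_on_0[OF B.c] by simp_all
    then show "pairing d \<xi> (a' (monom 1 i)) = coeff u i" "pairing d \<xi> (b' (monom 1 i)) = coeff v i" "pairing d \<xi> (c' (monom 1 i)) = coeff w i"
      by (simp_all add: T_def pairing_monom i)
  qed
  moreover have "\<xi> \<in> carrier P1" by (simp add: \<xi>_def)
  ultimately show "z \<in> f ` carrier P1" by blast
qed

end


section \<open>Homomorphisms into the algebra and the cokernel of the transposed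
  presentation\<close>

lemma hom_module_simps [simp]:
  "carrier (hom_module A P) = mod_hom A P (regular_module A) \<inter> extensional (carrier P)"
  "zero (hom_module A P) = (\<lambda>p\<in>carrier P. \<zero>\<^bsub>A\<^esub>)"
  "add (hom_module A P) \<phi> \<psi> = (\<lambda>p\<in>carrier P. \<phi> p \<oplus>\<^bsub>A\<^esub> \<psi> p)"
  "a \<odot>\<^bsub>hom_module A P\<^esub> \<phi> = (\<lambda>p\<in>carrier P. \<phi> p \<otimes>\<^bsub>A\<^esub> a)"
  by (simp_all add: hom_module_def)

lemma regular_module_simps [simp]:
  "carrier (regular_module A) = carrier A" "zero (regular_module A) = zero A" "add (regular_module A) = add A"
  "a \<odot>\<^bsub>regular_module A\<^esub> b = a \<otimes>\<^bsub>A\<^esub> b"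
  by (simp_all add: regular_module_def)

lemma mod_hom_restrict:
  assumes M: "left_module A M" and h: "h \<in> mod_hom A M N"
  shows "(\<lambda>x\<in>carrier M. h x) \<in> mod_hom A M N"
proof -
  interpret left_module A M by (rule M)
  show ?thesis by (rule mod_homI) (simp_all add: mod_homD[OF h])
qed

lemma factor_map_isomorphic:
  fixes N :: "('a, 'n) module"
  assumes M: "left_module A M" and f: "factor_map A M Q q U" and iso: "mod_isomorphic A Q N" and N: "left_module A N"
  shows "\<exists>p. factor_map A M N p U"
proof -
  obtain h where h: "h \<in> mod_hom A Q N" "bij_betw h (carrier Q) (carrier N)" using iso unfolding mod_isomorphic_def by blast
  have Q: "left_module A Q" using factor_map_left_module[OF M f] .
  have "(\<lambda>x. h (q x)) ` carrier M = h ` (q ` carrier M)" by (simp add: image_image)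
  also have "\<dots> = carrier N" unfolding factor_map_image_carrier[OF f] using h(2) by (simp add: bij_betw_def)
  finally have im: "(\<lambda>x. h (q x)) ` carrier M = carrier N" .
  have inj: "h (q x) = h (q y) \<longleftrightarrow> q x = q y" if "x \<in> carrier M" "y \<in> carrier M" for x y
    using inj_on_eq_iff[OF bij_betw_imp_inj_on[OF h(2)]] factor_map_closed[OF f] that by simp
  have "factor_map A M N (\<lambda>x. h (q x)) U"
    unfolding factor_map_def
    by (simp add: im inj factor_map_zero[OF f] mod_hom_zero[OF Q N h(1)] factor_map_add[OF f] factor_map_smult[OF f]
        mod_homD(2,3)[OF h(1)] factor_map_closed[OF f] factor_map_eq_iff[OF f])
  then show ?thesis by blast
qed

context tau_link
begin

interpretation M: left_module K3 M by (rule lmM)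

text \<open>The homomorphisms from \<open>(e\<^sub>x \<Lambda>\<^sub>3)\<^sup>d\<close> and from \<open>(e\<^sub>y \<Lambda>\<^sub>3)\<^sup>n\<close> to \<open>\<Lambda>\<^sub>3\<close>.\<close>

definition \<chi> :: "'k poly \<times> 'k triple \<Rightarrow> 'k poly \<Rightarrow> kronecker_vertex \<times> nat list \<Rightarrow> 'k" where
  "\<chi> = (\<lambda>(x, u, v, w) \<xi>. pathalg_elem (pairing d \<xi> x) 0 (pairing d \<xi> u) (pairing d \<xi> v) (pairing d \<xi> w))"

definition \<eta> :: "'k poly \<Rightarrow> 'k poly \<times> 'k triple \<Rightarrow> kronecker_vertex \<times> nat list \<Rightarrow> 'k" where
  "\<eta> q = (\<lambda>(y, u, v, w). pathalg_elem 0 (pairing n y q) (pairing n u q) (pairing n v q) (pairing n w q))"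

lemma \<chi>_mod_hom: "\<chi> x \<in> mod_hom (opp K3) P1 (regular_module (opp K3))"
  by (cases x, rule mod_homI) (auto simp: \<chi>_def pairing_simps mult.commute elim!: pathalg_elem_cases)

lemma \<eta>_mod_hom: "\<eta> q \<in> mod_hom (opp K3) P0 (regular_module (opp K3))"
  by (rule mod_homI) (auto simp: \<eta>_def pairing_simps algebra_simps elim!: pathalg_elem_cases)

text \<open>The trivial path at the source acts as the identity on the generators, so their images
  have no coefficient at the other trivial path.\<close>

lemma \<chi>_cases:
  assumes \<psi>: "\<psi> \<in> mod_hom (opp K3) P1 (regular_module (opp K3))"
  shows "\<exists>x\<in>kn d \<times> kn3 d. \<forall>\<xi>\<in>kn d. \<psi> \<xi> = \<chi> x \<xi>"
proof -
  define \<kappa> where "\<kappa> i = \<psi> (monom 1 i)" for i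
  let ?co = "\<lambda>s. poly_of d (\<lambda>i. \<kappa> i s)"
  let ?x = "(?co (VX, []), ?co (VX, [0]), ?co (VX, [1]), ?co (VX, [2]))"
  have mul: "\<psi> (e *s \<xi>) = \<psi> \<xi> \<otimes>\<^bsub>K3\<^esub> pathalg_elem e 0 0 0 0" if "\<xi> \<in> kn d" for e \<xi>
    using mod_homD(3)[OF \<psi>, of "pathalg_elem e 0 0 0 0" \<xi>] that by simp
  have \<kappa>: "\<kappa> i = pathalg_elem (\<kappa> i (VX, [])) 0 (\<kappa> i (VX, [0])) (\<kappa> i (VX, [1])) (\<kappa> i (VX, [2]))" if i: "i < d" for i
  proof -
    have k: "monom (1::'k) i \<in> kn d" using i by simp
    then have "\<kappa> i \<in> carrier K3" unfolding \<kappa>_def using mod_homD(1)[OF \<psi>] by simp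
    then obtain p q r s t where e: "\<kappa> i = pathalg_elem p q r s t" by (rule pathalg_elem_cases)
    have "\<kappa> i = \<kappa> i \<otimes>\<^bsub>K3\<^esub> pathalg_elem 1 0 0 0 0" using mul[OF k, of 1] unfolding \<kappa>_def by simp
    then show ?thesis unfolding e by simp
  qed
  have "\<psi> \<xi> = \<chi> ?x \<xi>" if "\<xi> \<in> kn d" for \<xi>
    using that
  proof (induction rule: kn_induct)
    case zero
    show ?case using mul[of 0 0] mod_homD(1)[OF \<psi>, of 0] by (auto simp: \<chi>_def elim!: pathalg_elem_cases)
  next
    case (add \<xi> e i)
    have k: "monom (1::'k) i \<in> kn d" using add.hyps(2) by simp
    have "\<psi> (\<xi> + e *s monom 1 i) = \<psi> \<xi> \<oplus>\<^bsub>K3\<^esub> \<psi> (e *s monom 1 i)"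
      using mod_homD(2)[OF \<psi>, of \<xi> "e *s monom 1 i"] add.hyps(1) kn_closed(5)[OF k] by simp
    also have "\<psi> (e *s monom 1 i) = \<kappa> i \<otimes>\<^bsub>K3\<^esub> pathalg_elem e 0 0 0 0" using mul[OF k] unfolding \<kappa>_def .
    also have "\<dots> = pathalg_elem (\<kappa> i (VX, []) * e) 0 (\<kappa> i (VX, [0]) * e) (\<kappa> i (VX, [1]) * e) (\<kappa> i (VX, [2]) * e)"
      by (subst \<kappa>[OF add.hyps(2)]) simp
    finally show ?case using add.IH add.hyps(2) by (simp add: \<chi>_def pairing_simps pairing_monom coeff_poly_of mult.commute)
  qed
  moreover have "?x \<in> kn d \<times> kn3 d" by (simp add: kn3_def)
  ultimately show ?thesis by blast
qed

text \<open>The comparison is made on radical elements only, because these are the values of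
  \<open>f\<close>.\<close>

lemma \<eta>_cases:
  assumes \<psi>: "\<psi> \<in> mod_hom (opp K3) P0 (regular_module (opp K3))"
  shows "\<exists>q\<in>kn n. \<forall>u\<in>kn n. \<forall>v\<in>kn n. \<forall>w\<in>kn n. \<psi> (0, u, v, w) = \<eta> q (0, u, v, w)"
proof -
  have sm: "\<psi> (act (pathalg_elem x y r s t) z) = \<psi> z \<otimes>\<^bsub>K3\<^esub> pathalg_elem y x r s t" if "z \<in> kn n \<times> kn3 n" for x y r s t z
    using mod_homD(3)[OF \<psi>, of "pathalg_elem y x r s t" z] that by simp
  have ad: "\<psi> (z + z') = \<psi> z \<oplus>\<^bsub>K3\<^esub> \<psi> z'" if "z \<in> kn n \<times> kn3 n" "z' \<in> kn n \<times> kn3 n" for z z'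
    using mod_homD(2)[OF \<psi>, of z z'] that by simp
  define \<kappa> where "\<kappa> i = \<psi> (monom 1 i, 0, 0, 0)" for i
  define q where "q = poly_of n (\<lambda>i. \<kappa> i (VY, []))"
  have mk: "(monom 1 i, 0, 0, 0) \<in> kn n \<times> kn3 n" if "i < n" for i using that by (simp add: kn3_def)
  have \<kappa>: "\<kappa> i = pathalg_elem 0 (\<kappa> i (VY, [])) 0 0 0" if i: "i < n" for i
  proof -
    have "(monom 1 i, 0, 0, 0) \<in> carrier P0" using mk[OF i] by simp
    then have "\<kappa> i \<in> carrier K3" unfolding \<kappa>_def using mod_homD(1)[OF \<psi>] by fastforce
    then obtain p q r s t where e: "\<kappa> i = pathalg_elem p q r s t" by (rule pathalg_elem_cases)
    have "\<kappa> i = \<kappa> i \<otimes>\<^bsub>K3\<^esub> pathalg_elem 0 1 0 0 0" using sm[OF mk[OF i], of 1 0 0 0 0] unfolding \<kappa>_def by simp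
    then show ?thesis unfolding e by simp
  qed
  have arrow: "\<psi> (0, r *s f, s *s f, t *s f) = pathalg_elem 0 0 (r * pairing n f q) (s * pairing n f q) (t * pairing n f q)"
    if "f \<in> kn n" for f r s t
    using that
  proof (induction rule: kn_induct)
    case zero
    have "\<psi> (act (pathalg_elem 0 0 0 0 0) 0) = \<psi> 0 \<otimes>\<^bsub>K3\<^esub> pathalg_elem 0 0 0 0 0"
      by (rule sm) (simp add: kn3_def zero_prod_def)
    moreover have "\<psi> 0 \<in> carrier K3" using mod_homD(1)[OF \<psi>, of 0] by (simp add: kn3_def zero_prod_def)
    ultimately show ?case by (auto simp: zero_prod_def elim!: pathalg_elem_cases)
  next
    case (add f e i)
    have m: "monom (1::'k) i \<in> kn n" using add.hyps(2) by simp
    have "\<psi> (0, r *s (f + e *s monom 1 i), s *s (f + e *s monom 1 i), t *s (f + e *s monom 1 i)) =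
      \<psi> ((0, r *s f, s *s f, t *s f) + act (pathalg_elem 0 0 (r * e) (s * e) (t * e)) (monom 1 i, 0, 0, 0))"
      by (simp add: smult_add_right)
    also have "\<dots> = \<psi> (0, r *s f, s *s f, t *s f) \<oplus>\<^bsub>K3\<^esub> \<kappa> i \<otimes>\<^bsub>K3\<^esub> pathalg_elem 0 0 (r * e) (s * e) (t * e)"
      unfolding \<kappa>_def sm[OF mk[OF add.hyps(2)], symmetric] by (rule ad) (use add.hyps m in \<open>simp_all add: kn3_def\<close>)
    also have "\<dots> = \<psi> (0, r *s f, s *s f, t *s f) \<oplus>\<^bsub>K3\<^esub>
        pathalg_elem 0 0 (\<kappa> i (VY, []) * (r * e)) (\<kappa> i (VY, []) * (s * e)) (\<kappa> i (VY, []) * (t * e))"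
      by (subst \<kappa>[OF add.hyps(2)]) simp
    finally show ?case
      using add.IH add.hyps(2) by (simp add: pairing_simps pairing_monom q_def coeff_poly_of algebra_simps)
  qed
  have "\<psi> (0, u, v, w) = \<eta> q (0, u, v, w)" if k: "u \<in> kn n" "v \<in> kn n" "w \<in> kn n" for u v w
  proof -
    have "\<psi> ((0, u, 0, 0) + ((0, 0, v, 0) + (0, 0, 0, w))) = \<psi> (0, u, 0, 0) \<oplus>\<^bsub>K3\<^esub> (\<psi> (0, 0, v, 0) \<oplus>\<^bsub>K3\<^esub> \<psi> (0, 0, 0, w))"
      using ad[of "(0, u, 0, 0)" "(0, 0, v, w)"] ad[of "(0, 0, v, 0)" "(0, 0, 0, w)"] k by (simp add: kn3_def)
    then show ?thesis using arrow[OF k(1), of 1 0 0] arrow[OF k(2), of 0 1 0] arrow[OF k(3), of 0 0 1] by (simp add: \<eta>_def)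
  qed
  moreover have "q \<in> kn n" by (simp add: q_def)
  ultimately show ?thesis by blast
qed

text \<open>Transposing twice brings back the primed arrows; these are the relations of the inverse
  translate.\<close>

lemma \<eta>_f: "q \<in> kn n \<Longrightarrow> \<eta> q (f \<xi>) = \<chi> (0, a' q, b' q, c' q) \<xi>"
  by (simp add: \<eta>_def \<chi>_def f_def pairing_adjoint[OF B.a] pairing_adjoint[OF B.b] pairing_adjoint[OF B.c])

text \<open>By uniqueness of projective covers, every minimal projective presentation of \<open>D M\<close> is isomorphic to
  \<open>(e\<^sub>x \<Lambda>\<^sub>3)\<^sup>d \<rightarrow> (e\<^sub>y \<Lambda>\<^sub>3)\<^sup>n \<rightarrow> D M\<close>.\<close>

lemma presentation_unique:
  assumes "minimal_projective_presentation (opp K3) Q1 h1 Q0 h0 DM"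
  shows "\<exists>\<theta>1 \<theta>0. \<theta>1 \<in> mod_hom (opp K3) P1 Q1 \<and> bij_betw \<theta>1 (carrier P1) (carrier Q1) \<and>
    \<theta>0 \<in> mod_hom (opp K3) P0 Q0 \<and> bij_betw \<theta>0 (carrier P0) (carrier Q0) \<and>
    (\<forall>\<xi>\<in>kn d. h1 (\<theta>1 \<xi>) = \<theta>0 (f \<xi>)) \<and> left_module (opp K3) Q1 \<and> left_module (opp K3) Q0 \<and> h1 \<in> mod_hom (opp K3) Q1 Q0"
proof -
  let ?K = "Q0\<lparr>carrier := a_kernel Q0 DM h0\<rparr>"
  have c0: "fd_module (opp K3) Q0" "projective_module (opp K3) Q0" "h0 \<in> mod_hom (opp K3) Q0 DM"
      "h0 ` carrier Q0 = carrier DM" "superfluous (opp K3) Q0 (a_kernel Q0 DM h0)"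
    and c1: "fd_module (opp K3) Q1" "projective_module (opp K3) Q1" "h1 \<in> mod_hom (opp K3) Q1 ?K"
      "h1 ` carrier Q1 = carrier ?K" "superfluous (opp K3) Q1 (a_kernel Q1 ?K h1)"
    using assms unfolding minimal_projective_presentation_def projective_cover_def by blast+
  have lm: "left_module (opp K3) Q0" "left_module (opp K3) Q1" using c0(1) c1(1) unfolding fd_module_def by blast+
  interpret Q0: left_module "opp K3 :: ('k, _) module" Q0 by (rule lm(1))
  have subK: "submodule (a_kernel Q0 DM h0) (opp K3) Q0" using submodule_a_kernel[OF lm(1) lmD c0(3)] .
  have lmK: "left_module (opp K3) ?K" using Q0.submodule_left_module[OF subK] .
  have ker0: "a_kernel Q0 DM h0 = {x \<in> carrier Q0. h0 x = \<zero>\<^bsub>DM\<^esub>}" using a_kernel_eq[OF lm(1) lmD c0(3)] .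
  obtain \<theta>0 where t0: "\<theta>0 \<in> mod_hom (opp K3) P0 Q0" "bij_betw \<theta>0 (carrier P0) (carrier Q0)"
      "\<And>z. z \<in> carrier P0 \<Longrightarrow> h0 (\<theta>0 z) = g z"
    using projective_cover_unique[OF lmP0 lm(1) lmD projective_right_proj_y g_mod_hom g_surj g_superfluous c0(2-5)] by blast
  have im: "\<theta>0 ` a_kernel P0 DM g = a_kernel Q0 DM h0"
  proof (intro equalityI subsetI)
    fix z assume "z \<in> \<theta>0 ` a_kernel P0 DM g"
    then obtain y where y: "y \<in> a_kernel P0 DM g" "z = \<theta>0 y" by blast
    then have "y \<in> carrier P0" "g y = \<zero>\<^bsub>DM\<^esub>" unfolding ker_g by (simp_all del: right_proj_simps)
    then show "z \<in> a_kernel Q0 DM h0" unfolding ker0 using t0(3)[of y] mod_homD(1)[OF t0(1), of y] y(2)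
      by (simp del: right_proj_simps)
  next
    fix z assume "z \<in> a_kernel Q0 DM h0"
    then have z: "z \<in> carrier Q0" "h0 z = \<zero>\<^bsub>DM\<^esub>" unfolding ker0 by simp_all
    then obtain y where y: "y \<in> carrier P0" "z = \<theta>0 y" using bij_betw_imp_surj_on[OF t0(2)] by (metis imageE)
    then have "y \<in> a_kernel P0 DM g" unfolding ker_g using z(2) t0(3)[OF y(1)] by simp
    then show "z \<in> \<theta>0 ` a_kernel P0 DM g" using y(2) by (rule_tac image_eqI)
  qed
  define k where "k \<xi> = \<theta>0 (f \<xi>)" for \<xi>
  have kim: "k ` carrier P1 = carrier ?K"
  proof -
    have "k ` carrier P1 = \<theta>0 ` f ` carrier P1" unfolding k_def by (rule image_image[symmetric])
    then show ?thesis unfolding f_image im by simp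
  qed
  have k: "k \<in> mod_hom (opp K3) P1 ?K"
  proof (rule mod_homI)
    note h = mod_hom_comp[OF f_mod_hom t0(1), folded k_def]
    fix \<xi> assume \<xi>: "\<xi> \<in> carrier P1"
    show "k \<xi> \<in> carrier ?K" using kim \<xi> by blast
    { fix \<xi>' assume "\<xi>' \<in> carrier P1"
      then show "k (\<xi> \<oplus>\<^bsub>P1\<^esub> \<xi>') = k \<xi> \<oplus>\<^bsub>?K\<^esub> k \<xi>'" using mod_homD(2)[OF h \<xi>] by simp }
    { fix e assume "e \<in> carrier (opp K3 :: ('k, _) module)"
      then show "k (e \<odot>\<^bsub>P1\<^esub> \<xi>) = e \<odot>\<^bsub>?K\<^esub> k \<xi>" using mod_homD(3)[OF h _ \<xi>] by simp }
  qed
  have "a_kernel P1 ?K k = {0}"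
  proof -
    have "\<xi> = 0" if \<xi>: "\<xi> \<in> kn d" "k \<xi> = \<zero>\<^bsub>Q0\<^esub>" for \<xi>
    proof -
      have "\<theta>0 (f \<xi>) = \<theta>0 0" using \<xi>(2) mod_hom_zero[OF lmP0 lm(1) t0(1)] unfolding k_def by simp
      moreover have "0 \<in> carrier P0" by (simp add: kn3_def zero_prod_def)
      ultimately have "f \<xi> = 0" using t0(2) f_closed unfolding bij_betw_def inj_on_def by blast
      then show ?thesis using f_inj \<xi>(1) by blast
    qed
    moreover have "k 0 = \<zero>\<^bsub>Q0\<^esub>" using mod_hom_zero[OF lmP1 lmK k] by simp
    ultimately show ?thesis unfolding a_kernel_eq[OF lmP1 lmK k] by auto
  qed
  then have sup: "superfluous (opp K3) P1 (a_kernel P1 ?K k)"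
  proof -
    interpret P1: left_module "opp K3 :: ('k, _) module" P1 by (rule lmP1)
    have "U <+>\<^bsub>P1\<^esub> {0} = U" for U unfolding set_add_def' by auto
    then show ?thesis unfolding superfluous_def \<open>a_kernel P1 ?K k = {0}\<close> by metis
  qed
  obtain \<theta>1 where t1: "\<theta>1 \<in> mod_hom (opp K3) P1 Q1" "bij_betw \<theta>1 (carrier P1) (carrier Q1)"
      "\<And>\<xi>. \<xi> \<in> carrier P1 \<Longrightarrow> h1 (\<theta>1 \<xi>) = k \<xi>"
    using projective_cover_unique[OF lmP1 lm(2) lmK projective_right_proj_x k kim sup c1(2-5)] by blast
  have "h1 \<in> mod_hom (opp K3) Q1 Q0"
  proof (rule mod_homI)
    fix x assume x: "x \<in> carrier Q1"
    show "h1 x \<in> carrier Q0" using mod_homD(1)[OF c1(3) x] unfolding ker0 by simp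
  qed (use mod_homD(2,3)[OF c1(3)] in simp_all)
  then show ?thesis using t0(1,2) t1(1,2) t1(3)[unfolded k_def] lm by (intro exI[of _ \<theta>1] exI[of _ \<theta>0]) simp
qed

text \<open>The presentation provided by \<open>is_tau_inverse\<close> is replaced by the standard
  one via \<open>\<theta>1\<close> and \<open>\<theta>0\<close>. Under the identification
  \<open>q\<close> of \<open>(Lambda e_x)^d\<close> with the homomorphisms from \<open>Q1\<close>,
  those that factor through \<open>h1\<close> become the relations
  \<open>(a' v, b' v, c' v)\<close>.\<close>

theorem presents_tau_inverse:
  assumes d: "d > 0" and tau: "is_tau_inverse K3 M N" and N: "left_module K3 N"
  shows "\<exists>\<Psi>. presents N d (B.rel 0 {}) \<Psi>"
proof -
  obtain Q1 :: "(kronecker_vertex \<times> nat list \<Rightarrow> 'k, nat \<Rightarrow> kronecker_vertex \<times> nat list \<Rightarrow> 'k) module" and h1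
    and Q0 :: "(kronecker_vertex \<times> nat list \<Rightarrow> 'k, nat \<Rightarrow> kronecker_vertex \<times> nat list \<Rightarrow> 'k) module" and h0
    where pr: "minimal_projective_presentation (opp K3) Q1 h1 Q0 h0 DM"
      and iso: "mod_isomorphic K3 (quot_module (hom_module (opp K3) Q1)
            ((\<lambda>\<phi>. \<lambda>p\<in>carrier Q1. \<phi> (h1 p)) ` carrier (hom_module (opp K3) Q0))) N"
    using tau unfolding is_tau_inverse_def is_transpose_def opp_simps by blast
  obtain \<theta>1 \<theta>0 where t1: "\<theta>1 \<in> mod_hom (opp K3) P1 Q1" "bij_betw \<theta>1 (carrier P1) (carrier Q1)"
    and t0: "\<theta>0 \<in> mod_hom (opp K3) P0 Q0" "bij_betw \<theta>0 (carrier P0) (carrier Q0)"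
    and comm: "\<And>\<xi>. \<xi> \<in> kn d \<Longrightarrow> h1 (\<theta>1 \<xi>) = \<theta>0 (f \<xi>)"
    and lm: "left_module (opp K3) Q1" "left_module (opp K3) Q0" and h1: "h1 \<in> mod_hom (opp K3) Q1 Q0"
    using presentation_unique[OF pr] by blast
  define \<iota>1 where "\<iota>1 = inv_into (carrier P1) \<theta>1"
  define \<iota>0 where "\<iota>0 = inv_into (carrier P0) \<theta>0"
  have i1: "\<iota>1 \<in> mod_hom (opp K3) Q1 P1" unfolding \<iota>1_def by (rule mod_hom_inv[OF t1 lmP1])
  have i0: "\<iota>0 \<in> mod_hom (opp K3) Q0 P0" unfolding \<iota>0_def by (rule mod_hom_inv[OF t0 lmP0])
  have it1: "\<iota>1 (\<theta>1 \<xi>) = \<xi>" if "\<xi> \<in> kn d" for \<xi>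
    using t1(2) that unfolding \<iota>1_def bij_betw_def by (simp add: inv_into_f_f)
  have it0: "\<iota>0 (\<theta>0 z) = z" if "z \<in> carrier P0" for z
    using t0(2) that unfolding \<iota>0_def bij_betw_def by (simp add: inv_into_f_f)
  have ti1: "\<theta>1 (\<iota>1 p) = p" "\<iota>1 p \<in> kn d" if "p \<in> carrier Q1" for p
    using t1(2) that mod_homD(1)[OF i1] unfolding \<iota>1_def bij_betw_def by (simp_all add: f_inv_into_f)
  let ?H1 = "hom_module (opp K3) Q1" and ?H0 = "hom_module (opp K3) Q0"
  let ?R = "B.rel 0 {}"
  define q where "q x = (\<lambda>p\<in>carrier Q1. \<chi> x (\<iota>1 p))" for x
  have q\<theta>: "q x (\<theta>1 \<xi>) = \<chi> x \<xi>" if "\<xi> \<in> kn d" for x \<xi>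
    using that it1[OF that] mod_homD(1)[OF t1(1)] by (simp add: q_def)
  have \<chi>_closed: "\<chi> x \<xi> \<in> carrier K3" if "\<xi> \<in> kn d" for x \<xi>
    using mod_homD(1)[OF \<chi>_mod_hom[of x]] that by simp
  have q_closed: "q x \<in> carrier ?H1" for x
  proof -
    have "(\<lambda>p. \<chi> x (\<iota>1 p)) \<in> mod_hom (opp K3) Q1 (regular_module (opp K3))" using mod_hom_comp[OF i1 \<chi>_mod_hom] .
    then have "q x \<in> mod_hom (opp K3) Q1 (regular_module (opp K3))"
      unfolding q_def by (rule mod_hom_restrict[OF lm(1)])
    then show ?thesis by (simp add: q_def)
  qed
  have q_eqI: "\<phi> = q x" if "\<phi> \<in> extensional (carrier Q1)" "\<And>\<xi>. \<xi> \<in> kn d \<Longrightarrow> \<phi> (\<theta>1 \<xi>) = \<chi> x \<xi>" for \<phi> x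
  proof (rule extensionalityI[OF that(1)])
    fix p assume p: "p \<in> carrier Q1"
    show "\<phi> p = q x p" using that(2)[OF ti1(2)[OF p]] ti1(1)[OF p] p by (simp add: q_def)
  qed (simp add: q_def)
  have lmF: "left_module K3 (proj_x d :: (_, 'k poly \<times> 'k triple) module)" using left_module_proj_x M.R.ring_axioms by blast
  have q_inj: "x = x'" if xx: "x \<in> kn d \<times> kn3 d" "x' \<in> kn d \<times> kn3 d" "q x = q x'" for x x'
  proof -
    obtain x0 x1 x2 x3 where x: "x = (x0, x1, x2, x3)" by (cases x)
    obtain y0 y1 y2 y3 where y: "x' = (y0, y1, y2, y3)" by (cases x')
    have "\<chi> x (monom 1 i) = \<chi> x' (monom 1 i)" if "i < d" for i
      using q\<theta>[of "monom 1 i" x] q\<theta>[of "monom 1 i" x'] xx(3) that by simp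
    then have co: "coeff x0 i = coeff y0 i \<and> coeff x1 i = coeff y1 i \<and> coeff x2 i = coeff y2 i \<and> coeff x3 i = coeff y3 i" if "i < d" for i
      using that unfolding x y by (simp add: \<chi>_def pairing_monom)
    show ?thesis using xx(1,2) co unfolding x y by (auto simp: kn3_def intro!: kn_eqI[of _ d])
  qed
  \<comment> \<open>An isomorphism, written as a factor map with zero kernel so that it can be
    composed with the passage to the cokernel.\<close>
  have fq: "factor_map K3 (proj_x d) ?H1 q {0}"
    unfolding factor_map_def
  proof (intro conjI ballI)
    show "q ` carrier (proj_x d) = carrier ?H1"
    proof (intro equalityI subsetI)
      fix \<phi> assume "\<phi> \<in> carrier ?H1"
      then have \<phi>: "\<phi> \<in> mod_hom (opp K3) Q1 (regular_module (opp K3))" "\<phi> \<in> extensional (carrier Q1)" by simp_all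
      obtain x where "x \<in> kn d \<times> kn3 d" "\<And>\<xi>. \<xi> \<in> kn d \<Longrightarrow> \<phi> (\<theta>1 \<xi>) = \<chi> x \<xi>"
        using \<chi>_cases[OF mod_hom_comp[OF t1(1) \<phi>(1)]] by blast
      then show "\<phi> \<in> q ` carrier (proj_x d)" using q_eqI[OF \<phi>(2)] by (intro image_eqI[of _ _ x]) simp_all
    qed (use q_closed in blast)
    show "q \<zero>\<^bsub>proj_x d\<^esub> = \<zero>\<^bsub>?H1\<^esub>"
      by (simp add: q_def \<chi>_def zero_prod_def pathalg_elem_zero)
  next
    fix x y :: "'k poly \<times> 'k triple" assume xy: "x \<in> carrier (proj_x d)" "y \<in> carrier (proj_x d)"
    show "q (x \<oplus>\<^bsub>proj_x d\<^esub> y) = q x \<oplus>\<^bsub>?H1\<^esub> q y"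
      by (cases x; cases y) (simp add: q_def \<chi>_def pairing_simps fun_eq_iff)
    show "q x = q y \<longleftrightarrow> x \<ominus>\<^bsub>proj_x d\<^esub> y \<in> {0}"
      unfolding proj_x_minus[OF lmF xy] using q_inj xy by auto
  next
    fix e :: "kronecker_vertex \<times> nat list \<Rightarrow> 'k" and x :: "'k poly \<times> 'k triple" assume "e \<in> carrier K3"
    then obtain p1 p2 p3 p4 p5 where e: "e = pathalg_elem p1 p2 p3 p4 p5" by (rule pathalg_elem_cases)
    obtain x0 x1 x2 x3 where x: "x = (x0, x1, x2, x3)" by (cases x)
    show "q (e \<odot>\<^bsub>proj_x d\<^esub> x) = e \<odot>\<^bsub>?H1\<^esub> q x"
      unfolding q_def by (simp add: e x \<chi>_def pairing_simps cong: restrict_cong)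
  qed
  have R: "subspace3 d ?R" using B.subspace3_rel d by simp
  let ?L = "{0 :: 'k poly} \<times> ?R"
  have L: "submodule ?L K3 (proj_x d)" using submodule_relations[OF lmF R] .
  have L0: "{0} \<subseteq> ?L" using subspace3D(2)[OF R] by (simp add: zero_prod_def)
  have I: "(\<lambda>\<phi>. \<lambda>p\<in>carrier Q1. \<phi> (h1 p)) ` carrier ?H0 = q ` ?L"
  proof (intro equalityI subsetI)
    fix \<omega> assume "\<omega> \<in> (\<lambda>\<phi>. \<lambda>p\<in>carrier Q1. \<phi> (h1 p)) ` carrier ?H0"
    then obtain \<phi> where \<phi>: "\<phi> \<in> mod_hom (opp K3) Q0 (regular_module (opp K3))" "\<omega> = (\<lambda>p\<in>carrier Q1. \<phi> (h1 p))" by auto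
    obtain v where v: "v \<in> kn n" "\<forall>u\<in>kn n. \<forall>w\<in>kn n. \<forall>t\<in>kn n. \<phi> (\<theta>0 (0, u, w, t)) = \<eta> v (0, u, w, t)"
      using \<eta>_cases[OF mod_hom_comp[OF t0(1) \<phi>(1)]] by blast
    have "\<omega> = q (0, a' v, b' v, c' v)"
    proof (rule q_eqI)
      fix \<xi> :: "'k poly" assume \<xi>: "\<xi> \<in> kn d"
      have "\<omega> (\<theta>1 \<xi>) = \<phi> (\<theta>0 (f \<xi>))" using \<phi>(2) mod_homD(1)[OF t1(1)] \<xi> comm[OF \<xi>] by simp
      also have "\<dots> = \<eta> v (f \<xi>)" using v(2) by (simp add: f_def)
      finally show "\<omega> (\<theta>1 \<xi>) = \<chi> (0, a' v, b' v, c' v) \<xi>" using \<eta>_f[OF v(1)] by simp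
    qed (simp add: \<phi>(2))
    moreover have "(a' v, b' v, c' v) \<in> ?R" using B.relI[OF v(1), of 0 0 0 "{}"] by simp
    ultimately show "\<omega> \<in> q ` ?L" by blast
  next
    fix \<omega> assume "\<omega> \<in> q ` ?L"
    then obtain r where r: "r \<in> ?R" "\<omega> = q (0, r)" by blast
    obtain v where v: "v \<in> kn n" "r = (a' v, b' v, c' v)"
    proof -
      obtain r1 r2 r3 where e: "r = (r1, r2, r3)" by (cases r)
      obtain v h s where "v \<in> kn n" "h \<in> kn 0" "s \<in> kn_supp {}" "r1 = a' v + h" "r2 = b' v + pCons 0 h" "r3 = c' v + s"
        using r(1) unfolding e by (rule B.relE)
      then show thesis using that[of v] e by simp
    qed
    define \<phi> where "\<phi> = (\<lambda>z\<in>carrier Q0. \<eta> v (\<iota>0 z))"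
    have "(\<lambda>z. \<eta> v (\<iota>0 z)) \<in> mod_hom (opp K3) Q0 (regular_module (opp K3))" using mod_hom_comp[OF i0 \<eta>_mod_hom] .
    then have "\<phi> \<in> mod_hom (opp K3) Q0 (regular_module (opp K3))"
      unfolding \<phi>_def by (rule mod_hom_restrict[OF lm(2)])
    then have \<phi>c: "\<phi> \<in> carrier ?H0" by (simp add: \<phi>_def)
    have "(\<lambda>p\<in>carrier Q1. \<phi> (h1 p)) = q (0, r)"
    proof (rule q_eqI)
      fix \<xi> :: "'k poly" assume \<xi>: "\<xi> \<in> kn d"
      have c: "\<theta>0 (f \<xi>) \<in> carrier Q0" using mod_homD(1)[OF t0(1) f_closed] .
      have "(\<lambda>p\<in>carrier Q1. \<phi> (h1 p)) (\<theta>1 \<xi>) = \<eta> v (f \<xi>)"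
        using mod_homD(1)[OF t1(1)] \<xi> comm[OF \<xi>] c it0[OF f_closed] by (simp add: \<phi>_def)
      then show "(\<lambda>p\<in>carrier Q1. \<phi> (h1 p)) (\<theta>1 \<xi>) = \<chi> (0, r) \<xi>" using \<eta>_f[OF v(1)] v(2) by simp
    qed simp
    then have "\<omega> = (\<lambda>p\<in>carrier Q1. \<phi> (h1 p))" using r(2) by simp
    then show "\<omega> \<in> (\<lambda>\<phi>. \<lambda>p\<in>carrier Q1. \<phi> (h1 p)) ` carrier ?H0"
      using \<phi>c by (rule image_eqI[where x = \<phi>])
  qed
  have lmH: "left_module K3 ?H1" using factor_map_left_module[OF lmF fq] .
  have LI: "submodule (q ` ?L) K3 ?H1" using factor_map_image[OF lmF fq L] .
  obtain p where "factor_map K3 ?H1 N p (q ` ?L)"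
    using factor_map_isomorphic[OF lmH factor_map_quot_module[OF lmH LI] iso[unfolded I] N] by blast
  from factor_map_comp[OF lmF fq L L0 this] have "presents N d ?R (\<lambda>x. p (q x))"
    unfolding presents_def using N R by simp
  then show ?thesis by (rule exI[of _ "\<lambda>x. p (q x)"])
qed

end


section \<open>From presentations back to representations\<close>

lemma (in exact_arrows) realizes_if_presents:
  fixes M :: "(kronecker_vertex \<times> nat list \<Rightarrow> 'k, 'm) module"
  assumes pres: "presents M d (sum_rel 0) \<Psi>"
  shows "\<exists>\<Phi>. realizes M d n a b c \<Phi>"
proof -
  note fm = pres_fm[OF pres] and lmF = pres_lmF[OF pres]
  \<comment> \<open>This sum map is onto by \<open>gen\<close> and its kernel is
    \<open>sum_rel 0\<close>, so the sink component of \<open>M\<close> is identified with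
    \<open>k^n\<close>, and the arrows with \<open>a, b, c\<close>.\<close>
  define S where "S = (\<lambda>(u, v, w). a u + b v + c w)"
  have S: "S r \<in> kn n" if "r \<in> kn3 d" for r
    using that lin_onD(1)[OF a] lin_onD(1)[OF b] lin_onD(1)[OF c] by (auto simp: S_def kn3_def)
  have S_add: "S (r + s) = S r + S s" if "r \<in> kn3 d" "s \<in> kn3 d" for r s
  proof -
    obtain u v w u' v' w' where r: "r = (u, v, w)" "s = (u', v', w')" by (cases r; cases s)
    then have k: "u \<in> kn d" "v \<in> kn d" "w \<in> kn d" "u' \<in> kn d" "v' \<in> kn d" "w' \<in> kn d" using that by (simp_all add: kn3_def)
    show ?thesis unfolding r S_def using lin_onD(3)[OF a k(1,4)] lin_onD(3)[OF b k(2,5)] lin_onD(3)[OF c k(3,6)]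
      by (simp add: ac_simps)
  qed
  have S_scale: "S (tscale e r) = e *s S r" if "r \<in> kn3 d" for r e
  proof -
    obtain u v w where r: "r = (u, v, w)" by (cases r)
    then have k: "u \<in> kn d" "v \<in> kn d" "w \<in> kn d" using that by (simp_all add: kn3_def)
    show ?thesis unfolding r S_def using lin_onD(2)[OF a k(1)] lin_onD(2)[OF b k(2)] lin_onD(2)[OF c k(3)]
      by (simp add: smult_add_right)
  qed
  have ker: "r \<in> sum_rel 0 \<longleftrightarrow> r \<in> kn3 d \<and> S r = 0" for r
    by (cases r) (auto simp: sum_rel_def S_def kn3_def)
  have "\<exists>r. r \<in> kn3 d \<and> S r = q" if q: "q \<in> kn n" for q
  proof -
    obtain u v w where "u \<in> kn d" "v \<in> kn d" "w \<in> kn d" "q = a u + b v + c w" using gen[OF q] by blast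
    then show ?thesis by (intro exI[of _ "(u, v, w)"]) (simp add: S_def kn3_def)
  qed
  then obtain pre where pre: "\<And>q. q \<in> kn n \<Longrightarrow> pre q \<in> kn3 d \<and> S (pre q) = q" by metis
  define \<Phi> where "\<Phi> = (\<lambda>(p, q). \<Psi> (p, pre q))"
  have eq: "\<Psi> (p, r) = \<Psi> (p', r') \<longleftrightarrow> p = p' \<and> S r = S r'"
    if k: "p \<in> kn d" "p' \<in> kn d" "r \<in> kn3 d" "r' \<in> kn3 d" for p p' r r'
  proof -
    have c: "(p, r) \<in> carrier (proj_x d)" "(p', r') \<in> carrier (proj_x d)" using k by simp_all
    have d: "r - r' \<in> kn3 d" using k by (auto simp: kn3_def)
    have "S r = S (r - r') + S r'" using S_add[OF d k(4)] by simp
    then have "S (r - r') = 0 \<longleftrightarrow> S r = S r'" by simp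
    then show ?thesis unfolding factor_map_eq_iff[OF fm c] proj_x_minus[OF lmF c] using d by (auto simp: ker)
  qed
  have \<Psi>: "\<Psi> (p, r) = \<Phi> (p, S r)" if "p \<in> kn d" "r \<in> kn3 d" for p r
    using eq[OF that(1,1,2), of "pre (S r)"] pre[OF S[OF that(2)]] that by (simp add: \<Phi>_def)
  have "bij_betw \<Phi> (kn d \<times> kn n) (carrier M)"
  proof (rule bij_betw_imageI)
    show "inj_on \<Phi> (kn d \<times> kn n)"
    proof (rule inj_onI)
      fix z z' assume z: "z \<in> kn d \<times> kn n" "z' \<in> kn d \<times> kn n" "\<Phi> z = \<Phi> z'"
      obtain p q p' q' where zz: "z = (p, q)" "z' = (p', q')" by (cases z; cases z')
      then show "z = z'" using z eq[of p p' "pre q" "pre q'"] pre[of q] pre[of q'] by (simp add: \<Phi>_def)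
    qed
    show "\<Phi> ` (kn d \<times> kn n) = carrier M"
    proof (intro equalityI subsetI)
      fix m assume "m \<in> \<Phi> ` (kn d \<times> kn n)"
      then obtain p q where "p \<in> kn d" "q \<in> kn n" "m = \<Phi> (p, q)" by auto
      then show "m \<in> carrier M" using factor_map_closed[OF fm, of "(p, pre q)"] pre[of q] by (simp add: \<Phi>_def)
    next
      fix m assume "m \<in> carrier M"
      then obtain z where z: "z \<in> carrier (proj_x d)" "m = \<Psi> z" using factor_map_surj[OF fm] by blast
      obtain p r where "z = (p, r)" by (cases z)
      then have "p \<in> kn d" "r \<in> kn3 d" "m = \<Phi> (p, S r)" using z \<Psi>[of p r] by simp_all
      then show "m \<in> \<Phi> ` (kn d \<times> kn n)" using S by (intro image_eqI[of _ _ "(p, S r)"]) simp_all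
    qed
  qed
  moreover have "\<Phi> (p + p', q + q') = \<Phi> (p, q) \<oplus>\<^bsub>M\<^esub> \<Phi> (p', q')"
    if k: "p \<in> kn d" "q \<in> kn n" "p' \<in> kn d" "q' \<in> kn n" for p q p' q'
  proof -
    note r = pre[OF k(2)] pre[OF k(4)]
    have "\<Phi> (p, q) \<oplus>\<^bsub>M\<^esub> \<Phi> (p', q') = \<Psi> (p + p', pre q + pre q')"
      using factor_map_add[OF fm, of "(p, pre q)" "(p', pre q')"] k r by (simp add: \<Phi>_def)
    also have "\<dots> = \<Phi> (p + p', q + q')"
      using \<Psi>[of "p + p'" "pre q + pre q'"] S_add[of "pre q" "pre q'"] kn3_closed(2)[of "pre q" d "pre q'"] k r by simp
    finally show ?thesis by simp
  qed
  moreover have "pathalg_elem x y r s t \<odot>\<^bsub>M\<^esub> \<Phi> (p, q) = \<Phi> (x *s p, y *s q + (r *s a p + s *s b p + t *s c p))"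
    if k: "p \<in> kn d" "q \<in> kn n" for x y r s t p q
  proof -
    note pq = pre[OF k(2)]
    let ?z = "(r *s p, s *s p, t *s p) + tscale y (pre q)"
    have rk: "(r *s p, s *s p, t *s p) \<in> kn3 d" using k by (simp add: kn3_def)
    have zk: "?z \<in> kn3 d" using kn3_closed(2)[OF rk kn3_closed(3)] pq by blast
    have "pathalg_elem x y r s t \<odot>\<^bsub>M\<^esub> \<Phi> (p, q) = \<Psi> (act (pathalg_elem x y r s t) (p, pre q))"
      using factor_map_smult[OF fm, of "pathalg_elem x y r s t" "(p, pre q)"] k pq by (simp add: \<Phi>_def)
    also have "act (pathalg_elem x y r s t) (p, pre q) = (x *s p, ?z)" by (cases "pre q") simp
    also have "\<Psi> (x *s p, ?z) = \<Phi> (x *s p, S ?z)" using \<Psi>[OF kn_closed(5)[OF k(1)] zk] .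
    also have "S ?z = S (r *s p, s *s p, t *s p) + y *s q"
      using S_add[OF rk kn3_closed(3)] S_scale pq by simp
    also have "S (r *s p, s *s p, t *s p) = r *s a p + s *s b p + t *s c p"
      unfolding S_def using lin_onD(2)[OF a k(1)] lin_onD(2)[OF b k(1)] lin_onD(2)[OF c k(1)] by simp
    finally show ?thesis by (simp only: add.commute)
  qed
  ultimately have "realizes M d n a b c \<Phi>" unfolding realizes_def using pres_lm[OF pres] by simp
  then show ?thesis by (rule exI[of _ \<Phi>])
qed

section \<open>The projective modules at the two vertices\<close>

lemma vertex_idempotent_eq:
  "vertex_idempotent VX = pathalg_elem 1 0 0 0 0" "vertex_idempotent VY = pathalg_elem 0 1 0 0 0"
  by (auto simp: fun_eq_iff vertex_idempotent_def pathalg_elem_def split: kronecker_vertex.split)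

lemma carrier_vertex_projective_VX:
  "carrier (vertex_projective (kronecker_quiver 3) VX) = {pathalg_elem x 0 r s t |x r s t. True}"
proof (intro equalityI subsetI)
  fix z :: "kronecker_vertex \<times> nat list \<Rightarrow> 'a" assume "z \<in> carrier (vertex_projective (kronecker_quiver 3) VX)"
  then obtain w where "w \<in> carrier K3" "z = w \<otimes>\<^bsub>K3\<^esub> pathalg_elem 1 0 0 0 0"
    by (auto simp: vertex_projective_def vertex_idempotent_eq)
  then show "z \<in> {pathalg_elem x 0 r s t |x r s t. True}" by (auto elim!: pathalg_elem_cases)
next
  fix z :: "kronecker_vertex \<times> nat list \<Rightarrow> 'a" assume "z \<in> {pathalg_elem x 0 r s t |x r s t. True}"
  then obtain x r s t where "z = pathalg_elem x 0 r s t" by blast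
  then have "z = pathalg_elem x 0 r s t \<otimes>\<^bsub>K3\<^esub> pathalg_elem 1 0 0 0 0" by simp
  then show "z \<in> carrier (vertex_projective (kronecker_quiver 3) VX)"
    unfolding vertex_projective_def vertex_idempotent_eq by (simp del: pathalg_elem_mult)
qed

lemma carrier_vertex_projective_VY:
  "carrier (vertex_projective (kronecker_quiver 3) VY) = {pathalg_elem 0 y 0 0 0 |y. True}"
proof (intro equalityI subsetI)
  fix z :: "kronecker_vertex \<times> nat list \<Rightarrow> 'a" assume "z \<in> carrier (vertex_projective (kronecker_quiver 3) VY)"
  then obtain w where "w \<in> carrier K3" "z = w \<otimes>\<^bsub>K3\<^esub> pathalg_elem 0 1 0 0 0"
    by (auto simp: vertex_projective_def vertex_idempotent_eq)
  then show "z \<in> {pathalg_elem 0 y 0 0 0 |y. True}" by (auto elim!: pathalg_elem_cases)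
next
  fix z :: "kronecker_vertex \<times> nat list \<Rightarrow> 'a" assume "z \<in> {pathalg_elem 0 y 0 0 0 |y. True}"
  then obtain y where "z = pathalg_elem 0 y 0 0 0" by blast
  then have "z = pathalg_elem 0 y 0 0 0 \<otimes>\<^bsub>K3\<^esub> pathalg_elem 0 1 0 0 0" by simp
  then show "z \<in> carrier (vertex_projective (kronecker_quiver 3) VY)"
    unfolding vertex_projective_def vertex_idempotent_eq by (simp del: pathalg_elem_mult)
qed

lemma vertex_projective_ops:
  "add (vertex_projective (kronecker_quiver 3) v) = add K3"
  "a \<odot>\<^bsub>vertex_projective (kronecker_quiver 3) v\<^esub> b = a \<otimes>\<^bsub>K3\<^esub> b"
  by (simp_all add: vertex_projective_def)

lemmas vertex_projective_simps = carrier_vertex_projective_VX carrier_vertex_projective_VY vertex_projective_ops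

lemma presents_vertex_projective_VX:
  fixes M :: "(kronecker_vertex \<times> nat list \<Rightarrow> 'k::field, 'm) module"
  assumes M: "left_module K3 M" and iso: "mod_isomorphic K3 (vertex_projective (kronecker_quiver 3) VX) M"
  shows "\<exists>\<Psi>. presents M 1 {0} \<Psi>"
proof -
  interpret left_module K3 M by (rule M)
  let ?V = "vertex_projective (kronecker_quiver 3) VX :: (kronecker_vertex \<times> nat list \<Rightarrow> 'k, _) module"
  obtain h where h: "h \<in> mod_hom K3 ?V M" "bij_betw h (carrier ?V) (carrier M)" using iso unfolding mod_isomorphic_def by blast
  have lmF: "left_module K3 (proj_x 1 :: (_, 'k poly \<times> 'k triple) module)" using left_module_proj_x R.ring_axioms by blast
  let ?i = "\<lambda>(x, u, v, w). pathalg_elem (coeff x 0) 0 (coeff u 0) (coeff v 0) (coeff w (0::nat)) :: kronecker_vertex \<times> nat list \<Rightarrow> 'k"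
  have ic: "?i z \<in> carrier ?V" for z by (cases z) (auto simp: vertex_projective_simps)
  have hi: "h (?i z) = h (?i z') \<longleftrightarrow> ?i z = ?i z'" for z z'
    using inj_on_eq_iff[OF bij_betw_imp_inj_on[OF h(2)] ic ic] .
  have ieq: "?i z = ?i z' \<longleftrightarrow> z = z'" if z: "z \<in> kn 1 \<times> kn3 1" "z' \<in> kn 1 \<times> kn3 1" for z z'
  proof
    assume e: "?i z = ?i z'"
    obtain x u v w where zz: "z = (x, u, v, w)" by (cases z)
    obtain x' u' v' w' where zz': "z' = (x', u', v', w')" by (cases z')
    show "z = z'" using e z unfolding zz zz' by (auto simp: kn3_def intro!: kn_eqI[of _ 1])
  qed simp
  have "factor_map K3 (proj_x 1) M (\<lambda>z. h (?i z)) ({0} \<times> {0})"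
    unfolding factor_map_def
  proof (intro conjI ballI)
    show "(\<lambda>z. h (?i z)) ` carrier (proj_x 1) = carrier M"
    proof (intro equalityI subsetI)
      fix m assume "m \<in> carrier M"
      then obtain z where z: "z \<in> carrier ?V" "m = h z" using bij_betw_imp_surj_on[OF h(2)] by (metis imageE)
      then obtain x r s t where "z = pathalg_elem x 0 r s t" unfolding vertex_projective_simps by blast
      then have "z = ?i ([:x:], [:r:], [:s:], [:t:])" by simp
      then show "m \<in> (\<lambda>z. h (?i z)) ` carrier (proj_x 1)"
        unfolding z(2) by (intro image_eqI[of _ _ "([:x:], [:r:], [:s:], [:t:])"]) (simp_all add: kn3_def)
    next
      fix m assume "m \<in> (\<lambda>z. h (?i z)) ` carrier (proj_x 1)"
      then show "m \<in> carrier M" using mod_homD(1)[OF h(1) ic] by blast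
    qed
    show "h (?i \<zero>\<^bsub>proj_x 1\<^esub>) = \<zero>\<^bsub>M\<^esub>"
    proof -
      have "pathalg_elem 0 0 0 0 0 \<otimes>\<^bsub>K3\<^esub> ?i 0 = ?i 0" by (simp add: zero_prod_def)
      then have "h (?i 0) = pathalg_elem 0 0 0 0 0 \<odot>\<^bsub>M\<^esub> h (?i 0)"
        using mod_homD(3)[OF h(1) pathalg_elem_closed ic, of 0 0 0 0 0 0] unfolding vertex_projective_simps by simp
      also have "\<dots> = \<zero>\<^bsub>M\<^esub>" using smult_zero_left[OF mod_homD(1)[OF h(1) ic]] unfolding pathalg_elem_zero .
      finally show ?thesis by simp
    qed
  next
    fix z z' :: "'k poly \<times> 'k triple" assume z: "z \<in> carrier (proj_x 1)" "z' \<in> carrier (proj_x 1)"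
    have "?i (z + z') = ?i z \<oplus>\<^bsub>K3\<^esub> ?i z'" by (cases z; cases z') simp
    then show "h (?i (z \<oplus>\<^bsub>proj_x 1\<^esub> z')) = h (?i z) \<oplus>\<^bsub>M\<^esub> h (?i z')"
      using mod_homD(2)[OF h(1) ic ic, of z z'] unfolding vertex_projective_simps by simp
    show "h (?i z) = h (?i z') \<longleftrightarrow> z \<ominus>\<^bsub>proj_x 1\<^esub> z' \<in> {0} \<times> {0}"
      unfolding proj_x_minus[OF lmF z] hi using ieq z by (auto simp: zero_prod_def)
  next
    fix e :: "kronecker_vertex \<times> nat list \<Rightarrow> 'k" and z :: "'k poly \<times> 'k triple" assume e: "e \<in> carrier K3"
    then obtain p1 p2 p3 p4 p5 where ee: "e = pathalg_elem p1 p2 p3 p4 p5" by (rule pathalg_elem_cases)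
    have "?i (act e z) = e \<otimes>\<^bsub>K3\<^esub> ?i z" unfolding ee by (cases z) simp
    then show "h (?i (e \<odot>\<^bsub>proj_x 1\<^esub> z)) = e \<odot>\<^bsub>M\<^esub> h (?i z)"
      using mod_homD(3)[OF h(1) e ic, of z] unfolding vertex_projective_simps by simp
  qed
  moreover have "subspace3 1 {0 :: 'k triple}" unfolding subspace3_def by (auto simp: kn3_def zero_prod_def)
  ultimately have "presents M 1 {0} (\<lambda>z. h (?i z))" unfolding presents_def using M by simp
  then show ?thesis by (rule exI[of _ "\<lambda>z. h (?i z)"])
qed

lemma realizes_vertex_projective_VY:
  fixes M :: "(kronecker_vertex \<times> nat list \<Rightarrow> 'k::field, 'm) module"
  assumes M: "left_module K3 M" and iso: "mod_isomorphic K3 (vertex_projective (kronecker_quiver 3) VY) M"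
  shows "\<exists>\<Phi>. realizes M 0 1 (\<lambda>_. 0) (\<lambda>_. 0) (\<lambda>_. 0) \<Phi>"
proof -
  let ?V = "vertex_projective (kronecker_quiver 3) VY :: (kronecker_vertex \<times> nat list \<Rightarrow> 'k, _) module"
  obtain h where h: "h \<in> mod_hom K3 ?V M" "bij_betw h (carrier ?V) (carrier M)" using iso unfolding mod_isomorphic_def by blast
  let ?i = "\<lambda>(p :: 'k poly, q). pathalg_elem 0 (coeff q 0) 0 0 0 :: kronecker_vertex \<times> nat list \<Rightarrow> 'k"
  have ic: "?i z \<in> carrier ?V" for z by (cases z) (auto simp: vertex_projective_simps)
  have "bij_betw ?i (kn 0 \<times> kn 1) (carrier ?V)"
  proof (rule bij_betw_imageI)
    show "inj_on ?i (kn 0 \<times> kn 1)"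
      by (rule inj_onI) (auto intro!: kn_eqI[of _ 1])
    show "?i ` (kn 0 \<times> kn 1) = carrier ?V"
    proof (intro equalityI subsetI)
      fix z assume "z \<in> carrier ?V"
      then obtain y where "z = pathalg_elem 0 y 0 0 0" unfolding vertex_projective_simps by blast
      then show "z \<in> ?i ` (kn 0 \<times> kn 1)" by (intro image_eqI[of _ _ "(0, [:y:])"]) simp_all
    qed (use ic in blast)
  qed
  then have "bij_betw (h \<circ> ?i) (kn 0 \<times> kn 1) (carrier M)" using h(2) by (rule bij_betw_trans)
  moreover have "h (?i (p + p', q + q')) = h (?i (p, q)) \<oplus>\<^bsub>M\<^esub> h (?i (p', q'))" for p q p' q'
    using mod_homD(2)[OF h(1) ic ic, of "(p, q)" "(p', q')"] by (simp add: vertex_projective_simps)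
  moreover have "pathalg_elem x y r s t \<odot>\<^bsub>M\<^esub> h (?i (p, q)) = h (?i (x *s p, y *s q + (r *s 0 + s *s 0 + t *s 0)))" for x y r s t p q
    using mod_homD(3)[OF h(1) pathalg_elem_closed ic, of x y r s t "(p, q)"] by (simp add: vertex_projective_simps)
  ultimately have "realizes M 0 1 (\<lambda>_. 0) (\<lambda>_. 0) (\<lambda>_. 0) (h \<circ> ?i)" unfolding realizes_def comp_def using M by simp
  then show ?thesis by (rule exI[of _ "h \<circ> ?i"])
qed

lemma accessible_vertex_projective_VY:
  fixes M :: "(kronecker_vertex \<times> nat list \<Rightarrow> 'k::field, 'm) module"
  assumes fd: "fd_module K3 M" and real: "realizes M 0 1 (\<lambda>_. 0) (\<lambda>_. 0) (\<lambda>_. 0) \<Phi>"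
  shows "accessible K3 M"
proof (rule accessible.simple[OF fd])
  interpret left_module K3 M using fd unfolding fd_module_def by blast
  have bij: "bij_betw \<Phi> (kn 0 \<times> kn 1) (carrier M)" using real unfolding realizes_def by blast
  have add: "\<Phi> (0, q + q') = \<Phi> (0, q) \<oplus>\<^bsub>M\<^esub> \<Phi> (0, q')" if "q \<in> kn 1" "q' \<in> kn 1" for q q'
    using real that unfolding realizes_def by (metis add_0 kn_closed(1))
  have sm: "pathalg_elem 0 y 0 0 0 \<odot>\<^bsub>M\<^esub> \<Phi> (0, q) = \<Phi> (0, y *s q)" if "q \<in> kn 1" for y q
  proof -
    have "pathalg_elem 0 y 0 0 0 \<odot>\<^bsub>M\<^esub> \<Phi> (0, q) = \<Phi> (0 *s 0, y *s q + (0 *s 0 + 0 *s 0 + 0 *s 0))"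
      using real that kn_closed(1) unfolding realizes_def by blast
    then show ?thesis by simp
  qed
  have cases: "\<exists>e. z = \<Phi> (0, [:e:])" if z: "z \<in> carrier M" for z
  proof -
    obtain p q where "p \<in> kn 0" "q \<in> kn 1" "z = \<Phi> (p, q)"
      using z unfolding bij_betw_imp_surj_on[OF bij, symmetric] by blast
    then have "q \<in> kn 1" "z = \<Phi> (0, q)" by simp_all
    then show ?thesis using kn_1_cases by blast
  qed
  have cl: "\<Phi> (0, [:e:]) \<in> carrier M" for e using bij_betwE[OF bij] by simp
  have z0: "\<Phi> (0, 0) = \<zero>\<^bsub>M\<^esub>"
    using add[of 0 0] bij_betwE[OF bij] by (metis M.add.r_cancel_one' add_0 kn_closed(1) mem_Sigma_iff)
  have inj: "\<Phi> (0, [:e:]) = \<zero>\<^bsub>M\<^esub> \<longleftrightarrow> e = 0" for e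
    using inj_on_eq_iff[OF bij_betw_imp_inj_on[OF bij], of "(0, [:e:])" "(0, 0)"] by (simp add: z0)
  show "simple_module K3 M" unfolding simple_module_def
  proof (intro conjI allI impI)
    show "carrier M \<noteq> {\<zero>\<^bsub>M\<^esub>}" using cl[of 1] inj[of 1] by auto
    fix U assume U: "submodule U K3 M"
    note u = U[unfolded submodule_iff]
    show "U = {\<zero>\<^bsub>M\<^esub>} \<or> U = carrier M"
    proof (cases "U \<subseteq> {\<zero>\<^bsub>M\<^esub>}")
      case True
      then show ?thesis using u by blast
    next
      case False
      then obtain z where z: "z \<in> U" "z \<noteq> \<zero>\<^bsub>M\<^esub>" by blast
      then obtain e where e: "z = \<Phi> (0, [:e:])" using cases u by blast
      then have "e \<noteq> 0" using z inj by blast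
      have "\<Phi> (0, [:x:]) \<in> U" for x
      proof -
        have "pathalg_elem 0 (x / e) 0 0 0 \<odot>\<^bsub>M\<^esub> z \<in> U" using u z(1) pathalg_elem_closed by blast
        then show ?thesis unfolding e using sm[of "[:e:]" "x / e"] \<open>e \<noteq> 0\<close> by simp
      qed
      then have "carrier M \<subseteq> U" using cases by blast
      then show ?thesis using u by blast
    qed
  qed
qed

text \<open>The ring axioms are contained in the requirement that the projective modules of the
  presentation are modules over \<open>opp K3\<close>.\<close>

lemma ring_opp_if_tau_inverse:
  fixes M :: "(kronecker_vertex \<times> nat list \<Rightarrow> 'k::field, 'm) module"
  assumes "is_tau_inverse K3 M N"
  shows "ring (opp K3 :: ('k, _) module)"
proof -
  obtain P1 :: "(kronecker_vertex \<times> nat list \<Rightarrow> 'k, nat \<Rightarrow> kronecker_vertex \<times> nat list \<Rightarrow> 'k) module" and f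
    and P0 :: "(kronecker_vertex \<times> nat list \<Rightarrow> 'k, nat \<Rightarrow> kronecker_vertex \<times> nat list \<Rightarrow> 'k) module" and g
    where pres: "minimal_projective_presentation (opp K3) P1 f P0 g (dual_module K3 M)"
    using assms unfolding is_tau_inverse_def is_transpose_def by blast
  have "left_module (opp K3) P0"
    using pres unfolding minimal_projective_presentation_def projective_cover_def fd_module_def by simp
  then show ?thesis by (rule left_module.axioms(1))
qed

lemma sum_rel_1: "A1.sum_rel 0 = {0}"
proof (rule triple_set_eqI, rule iffI)
  fix u v w :: "'a poly" assume "(u, v, w) \<in> A1.sum_rel 0"
  then have k: "u \<in> kn 1" "v \<in> kn 1" "w \<in> kn 1" "a1 u + b1 v + c1 w = 0" unfolding A1.sum_rel_def by auto
  then have "coeff (a1 u + b1 v + c1 w) i = 0" for i by simp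
  from this[of 0] this[of 1] this[of 2] have "coeff u 0 = 0" "coeff v 0 = 0" "coeff w 0 = 0" by (simp_all add: letter_defs)
  then have "u = 0" "v = 0" "w = 0" by (intro kn_eqI[OF k(1)] kn_eqI[OF k(2)] kn_eqI[OF k(3)]; simp)+
  then show "(u, v, w) \<in> {0}" by (simp add: zero_prod_def)
next
  fix u v w :: "'a poly" assume "(u, v, w) \<in> {0}"
  then show "(u, v, w) \<in> A1.sum_rel 0" unfolding A1.sum_rel_def by (simp add: zero_prod_def letter_defs)
qed

section \<open>The inverse translates at the three levels\<close>

context
  fixes M N :: "(kronecker_vertex \<times> nat list \<Rightarrow> 'k::field, 'm) module"
  assumes tau: "is_tau_inverse K3 M N" and N: "left_module K3 N"
begin

lemma tau_inverse_level_0: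
  assumes "realizes M 0 1 (\<lambda>_. 0) (\<lambda>_. 0) (\<lambda>_. 0) \<Phi>"
  shows "\<exists>\<Psi>. presents N 3 (A1.rel 0 {}) \<Psi>"
proof -
  have z: "lin_on m m' (\<lambda>_. 0 :: 'k poly)" for m m' by (simp add: lin_on_def)
  have A0: "arrows 0 1 (\<lambda>_. 0 :: 'k poly) (\<lambda>_. 0) (\<lambda>_. 0)"
    by (rule arrows.intro) (simp_all add: z)
  have "arrows.rel 0 (\<lambda>_. 0 :: 'k poly) (\<lambda>_. 0) (\<lambda>_. 0) 0 {} = {0}"
    unfolding arrows.rel_def[OF A0] by (auto simp: zero_prod_def)
  then have "tau_link 0 1 3 (\<lambda>_. 0 :: 'k poly) (\<lambda>_. 0) (\<lambda>_. 0) a1 b1 c1 (\<lambda>_. 0) M \<Phi>"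
    using assms
    by (intro tau_link.intro tau_link_axioms.intro A0 A1.exact_arrows_axioms ring_opp_if_tau_inverse[OF tau])
      (simp_all only: sum_rel_1 z kn_0 singleton_iff)
  from tau_link.presents_tau_inverse[OF this _ tau N] show ?thesis by simp
qed

lemma tau_inverse_level_1:
  assumes "realizes M 1 3 a1 b1 c1 \<Phi>"
  shows "\<exists>\<Psi>. presents N 8 (A2.rel 0 {}) \<Psi>"
proof -
  have r: "lin_on 3 1 (\<lambda>p :: 'k poly. [:coeff p 0:])" by (rule lin_onI) simp_all
  have inv: "[:coeff (c1 p) 0:] = p" if "p \<in> kn 1" for p :: "'k poly"
    using that by (intro kn_eqI[of _ 1]) (simp_all add: c1_def)
  have "tau_link 1 3 8 a1 b1 c1 a2 b2 c2 (\<lambda>p. [:coeff p 0:]) M \<Phi>"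
    by (intro tau_link.intro tau_link_axioms.intro A1.arrows_axioms A2.exact_arrows_axioms sum_rel_2 r inv assms
      ring_opp_if_tau_inverse[OF tau])
  from tau_link.presents_tau_inverse[OF this _ tau N] show ?thesis by simp
qed

lemma tau_inverse_level_2:
  assumes "realizes M 3 8 a2 b2 c2 \<Phi>"
  shows "\<exists>\<Psi>. presents N 21 (A3.rel 0 {}) \<Psi>"
proof -
  \<comment> \<open>A left inverse of \<open>c2\<close>, reading the three pivot coefficients 5, 0
    and 1.\<close>
  let ?\<rho> = "\<lambda>p :: 'k poly. monom (- coeff p 5) 0 + monom (coeff p 0) 1 + monom (coeff p 1) 2"
  have r: "lin_on 8 3 ?\<rho>" by (rule lin_onI; simp; simp add: poly_eq_iff algebra_simps)
  have inv: "?\<rho> (c2 p) = p" if "p \<in> kn 3" for p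
    using that by (intro kn_eqI[of _ 3]) (simp_all add: c2_def lessThan_nat_numeral)
  have "tau_link 3 8 21 a2 b2 c2 a3 b3 c3 ?\<rho> M \<Phi>"
    by (intro tau_link.intro tau_link_axioms.intro A2.arrows_axioms A3.exact_arrows_axioms sum_rel_3_0 r inv assms
      ring_opp_if_tau_inverse[OF tau])
  from tau_link.presents_tau_inverse[OF this _ tau N] show ?thesis by simp
qed

end

lemma acc_imp_accessible: "acc M \<Longrightarrow> accessible K3 M"
  unfolding acc_def accessible_of_length_def by blast

theorem mainTheorem4:
  fixes \<Lambda> :: "('k::alg_closed_field, kronecker_vertex \<times> nat list \<Rightarrow> 'k) module"
    and P :: "nat \<Rightarrow> (kronecker_vertex \<times> nat list \<Rightarrow> 'k, 'm) module"
  assumes "\<Lambda> = path_algebra (kronecker_quiver 3)"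
    and "\<And>i. fd_module \<Lambda> (P i)"
    and "mod_isomorphic \<Lambda> (vertex_projective (kronecker_quiver 3) VY) (P 0)"
    and "mod_isomorphic \<Lambda> (vertex_projective (kronecker_quiver 3) VX) (P 1)"
    and "\<And>i. is_tau_inverse \<Lambda> (P i) (P (i + 2))"
  shows "\<forall>i\<le>4. accessible \<Lambda> (P i)"
proof -
  note K3 = assms(1)
  have lm: "left_module K3 (P i)" for i using assms(2)[of i] unfolding K3 fd_module_def by blast
  have tau: "is_tau_inverse K3 (P i) (P j)" if "j = i + 2" for i j using assms(5)[of i] unfolding K3 that .
  have tau2: "is_tau_inverse K3 (P 0) (P 2)" and tau3: "is_tau_inverse K3 (P 1) (P 3)" and tau4: "is_tau_inverse K3 (P 2) (P 4)"
    by (rule tau; simp)+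
  \<comment> \<open>Presenting \<open>P (i + 2)\<close> requires the representation of
    \<open>P i\<close>; for \<open>i > 0\<close> this is recovered from the presentation of
    \<open>P i\<close> by exactness.\<close>
  obtain \<Phi>0 where \<Phi>0: "realizes (P 0) 0 1 (\<lambda>_. 0) (\<lambda>_. 0) (\<lambda>_. 0) \<Phi>0"
    using realizes_vertex_projective_VY[OF lm assms(3)[unfolded K3]] by blast
  obtain \<Psi>1 where \<Psi>1: "presents (P 1) 1 {0} \<Psi>1"
    using presents_vertex_projective_VX[OF lm assms(4)[unfolded K3]] by blast
  obtain \<Psi>2 where \<Psi>2: "presents (P 2) 3 (A1.rel 0 {}) \<Psi>2"
    using tau_inverse_level_0[OF tau2 lm \<Phi>0] by blast
  obtain \<Phi>1 where \<Phi>1: "realizes (P 1) 1 3 a1 b1 c1 \<Phi>1"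
    using A1.realizes_if_presents[unfolded sum_rel_1, OF \<Psi>1] by blast
  obtain \<Psi>3 where \<Psi>3: "presents (P 3) 8 (A2.rel 0 {}) \<Psi>3"
    using tau_inverse_level_1[OF tau3 lm \<Phi>1] by blast
  obtain \<Phi>2 where \<Phi>2: "realizes (P 2) 3 8 a2 b2 c2 \<Phi>2"
    using A2.realizes_if_presents[unfolded sum_rel_2, OF \<Psi>2] by blast
  obtain \<Psi>4 where \<Psi>4: "presents (P 4) 21 (A3.rel 0 {}) \<Psi>4"
    using tau_inverse_level_2[OF tau4 lm \<Phi>2] by blast
  have "accessible K3 (P 0)"
    using accessible_vertex_projective_VY[OF assms(2)[unfolded K3] \<Phi>0] .
  moreover have "accessible K3 (P 1)" using acc_imp_accessible[OF acc_level_0[OF \<Psi>1]] .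
  moreover have "accessible K3 (P 2)" using acc_imp_accessible[OF acc_level_1[OF \<Psi>2]] .
  moreover have "accessible K3 (P 3)" using acc_imp_accessible[OF acc_level_2[OF \<Psi>3]] .
  moreover have "accessible K3 (P 4)" using acc_imp_accessible[OF acc_level_3[OF \<Psi>4]] .
  moreover have "i = 0 \<or> i = 1 \<or> i = 2 \<or> i = 3 \<or> i = 4" if "i \<le> 4" for i :: nat using that by auto
  ultimately show ?thesis unfolding K3 by blast
qed

end
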